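(* Let $\rho_0=.7614$. For every $\beta\ge 1$ there exist a real sequence $(\varepsilon_N)$ with $\varepsilon_N\to 0$ as $N\to\infty$ and a constant $C>0$ such that the following holds for every integer $N\ge 512$ and all parameters $p_T,p_\Omega\in[0,1]$ with $\min(\mathbf{E}|T|,\mathbf{E}|\Omega|)\ge 4(\beta+1)\log N$ and $$2\sqrt{\mathbf{E}|T|\cdot\mathbf{E}|\Omega|}\;\le\;\mathbf{E}|T|+\mathbf{E}|\Omega|\;\le\;\frac{N}{\sqrt{(\beta+1)\log N}}\,\bigl(\rho_0/2+\varepsilon_N\bigr).$$ Let $f=\Phi\alpha$, where the random support $\Gamma=T\cup\Omega$ and the random coefficient vector $\alpha$ supported on $\Gamma$ are sampled according to the probability model. Then with probability at least $1-C\log N\cdot N^{-\beta}$, the solution to $$(P_0)\qquad \min_{\alpha'\in\mathbb{C}^{2N}}\|\alpha'\|_{\ell_0}\quad\text{subject to}\quad \Phi\alpha'=f$$ is unique and equal to $\alpha$.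
   Context: The time-frequency dictionary is the $N\times 2N$ matrix $\Phi=(I\;\;F^* )$, where $I$ is the identity (spike basis) and $F$ is the unitary discrete Fourier matrix, $(Ff)(\omega)=\hat f(\omega)=\frac1{\sqrt N}\sum_{t=0}^{N-1}f(t)e^{-i2\pi\omega t/N}$. So for $\alpha=(\alpha_1,\alpha_2)\in\mathbb{C}^{2N}$, $(\Phi\alpha)(s)=\alpha_1(s)+\frac1{\sqrt N}\sum_{\omega}\alpha_2(\omega)e^{i2\pi\omega s/N}$. Also $\|\alpha\|_{\ell_0}$ is the number of nonzero entries of $\alpha$. Probability model: let $I_1(t)$, $t=0,\dots,N-1$, and $I_2(\omega)$, $\omega=0,\dots,N-1$, be two independent sequences of i.i.d. Bernoulli random variables with parameters $p_T$ and $p_\Omega$ respectively; $T=\{t:I_1(t)=1\}$, $\Omega=\{\omega:I_2(\omega)=1\}$, so $\mathbf{E}|T|=p_TN$, $\mathbf{E}|\Omega|=p_\Omega N$. The set $\Gamma=T\cup\Omega$ is viewed as a subset of the $2N$ column indices of $\Phi$ (a disjoint union: $T$ among the first $N$ indices, $\Omega$ among the last $N$), so $|\Gamma|=|T|+|\Omega|$. Given $(T,\Omega)$, the coefficients $\{\alpha(\gamma),\gamma\in\Gamma\}$ are i.i.d. draws from a continuous probability distribution on $\mathbb{C}$ (one having a density) that is circularly symmetric (the phase of $\alpha(\gamma)$ is uniform on $[0,2\pi)$), and $\alpha(\gamma)=0$ for $\gamma\notin\Gamma$. $\log$ is the natural logarithm. *)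

theory Defs
  imports "HOL-Probability.Probability"
begin

text \<open>
  Vectors of \<open>\<complex>\<^sup>2\<^sup>N\<close> are extensional functions on the disjoint union of two copies of
  \<open>{0..<N}\<close>: \<open>Inl t\<close> is the index of the spike at \<open>t\<close> and \<open>Inr w\<close> that of the
  sinusoid of frequency \<open>w\<close>. Vectors of \<open>\<complex>\<^sup>N\<close> are extensional functions on \<open>{..<N}\<close>.
\<close>

definition idx :: "nat \<Rightarrow> (nat + nat) set" where
  "idx N = {..<N} <+> {..<N}"

definition coeff_vecs :: "nat \<Rightarrow> (nat + nat \<Rightarrow> complex) set" where
  "coeff_vecs N = (\<Pi>\<^sub>E i\<in>idx N. UNIV)"

definition dft :: "nat \<Rightarrow> nat \<Rightarrow> nat \<Rightarrow> complex" where
  "dft N w t = exp (- (\<i> * of_real (2 * pi * real w * real t / real N))) / of_real (sqrt (real N))"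

fun Phi :: "nat \<Rightarrow> nat \<Rightarrow> nat + nat \<Rightarrow> complex" where
  "Phi N s (Inl t) = (if s = t then 1 else 0)"
| "Phi N s (Inr w) = cnj (dft N w s)"

definition synth :: "nat \<Rightarrow> (nat + nat \<Rightarrow> complex) \<Rightarrow> nat \<Rightarrow> complex" where
  "synth N a = (\<lambda>s\<in>{..<N}. \<Sum>i\<in>idx N. Phi N s i * a i)"

definition l0 :: "nat \<Rightarrow> (nat + nat \<Rightarrow> complex) \<Rightarrow> nat" where
  "l0 N a = card {i \<in> idx N. a i \<noteq> 0}"

definition P0_solutions :: "nat \<Rightarrow> (nat \<Rightarrow> complex) \<Rightarrow> (nat + nat \<Rightarrow> complex) set" where
  "P0_solutions N f = {a. is_arg_min (l0 N) (\<lambda>a'. a' \<in> coeff_vecs N \<and> synth N a' = f) a}"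

definition bernoulli_set :: "nat \<Rightarrow> real \<Rightarrow> nat set pmf" where
  "bernoulli_set N p =
     map_pmf (\<lambda>I. {t \<in> {..<N}. I t}) (Pi_pmf {..<N} False (\<lambda>_. bernoulli_pmf p))"

definition expected_card :: "nat \<Rightarrow> real \<Rightarrow> real" where
  "expected_card N p = measure_pmf.expectation (bernoulli_set N p) (\<lambda>T. real (card T))"

text \<open>
  Circular symmetry means here that the phase is uniform on \<open>[0, 2\<pi>)\<close>. This follows from
  invariance of the law under rotations about the origin, but does not require the phase
  to be independent of the modulus.
\<close>

definition circular_continuous :: "complex measure \<Rightarrow> bool" where
  "circular_continuous \<mu> \<longleftrightarrow>
     prob_space \<mu> \<and>
     (\<exists>g \<in> borel_measurable lborel. \<mu> = density lborel g) \<and>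
     distr \<mu> lborel Arg2pi = uniform_measure lborel {0..<2 * pi}"

definition coeff_law :: "nat \<Rightarrow> complex measure \<Rightarrow> nat set \<Rightarrow> nat set \<Rightarrow> (nat + nat \<Rightarrow> complex) measure" where
  "coeff_law N \<mu> T W =
     distr (\<Pi>\<^sub>M i\<in>T <+> W. \<mu>) (\<Pi>\<^sub>M i\<in>idx N. borel)
       (\<lambda>x. \<lambda>i\<in>idx N. if i \<in> T <+> W then x i else 0)"

text \<open>
  The law of the coefficient vector: draw the two supports independently, then draw the
  coefficients from their conditional law given the supports.
\<close>

definition signal_law :: "nat \<Rightarrow> real \<Rightarrow> real \<Rightarrow> complex measure \<Rightarrow> (nat + nat \<Rightarrow> complex) measure" where
  "signal_law N pT pW \<mu> =
     measure_pmf (pair_pmf (bernoulli_set N pT) (bernoulli_set N pW)) \<bind>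
       (\<lambda>(T, W). coeff_law N \<mu> T W)"

definition rho0 :: real where
  "rho0 = 7614 / 10000"

end

theory Submission
  imports Defs "HOL-Real_Asymp.Real_Asymp"
begin

text \<open>
  Uniqueness reduces to linear algebra on the support. Suppose that the columns of \<open>\<Phi>\<close> indexed by
  \<open>\<Gamma> = T <+> W\<close> together with any one further column are linearly independent. Then for every other
  index set \<open>\<Gamma>'\<close> with \<open>card \<Gamma>' \<le> card \<Gamma>\<close> some column of \<open>\<Gamma>\<close> lies outside the span of the columns of \<open>\<Gamma>'\<close>
  (lemma \<open>exists_column_outside_span\<close>). The coefficients for which the signal is also representable on
  \<open>\<Gamma>'\<close> therefore lie in a proper linear subspace, which the law of the coefficients does not charge, since its
  one-point sets are null (lemma \<open>AE_unique_solution\<close>).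

  It remains to see that a random \<open>\<Gamma>\<close> has this independence property. A dependency is a vector \<open>x\<close>
  supported on \<open>W\<close> whose inverse Fourier transform is supported on \<open>T\<close>, up to one extra index in \<open>T\<close> or \<open>W\<close>.
  Let \<open>G = F P\<^sub>T F\<^sup>*\<close>, an orthogonal projection on frequency space whose diagonal entries all equal
  \<open>card T / N\<close>, which is small. Without the extra index \<open>G x = x\<close>, so the off-diagonal part \<open>H\<close> of the
  compression of \<open>G\<close> to \<open>W\<close> maps \<open>x\<close> to nearly \<open>x\<close>; the extra index is a small perturbation
  (lemmas \<open>compression_big_time\<close> and \<open>compression_big_frequency\<close>). Hence
  \<open>\<parallel>H x\<parallel> \<ge> \<parallel>x\<parallel> / 2\<close> for some \<open>x \<noteq> 0\<close>, and then the moment \<open>tr H\<^sup>2\<^sup>n\<close> is at least \<open>4\<^sup>-\<^sup>n\<close>.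

  That moment is estimated in expectation over \<open>W\<close>, for a fixed typical \<open>T\<close>. For typical \<open>T\<close> the
  off-diagonal entries of \<open>G\<close> are of order \<open>N\<^sup>-\<^sup>1\<^sup>/\<^sup>4\<close> or less, so by a Bernstein bound every column of \<open>H\<close>
  has squared norm at most \<open>L = 2 p q + O (N\<^sup>-\<^sup>1\<^sup>/\<^sup>4)\<close>, where \<open>p\<close> and \<open>q\<close> are the densities of \<open>T\<close> and \<open>W\<close>.
  Cutting closed walks at their returns to the starting index \<open>i\<close> expresses the diagonal entry of \<open>H\<^sup>2\<^sup>n\<close> at
  \<open>i\<close> through the compression to \<open>W - {i}\<close>, which is independent of the event \<open>i \<in> W\<close>. Replacing that
  event by \<open>i \<notin> W\<close> costs a factor \<open>q / (1 - q)\<close>, and since \<open>G\<close> is a contraction this gives a recursion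
  (lemma \<open>expected_moment_recursion\<close>) whose solution is \<open>E (tr H\<^sup>2\<^sup>n) \<le> N K\<^sup>n\<close>, the expectation being restricted
  to the event that the squared column norms are at most \<open>L\<close>, as long as
  \<open>q (1 + L / K)\<^sup>2\<^sup>n \<le> K (1 - q)\<close>. With \<open>K = 1 / 16\<close> and \<open>n\<close> about \<open>(\<beta> + 1) ln N\<close> the Markov inequality
  bounds the failure probability by \<open>N 4\<^sup>-\<^sup>n \<le> N\<^sup>-\<^sup>\<beta>\<close> (lemma \<open>random_compression_bound\<close>).

  The hypothesis \<open>p + q = O (1 / sqrt (ln N))\<close> makes \<open>n L\<close> bounded, while \<open>q\<close> itself tends to \<open>0\<close> and
  absorbs all constants. The condition on \<open>K\<close> therefore holds for all large \<open>N\<close>. For small \<open>N\<close> the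
  sequence \<open>\<epsilon>\<close> takes the value \<open>-1\<close>, which makes the upper bound on the expected support size negative.
\<close>

section \<open>Kernel operators on finite index sets\<close>

definition inner_on :: "'a set \<Rightarrow> ('a \<Rightarrow> complex) \<Rightarrow> ('a \<Rightarrow> complex) \<Rightarrow> complex" where
  "inner_on I x y = (\<Sum>i\<in>I. x i * cnj (y i))"

definition norm_on :: "'a set \<Rightarrow> ('a \<Rightarrow> complex) \<Rightarrow> real" where
  "norm_on I x = L2_set (\<lambda>i. cmod (x i)) I"

definition basis_vec :: "'a \<Rightarrow> 'a \<Rightarrow> complex" where
  "basis_vec i = (\<lambda>j. if j = i then 1 else 0)"

definition kernel_op :: "'a set \<Rightarrow> ('a \<Rightarrow> 'a \<Rightarrow> complex) \<Rightarrow> ('a \<Rightarrow> complex) \<Rightarrow> 'a \<Rightarrow> complex" where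
  "kernel_op I a x = (\<lambda>i. \<Sum>j\<in>I. a i j * x j)"

definition hermitian_on :: "'a set \<Rightarrow> ('a \<Rightarrow> 'a \<Rightarrow> complex) \<Rightarrow> bool" where
  "hermitian_on I a \<longleftrightarrow> (\<forall>i\<in>I. \<forall>j\<in>I. a j i = cnj (a i j))"

lemma norm_on_nonneg [simp]: "norm_on I x \<ge> 0"
  by (simp add: norm_on_def)

lemma norm_on_sq: "(norm_on I x)\<^sup>2 = (\<Sum>i\<in>I. (cmod (x i))\<^sup>2)"
  by (simp add: norm_on_def L2_set_def sum_nonneg)

lemma inner_on_self: "inner_on I x x = of_real ((norm_on I x)\<^sup>2)"
  by (simp add: inner_on_def norm_on_sq complex_norm_square[symmetric] of_real_power[symmetric] del: of_real_power)

lemma norm_on_triangle: "norm_on I (\<lambda>i. x i + y i) \<le> norm_on I x + norm_on I y"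
proof -
  have "norm_on I (\<lambda>i. x i + y i) \<le> L2_set (\<lambda>i. cmod (x i) + cmod (y i)) I"
    unfolding norm_on_def by (intro L2_set_mono norm_triangle_ineq) auto
  also have "\<dots> \<le> norm_on I x + norm_on I y"
    unfolding norm_on_def by (rule L2_set_triangle_ineq)
  finally show ?thesis .
qed

lemma norm_on_scale: "norm_on I (\<lambda>i. c * x i) = cmod c * norm_on I x"
  by (simp add: norm_on_def norm_mult L2_set_right_distrib)

lemma norm_on_zero [simp]: "norm_on I (\<lambda>i. 0) = 0"
  by (simp add: norm_on_def L2_set_def)

lemma norm_on_sum: "finite J \<Longrightarrow> norm_on I (\<lambda>i. \<Sum>j\<in>J. x j i) \<le> (\<Sum>j\<in>J. norm_on I (x j))"
proof (induction J rule: finite_induct)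
  case (insert j J)
  then show ?case using norm_on_triangle[of I "x j" "\<lambda>i. \<Sum>j\<in>J. x j i"] by simp
qed simp

lemma Cauchy_Schwarz_inner_on: "cmod (inner_on I x y) \<le> norm_on I x * norm_on I y"
proof -
  have "cmod (inner_on I x y) \<le> (\<Sum>i\<in>I. \<bar>cmod (x i)\<bar> * \<bar>cmod (y i)\<bar>)"
    unfolding inner_on_def by (rule order_trans[OF norm_sum]) (simp add: norm_mult)
  also have "\<dots> \<le> norm_on I x * norm_on I y"
    unfolding norm_on_def by (rule L2_set_mult_ineq)
  finally show ?thesis .
qed

lemma norm_on_cong: "(\<And>i. i \<in> I \<Longrightarrow> x i = y i) \<Longrightarrow> norm_on I x = norm_on I y"
  unfolding norm_on_def by (rule L2_set_cong) auto

lemma norm_on_eq_0: "finite I \<Longrightarrow> norm_on I x = 0 \<Longrightarrow> i \<in> I \<Longrightarrow> x i = 0"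
  unfolding norm_on_def by (simp add: L2_set_eq_0_iff)

lemma inner_on_basis_vec: "finite I \<Longrightarrow> i \<in> I \<Longrightarrow> inner_on I x (basis_vec i) = x i"
  unfolding inner_on_def basis_vec_def by (simp add: if_distrib sum.If_cases cong: if_cong)

lemma inner_on_adjoint:
  assumes herm: "hermitian_on I a"
  shows "inner_on I (kernel_op I a x) y = inner_on I x (kernel_op I a y)"
proof -
  have "inner_on I (kernel_op I a x) y = (\<Sum>i\<in>I. \<Sum>j\<in>I. a i j * x j * cnj (y i))"
    unfolding inner_on_def kernel_op_def by (simp add: sum_distrib_right)
  also have "\<dots> = (\<Sum>j\<in>I. \<Sum>i\<in>I. a i j * x j * cnj (y i))"
    by (rule sum.swap)
  also have "\<dots> = (\<Sum>j\<in>I. \<Sum>i\<in>I. x j * cnj (a j i * y i))"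
    proof (intro sum.cong refl)
    fix i j assume "i \<in> I" "j \<in> I"
    then have "cnj (a j i) = a i j" using herm unfolding hermitian_on_def by (metis complex_cnj_cnj)
    then show "a i j * x j * cnj (y i) = x j * cnj (a j i * y i)" by simp
  qed
  also have "\<dots> = inner_on I x (kernel_op I a y)"
    unfolding inner_on_def kernel_op_def by (simp add: sum_distrib_left)
  finally show ?thesis .
qed

lemma inner_on_adjoint_pow:
  assumes herm: "hermitian_on I a"
  shows "inner_on I ((kernel_op I a ^^ k) x) y = inner_on I x ((kernel_op I a ^^ k) y)"
proof (induction k arbitrary: y)
  case (Suc k)
  have "inner_on I ((kernel_op I a ^^ Suc k) x) y = inner_on I ((kernel_op I a ^^ k) x) (kernel_op I a y)"
    using inner_on_adjoint[OF herm] by simp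
  also have "\<dots> = inner_on I x ((kernel_op I a ^^ k) (kernel_op I a y))" by (rule Suc.IH)
  also have "\<dots> = inner_on I x ((kernel_op I a ^^ Suc k) y)" by (simp add: funpow_swap1)
  finally show ?case .
qed simp

lemma inner_on_pow_pow:
  assumes herm: "hermitian_on I a"
  shows "inner_on I ((kernel_op I a ^^ k) x) ((kernel_op I a ^^ l) x) = inner_on I ((kernel_op I a ^^ (k + l)) x) x"
proof -
  have "inner_on I ((kernel_op I a ^^ (l + k)) x) x = inner_on I ((kernel_op I a ^^ l) ((kernel_op I a ^^ k) x)) x"
    by (simp add: funpow_add)
  then show ?thesis using inner_on_adjoint_pow[OF herm, of l "(kernel_op I a ^^ k) x" x]
    by (simp add: add.commute)
qed

text \<open>
  Cauchy--Schwarz applied to \<open>\<parallel>H\<^sup>k\<^sup>+\<^sup>1 x\<parallel>\<^sup>2 = \<langle>H\<^sup>k x, H\<^sup>k\<^sup>+\<^sup>2 x\<rangle>\<close>. This log-convexity does the work of the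
  spectral theorem in what follows.
\<close>

lemma norm_on_pow_log_convex:
  assumes herm: "hermitian_on I a"
  shows "(norm_on I ((kernel_op I a ^^ Suc k) x))\<^sup>2 \<le> norm_on I ((kernel_op I a ^^ k) x) * norm_on I ((kernel_op I a ^^ Suc (Suc k)) x)"
proof -
  let ?H = "\<lambda>k. (kernel_op I a ^^ k) x"
  have "inner_on I (?H (Suc k)) (?H (Suc k)) = inner_on I (?H k) (?H (Suc (Suc k)))"
    using inner_on_pow_pow[OF herm, of "Suc k" x "Suc k"] inner_on_pow_pow[OF herm, of k x "Suc (Suc k)"] by simp
  then have "cmod (of_real ((norm_on I (?H (Suc k)))\<^sup>2)) = cmod (inner_on I (?H k) (?H (Suc (Suc k))))"
    by (simp add: inner_on_self)
  then have "(norm_on I (?H (Suc k)))\<^sup>2 = cmod (inner_on I (?H k) (?H (Suc (Suc k))))"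
    by (simp add: norm_power)
  then show ?thesis using Cauchy_Schwarz_inner_on by metis
qed

section \<open>Log-convex sequences and first returns\<close>

text \<open>
  The ratios \<open>v (k + 1) / v k\<close> are nondecreasing; the product form also covers vanishing terms.
\<close>

lemma log_convex_shift:
  fixes v :: "nat \<Rightarrow> real"
  assumes nn: "\<And>k. v k \<ge> 0" and lc: "\<And>k. (v (Suc k))\<^sup>2 \<le> v k * v (Suc (Suc k))" and "a \<le> b"
  shows "v (Suc a) * v b \<le> v a * v (Suc b)"
  using \<open>a \<le> b\<close>
proof (induction b rule: dec_induct)
  case base
  show ?case by (simp add: mult.commute)
next
  case (step b)
  show ?case
  proof (cases "v b = 0")
    case True
    then have "v (Suc b) = 0" using lc[of b] by simp
    then show ?thesis by (simp add: nn)
  next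
    case False
    then have pos: "v b > 0" using nn[of b] by simp
    have "v b * (v (Suc a) * v (Suc b)) = (v (Suc a) * v b) * v (Suc b)" by (simp add: ac_simps)
    also have "\<dots> \<le> (v a * v (Suc b)) * v (Suc b)"
      using step.IH nn by (intro mult_right_mono) auto
    also have "\<dots> = v a * (v (Suc b))\<^sup>2" by (simp add: power2_eq_square)
    also have "\<dots> \<le> v a * (v b * v (Suc (Suc b)))" using lc nn by (intro mult_left_mono) auto
    also have "\<dots> = v b * (v a * v (Suc (Suc b)))" by (simp add: ac_simps)
    finally show ?thesis using pos by simp
  qed
qed

lemma log_convex_mult:
  fixes v :: "nat \<Rightarrow> real"
  assumes nn: "\<And>k. v k \<ge> 0" and lc: "\<And>k. (v (Suc k))\<^sup>2 \<le> v k * v (Suc (Suc k))"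
  shows "v a * v b \<le> v 0 * v (a + b)"
proof -
  have *: "v a * v b \<le> v 0 * v (a + b)" if "a \<le> b" for a b
    using that
  proof (induction a arbitrary: b)
    case (Suc a)
    have "v (Suc a) * v b \<le> v a * v (Suc b)"
      using Suc.prems by (intro log_convex_shift nn lc) auto
    also have "\<dots> \<le> v 0 * v (a + Suc b)" using Suc.prems by (intro Suc.IH) auto
    finally show ?case by simp
  qed simp
  show ?thesis
    using *[of a b] *[of b a] by (cases "a \<le> b") (auto simp: ac_simps)
qed

text \<open>
  The first ratio bounds all later ones from below. For \<open>v k = \<parallel>H\<^sup>k x\<parallel>\<close> it turns \<open>\<parallel>H x\<parallel> \<ge> \<theta> \<parallel>x\<parallel>\<close> into
  \<open>\<parallel>H\<^sup>n x\<parallel> \<ge> \<theta>\<^sup>n \<parallel>x\<parallel>\<close>.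
\<close>

lemma log_convex_growth:
  fixes v :: "nat \<Rightarrow> real"
  assumes nn: "\<And>k. v k \<ge> 0" and lc: "\<And>k. (v (Suc k))\<^sup>2 \<le> v k * v (Suc (Suc k))"
    and "\<theta> > 0" and "v 1 \<ge> \<theta> * v 0"
  shows "v n \<ge> \<theta> ^ n * v 0"
proof (cases "v 0 = 0")
  case True then show ?thesis using nn by simp
next
  case False
  have "v k > 0 \<and> v (Suc k) \<ge> \<theta> * v k" for k
  proof (induction k)
    case 0 show ?case using assms(4) False nn[of 0] by simp
  next
    case (Suc k)
    then have p: "v (Suc k) > 0" using \<open>\<theta> > 0\<close> by (smt (verit) mult_pos_pos)
    have "v k * (\<theta> * v (Suc k)) \<le> v (Suc k) * v (Suc k)"
      using Suc p by (simp add: mult.assoc[symmetric] mult.commute[of "v k"])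
    also have "\<dots> \<le> v k * v (Suc (Suc k))" using lc[of k] by (simp add: power2_eq_square)
    finally show ?case using p Suc by simp
  qed
  then have g: "v (Suc k) \<ge> \<theta> * v k" for k by blast
  show ?thesis
  proof (induction n)
    case (Suc n)
    have "\<theta> ^ Suc n * v 0 = \<theta> * (\<theta> ^ n * v 0)" by simp
    also have "\<dots> \<le> \<theta> * v n" using Suc \<open>\<theta> > 0\<close> by (intro mult_left_mono) auto
    also have "\<dots> \<le> v (Suc n)" by (rule g)
    finally show ?case .
  qed simp
qed

text \<open>
  The recursion is the first-return decomposition of closed walks of length \<open>k\<close>: an excursion of length
  \<open>j + 2\<close> has weight \<open>y j\<close>, and \<open>h\<close> is the total weight. Merging the \<open>r + 1\<close> excursions of a walk into a
  single one costs \<open>L\<^sup>r\<close>, and the walks with \<open>r + 1\<close> excursions have at most \<open>k choose r\<close> choices of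
  return times; the hockey-stick identity carries this count through the induction.
\<close>

lemma first_return_bound:
  fixes h y :: "nat \<Rightarrow> complex" and z :: "nat \<Rightarrow> real"
  assumes h0: "h 0 = 1" and h1: "h (Suc 0) = 0"
    and rec: "\<And>k. h (Suc (Suc k)) = (\<Sum>j\<le>k. h (k - j) * y j)"
    and yz: "\<And>j. cmod (y j) \<le> z j" and z2: "\<And>a b. z a * z b \<le> L * z (a + b)" and L: "L \<ge> 0"
    and "k \<ge> 1"
  shows "cmod (h k) \<le> (\<Sum>r | 2 * r + 2 \<le> k. real (k choose r) * L ^ r * z (k - 2 - 2 * r))"
  using \<open>k \<ge> 1\<close>
proof (induction k rule: less_induct)
  case (less k)
  have z0: "z j \<ge> 0" for j using yz[of j] by (meson norm_ge_zero order_trans)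
  have fin: "finite {r. 2 * r + 2 \<le> m}" for m :: nat
    by (rule finite_subset[of _ "{..m}"]) auto
  show ?case
  proof (cases "k = 1")
    case True then show ?thesis using h1 by (auto intro!: sum_nonneg)
  next
    case False
    then obtain l where k: "k = Suc (Suc l)" using less.prems by (metis One_nat_def Suc_le_D not0_implies_Suc)
    have "cmod (h k) \<le> (\<Sum>j\<le>l. cmod (h (l - j)) * z j)"
      unfolding k rec by (rule order_trans[OF norm_sum]) (auto intro!: sum_mono mult_left_mono yz simp: norm_mult)
    also have "\<dots> = (\<Sum>j<l. cmod (h (l - j)) * z j) + z l"
      by (simp add: lessThan_Suc_atMost[symmetric] h0)
    also have "(\<Sum>j<l. cmod (h (l - j)) * z j)
        \<le> (\<Sum>j<l. \<Sum>r | 2 * r + 2 \<le> l. real (l - j choose r) * L ^ Suc r * z (l - 2 - 2 * r))"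
    proof (intro sum_mono)
      fix j assume j: "j \<in> {..<l}"
      have "cmod (h (l - j)) * z j \<le>
          (\<Sum>r | 2 * r + 2 \<le> l - j. real (l - j choose r) * L ^ r * z (l - j - 2 - 2 * r)) * z j"
        using j k by (intro mult_right_mono less.IH z0) auto
      also have "\<dots> = (\<Sum>r | 2 * r + 2 \<le> l - j. real (l - j choose r) * L ^ r * (z (l - j - 2 - 2 * r) * z j))"
        by (simp add: sum_distrib_right mult.assoc)
      also have "\<dots> \<le> (\<Sum>r | 2 * r + 2 \<le> l - j. real (l - j choose r) * L ^ Suc r * z (l - 2 - 2 * r))"
      proof (intro sum_mono)
        fix r assume r: "r \<in> {r. 2 * r + 2 \<le> l - j}"
        have "z (l - j - 2 - 2 * r) * z j \<le> L * z (l - j - 2 - 2 * r + j)" by (rule z2)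
        also have "l - j - 2 - 2 * r + j = l - 2 - 2 * r" using r j by auto
        finally have "real (l - j choose r) * L ^ r * (z (l - j - 2 - 2 * r) * z j)
            \<le> real (l - j choose r) * L ^ r * (L * z (l - 2 - 2 * r))"
          using L by (intro mult_left_mono) auto
        then show "real (l - j choose r) * L ^ r * (z (l - j - 2 - 2 * r) * z j)
            \<le> real (l - j choose r) * L ^ Suc r * z (l - 2 - 2 * r)" by (simp add: ac_simps)
      qed
      also have "\<dots> \<le> (\<Sum>r | 2 * r + 2 \<le> l. real (l - j choose r) * L ^ Suc r * z (l - 2 - 2 * r))"
        using L z0 by (intro sum_mono2 fin) auto
      finally show "cmod (h (l - j)) * z j \<le> \<dots>" .
    qed
    also have "\<dots> = (\<Sum>r | 2 * r + 2 \<le> l. real (\<Sum>j<l. l - j choose r) * L ^ Suc r * z (l - 2 - 2 * r))"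
      by (subst sum.swap) (simp add: sum_distrib_right)
    also have "\<dots> \<le> (\<Sum>r | 2 * r + 2 \<le> l. real (k choose Suc r) * L ^ Suc r * z (l - 2 - 2 * r))"
    proof (intro sum_mono mult_right_mono)
      fix r
      have "(\<Sum>j<l. l - j choose r) = (\<Sum>i\<in>{1..l}. i choose r)"
        by (rule sum.reindex_bij_witness[of _ "\<lambda>i. l - i" "\<lambda>j. l - j"]) auto
      also have "\<dots> \<le> (\<Sum>i\<le>l. i choose r)" by (rule sum_mono2) auto
      also have "\<dots> = Suc l choose Suc r" by (rule sum_choose_upper)
      also have "\<dots> \<le> k choose Suc r" unfolding k by (rule binomial_right_mono) auto
      finally show "real (\<Sum>j<l. l - j choose r) \<le> real (k choose Suc r)" by (rule of_nat_mono)
    qed (use L z0 in auto)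
    finally have "cmod (h k) \<le> (\<Sum>r | 2 * r + 2 \<le> l. real (k choose Suc r) * L ^ Suc r * z (l - 2 - 2 * r)) + z l"
      by simp
    also have "\<dots> = (\<Sum>r\<in>insert 0 (Suc ` {r. 2 * r + 2 \<le> l}). real (k choose r) * L ^ r * z (k - 2 - 2 * r))"
      using finite_imageI[OF fin[of l], of Suc] by (subst sum.insert) (auto simp: sum.reindex k)
    also have "insert 0 (Suc ` {r. 2 * r + 2 \<le> l}) = {r. 2 * r + 2 \<le> k}"
      using k by (auto simp: image_iff) presburger
    finally show ?thesis .
  qed
qed

section \<open>Off-diagonal compressions\<close>

text \<open>
  The kernel keeps the full index set and vanishes outside \<open>W\<close>, so that compressions to different sets act
  on the same vectors.
\<close>

definition offdiag :: "('a \<Rightarrow> 'a \<Rightarrow> complex) \<Rightarrow> 'a set \<Rightarrow> 'a \<Rightarrow> 'a \<Rightarrow> complex" where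
  "offdiag g W i j = (if i \<in> W \<and> j \<in> W \<and> i \<noteq> j then g i j else 0)"

text \<open>
  For \<open>i \<in> W\<close> this is column \<open>i\<close> of \<open>offdiag g W\<close>; for \<open>i \<notin> W\<close> it is the restriction to \<open>W\<close> of column \<open>i\<close>
  of \<open>g\<close>. Both cases are needed with the same definition because \<open>i\<close> moves out of \<open>W\<close> in the moment
  recursion.
\<close>

definition punctured_col :: "('a \<Rightarrow> 'a \<Rightarrow> complex) \<Rightarrow> 'a set \<Rightarrow> 'a \<Rightarrow> 'a \<Rightarrow> complex" where
  "punctured_col g W i = (\<lambda>j. if j \<in> W - {i} then g j i else 0)"

definition compression_pow :: "'a set \<Rightarrow> ('a \<Rightarrow> 'a \<Rightarrow> complex) \<Rightarrow> 'a set \<Rightarrow> nat \<Rightarrow> ('a \<Rightarrow> complex) \<Rightarrow> 'a \<Rightarrow> complex" where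
  "compression_pow I g W n = kernel_op I (offdiag g W) ^^ n"

lemma hermitian_offdiag: "hermitian_on I g \<Longrightarrow> W \<subseteq> I \<Longrightarrow> hermitian_on I (offdiag g W)"
  unfolding hermitian_on_def offdiag_def by (metis complex_cnj_zero)

lemma kernel_op_lincomb:
  "kernel_op I a (\<lambda>j. c * u j + (\<Sum>l\<in>S. d l * x l j)) = (\<lambda>j. c * kernel_op I a u j + (\<Sum>l\<in>S. d l * kernel_op I a (x l) j))"
proof
  fix i
  have "kernel_op I a (\<lambda>j. c * u j + (\<Sum>l\<in>S. d l * x l j)) i
      = (\<Sum>j\<in>I. c * (a i j * u j)) + (\<Sum>j\<in>I. \<Sum>l\<in>S. d l * (a i j * x l j))"
    by (simp add: kernel_op_def algebra_simps sum.distrib sum_distrib_left)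
  also have "(\<Sum>j\<in>I. \<Sum>l\<in>S. d l * (a i j * x l j)) = (\<Sum>l\<in>S. \<Sum>j\<in>I. d l * (a i j * x l j))"
    by (rule sum.swap)
  finally show "kernel_op I a (\<lambda>j. c * u j + (\<Sum>l\<in>S. d l * x l j)) i
      = c * kernel_op I a u i + (\<Sum>l\<in>S. d l * kernel_op I a (x l) i)"
    by (simp add: kernel_op_def sum_distrib_left)
qed

lemma kernel_op_sum: "kernel_op I a (\<lambda>j. \<Sum>l\<in>S. d l * x l j) = (\<lambda>j. \<Sum>l\<in>S. d l * kernel_op I a (x l) j)"
  using kernel_op_lincomb[where c = 0] by simp

lemma kernel_op_pow_sum:
  "(kernel_op I a ^^ n) (\<lambda>j. \<Sum>l\<in>S. d l * x l j) = (\<lambda>j. \<Sum>l\<in>S. d l * (kernel_op I a ^^ n) (x l) j)"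
  by (induction n) (simp_all add: kernel_op_sum)

lemma kernel_op_basis_vec: "finite I \<Longrightarrow> i \<in> I \<Longrightarrow> kernel_op I a (basis_vec i) = (\<lambda>j. a j i)"
  unfolding kernel_op_def basis_vec_def by (simp add: if_distrib sum.If_cases cong: if_cong)

lemma compression_pow_outside:
  assumes "\<And>j. j \<notin> W \<Longrightarrow> x j = 0" "j \<notin> W"
  shows "compression_pow I g W n x j = 0"
  using assms by (cases n) (auto simp: compression_pow_def kernel_op_def offdiag_def)

text \<open>
  On vectors that live on \<open>W - {i}\<close>, the compressions to \<open>W\<close> and to \<open>W - {i}\<close> differ only in the entry at
  \<open>i\<close>.
\<close>

lemma kernel_op_offdiag_remove:
  assumes "i \<in> W" "W \<subseteq> I" and herm: "hermitian_on I g" and x: "\<And>j. j \<notin> W - {i} \<Longrightarrow> x j = 0"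
  shows "kernel_op I (offdiag g W) x = (\<lambda>j. inner_on I x (punctured_col g W i) * basis_vec i j + kernel_op I (offdiag g (W - {i})) x j)"
proof
  fix j
  show "kernel_op I (offdiag g W) x j = inner_on I x (punctured_col g W i) * basis_vec i j + kernel_op I (offdiag g (W - {i})) x j"
  proof (cases "j = i")
    case True
    have "offdiag g W i k * x k = x k * cnj (punctured_col g W i k)" if "k \<in> I" for k
    proof (cases "k \<in> W - {i}")
      case True
      then have "cnj (g k i) = g i k" using herm assms(1,2) that unfolding hermitian_on_def
        by (metis complex_cnj_cnj in_mono)
      then show ?thesis using True \<open>i \<in> W\<close> by (auto simp: offdiag_def punctured_col_def)
    qed (use x in auto)
    then have "kernel_op I (offdiag g W) x i = inner_on I x (punctured_col g W i)"
      unfolding kernel_op_def inner_on_def by (intro sum.cong refl)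
    moreover have "kernel_op I (offdiag g (W - {i})) x i = 0" by (simp add: kernel_op_def offdiag_def)
    ultimately show ?thesis using True by (simp add: basis_vec_def)
  next
    case False
    have "offdiag g W j k * x k = offdiag g (W - {i}) j k * x k" for k
      using x[of k] False by (auto simp: offdiag_def)
    then have "kernel_op I (offdiag g W) x j = kernel_op I (offdiag g (W - {i})) x j"
      unfolding kernel_op_def by (intro sum.cong refl)
    then show ?thesis using False by (simp add: basis_vec_def)
  qed
qed

text \<open>
  A closed walk at \<open>i\<close> splits at its returns to \<open>i\<close> into excursions through \<open>W - {i}\<close>; an excursion
  of \<open>j + 2\<close> steps contributes \<open>\<langle>H'\<^sup>j c, c\<rangle>\<close>, where \<open>H'\<close> is the compression to \<open>W - {i}\<close> and \<open>c\<close> is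
  column \<open>i\<close>. By log-convexity a product of excursions costs at most a factor \<open>\<parallel>c\<parallel>\<^sup>2\<close> for each
  extra excursion. The right-hand side involves \<open>W\<close> only through \<open>W - {i}\<close>, which is what makes the
  expectation over \<open>W\<close> accessible.
\<close>

lemma first_return_column_bound:
  assumes fin: "finite I" and herm: "hermitian_on I g" and W: "W \<subseteq> I" and i: "i \<in> W"
    and L: "(norm_on I (punctured_col g W i))\<^sup>2 \<le> L" and n: "n \<ge> 1"
  shows "(norm_on I (compression_pow I g W n (basis_vec i)))\<^sup>2
    \<le> (\<Sum>r<n. real (2 * n choose r) * L ^ r * (norm_on I (compression_pow I g (W - {i}) (n - 1 - r) (punctured_col g W i)))\<^sup>2)"
proof -
  define c where "c = punctured_col g W i"
  define x where "x l = compression_pow I g (W - {i}) l c" for l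
  \<comment> \<open>\<open>h k\<close> is the weight of all closed walks of length \<open>k\<close> at \<open>i\<close>, \<open>y j\<close> that of a single excursion.\<close>
  define h where "h k = compression_pow I g W k (basis_vec i) i" for k
  define y where "y l = inner_on I (x l) c" for l
  define v where "v l = norm_on I (x l)" for l
  \<comment> \<open>For odd \<open>j\<close> the numbers \<open>y j\<close> have no sign and no convexity of their own; \<open>z\<close> interpolates the even ones.\<close>
  define z where "z j = v (j div 2) * v ((j + 1) div 2)" for j
  have iI: "i \<in> I" using W i by auto
  have hW: "hermitian_on I (offdiag g W)" and hW': "hermitian_on I (offdiag g (W - {i}))"
    using W by (auto intro!: hermitian_offdiag herm)
  have c0: "c j = 0" if "j \<notin> W - {i}" for j using that unfolding c_def punctured_col_def by auto
  have x_out: "x l j = 0" if "j \<notin> W - {i}" for l j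
    unfolding x_def by (rule compression_pow_outside[OF c0 that])
  have x_Suc: "x (Suc l) = kernel_op I (offdiag g (W - {i})) (x l)" for l by (simp add: x_def compression_pow_def)
  have Hx: "kernel_op I (offdiag g W) (x l) = (\<lambda>j. y l * basis_vec i j + x (Suc l) j)" for l
    unfolding y_def c_def x_Suc by (rule kernel_op_offdiag_remove[OF i W herm]) (rule x_out)
  have He: "kernel_op I (offdiag g W) (basis_vec i) = x 0"
    unfolding kernel_op_basis_vec[OF fin iI] x_def compression_pow_def c_def punctured_col_def offdiag_def
    using i by (simp add: fun_eq_iff)
  have unit_ii: "basis_vec i i = 1" by (simp add: basis_vec_def)
  have step: "compression_pow I g W (Suc k) (basis_vec i)
      = (\<lambda>j. (\<Sum>l<k. h (k - Suc l) * y l) * basis_vec i j + (\<Sum>l\<le>k. h (k - l) * x l j))"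
    if "compression_pow I g W k (basis_vec i) = (\<lambda>j. h k * basis_vec i j + (\<Sum>l<k. h (k - Suc l) * x l j))" for k
  proof -
    have "compression_pow I g W (Suc k) (basis_vec i) = kernel_op I (offdiag g W) (\<lambda>j. h k * basis_vec i j + (\<Sum>l<k. h (k - Suc l) * x l j))"
      by (simp add: compression_pow_def that[unfolded compression_pow_def])
    also have "\<dots> = (\<lambda>j. h k * x 0 j + (\<Sum>l<k. h (k - Suc l) * (y l * basis_vec i j + x (Suc l) j)))"
      unfolding kernel_op_lincomb He Hx ..
    also have "\<dots> = (\<lambda>j. (\<Sum>l<k. h (k - Suc l) * y l) * basis_vec i j + (\<Sum>l<Suc k. h (k - l) * x l j))"
      unfolding sum.lessThan_Suc_shift
      by (simp add: algebra_simps sum.distrib sum_distrib_left sum_distrib_right)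
    finally show ?thesis by (simp add: lessThan_Suc_atMost)
  qed
  \<comment> \<open>Decomposition at the last visit to \<open>i\<close>.\<close>
  have expand: "compression_pow I g W k (basis_vec i) = (\<lambda>j. h k * basis_vec i j + (\<Sum>l<k. h (k - Suc l) * x l j))" for k
  proof (induction k)
    case 0 show ?case by (simp add: compression_pow_def h_def unit_ii)
  next
    case (Suc k)
    note s = step[OF Suc.IH]
    have "h (Suc k) = (\<Sum>l<k. h (k - Suc l) * y l)"
      using fun_cong[OF s, of i] x_out by (simp add: h_def unit_ii)
    then show ?case using s by (simp add: lessThan_Suc_atMost)
  qed
  have h_rec: "h (Suc k) = (\<Sum>l<k. h (k - Suc l) * y l)" for k
    using fun_cong[OF step[OF expand], of k i] x_out by (simp add: h_def unit_ii)
  have h_rec2: "h (Suc (Suc k)) = (\<Sum>l\<le>k. h (k - l) * y l)" for k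
    using h_rec[of "Suc k"] by (simp add: lessThan_Suc_atMost)
  have nn: "v k \<ge> 0" for k by (simp add: v_def)
  have lc: "(v (Suc k))\<^sup>2 \<le> v k * v (Suc (Suc k))" for k
    unfolding v_def x_def compression_pow_def by (rule norm_on_pow_log_convex[OF hW'])
  have vv: "v a * v b \<le> v 0 * v (a + b)" for a b by (rule log_convex_mult[of v, OF nn lc])
  have yz: "cmod (y j) \<le> z j" for j
  proof -
    have "j div 2 + (j + 1) div 2 = j" by presburger
    then have "y j = inner_on I (x (j div 2)) (x ((j + 1) div 2))"
      unfolding y_def x_def compression_pow_def inner_on_pow_pow[OF hW'] by simp
    then show ?thesis unfolding z_def v_def using Cauchy_Schwarz_inner_on by metis
  qed
  have v0: "v 0 * v 0 \<le> L" using L unfolding v_def x_def compression_pow_def c_def by (simp add: power2_eq_square)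
  have vvvv: "(v a * v b) * (v a' * v b') \<le> L * (v (a + a') * v (b + b'))" for a b a' b'
  proof -
    have "(v a * v b) * (v a' * v b') = (v a * v a') * (v b * v b')" by (simp add: ac_simps)
    also have "\<dots> \<le> (v 0 * v (a + a')) * (v 0 * v (b + b'))" by (rule mult_mono) (auto intro: mult_nonneg_nonneg vv nn)
    also have "\<dots> = (v 0 * v 0) * (v (a + a') * v (b + b'))" by (simp add: ac_simps)
    also have "\<dots> \<le> L * (v (a + a') * v (b + b'))" using v0 nn by (intro mult_right_mono) auto
    finally show ?thesis .
  qed
  have z2: "z a * z b \<le> L * z (a + b)" for a b
  proof (cases "even a \<or> even b")
    case True
    then have "(a + b) div 2 = a div 2 + b div 2" "(a + b + 1) div 2 = (a + 1) div 2 + (b + 1) div 2"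
      by presburger+
    then show ?thesis unfolding z_def using vvvv by simp
  next
    case False
    then have "(a + b) div 2 = a div 2 + (b + 1) div 2" "(a + b + 1) div 2 = (a + 1) div 2 + b div 2"
      by presburger+
    then show ?thesis unfolding z_def
      using vvvv[of "a div 2" "(a + 1) div 2" "(b + 1) div 2" "b div 2"] by (simp add: mult.commute[of "v (Suc b div 2)"])
  qed
  have "L \<ge> 0" using L by (meson order_trans zero_le_power2)
  have "cmod (h (2 * n)) \<le> (\<Sum>r | 2 * r + 2 \<le> 2 * n. real (2 * n choose r) * L ^ r * z (2 * n - 2 - 2 * r))"
    using n \<open>L \<ge> 0\<close> h_rec[of 0]
    by (intro first_return_bound[where y = y] h_rec2 yz z2) (auto simp: h_def compression_pow_def unit_ii)
  also have "{r. 2 * r + 2 \<le> 2 * n} = {..<n}" by auto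
  also have "(\<Sum>r<n. real (2 * n choose r) * L ^ r * z (2 * n - 2 - 2 * r)) = (\<Sum>r<n. real (2 * n choose r) * L ^ r * (v (n - 1 - r))\<^sup>2)"
  proof (intro sum.cong refl)
    fix r assume "r \<in> {..<n}"
    then have "2 * n - 2 - 2 * r = 2 * (n - 1 - r)" by auto
    then show "real (2 * n choose r) * L ^ r * z (2 * n - 2 - 2 * r) = real (2 * n choose r) * L ^ r * (v (n - 1 - r))\<^sup>2"
      by (simp add: z_def power2_eq_square)
  qed
  also have "h (2 * n) = of_real ((norm_on I (compression_pow I g W n (basis_vec i)))\<^sup>2)"
    unfolding inner_on_self[symmetric] unfolding compression_pow_def inner_on_pow_pow[OF hW]
    unfolding inner_on_basis_vec[OF fin iI] h_def compression_pow_def by (simp add: mult_2)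
  finally show ?thesis by (simp add: norm_power v_def x_def c_def)
qed

text \<open>
  For \<open>i\<close> outside \<open>W\<close> the punctured column is \<open>P\<^sub>W G e\<^sub>i\<close>. Since \<open>G\<close> is a contraction,
  the sum over \<open>i\<close> of \<open>\<parallel>H\<^sup>n P\<^sub>W G e\<^sub>i\<parallel>\<^sup>2\<close> is at most the squared Hilbert--Schmidt norm of \<open>H\<^sup>n P\<^sub>W\<close>.
\<close>

lemma sum_columns_outside_le:
  assumes fin: "finite I" and herm: "hermitian_on I g" and W: "W \<subseteq> I"
    and contr: "\<And>x. norm_on I (kernel_op I g x) \<le> norm_on I x"
  shows "(\<Sum>i\<in>I - W. (norm_on I (compression_pow I g W n (punctured_col g W i)))\<^sup>2) \<le> (\<Sum>i\<in>W. (norm_on I (compression_pow I g W n (basis_vec i)))\<^sup>2)"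
proof -
  define d where "d j = compression_pow I g W n (basis_vec j)" for j
  have d0: "d j l = 0" if "j \<in> W" "l \<notin> W" for j l
    unfolding d_def using that by (intro compression_pow_outside) (auto simp: basis_vec_def)
  have finW: "finite W" using W fin finite_subset by blast
  have entry: "cmod (compression_pow I g W n (punctured_col g W i) j) = cmod (kernel_op I g (d j) i)" if "i \<in> I - W" "j \<in> W" for i j
  proof -
    have "compression_pow I g W n (punctured_col g W i) j = inner_on I (compression_pow I g W n (punctured_col g W i)) (basis_vec j)"
      using that W fin by (subst inner_on_basis_vec) auto
    also have "\<dots> = inner_on I (punctured_col g W i) (d j)"
      unfolding d_def compression_pow_def by (rule inner_on_adjoint_pow[OF hermitian_offdiag[OF herm W]])
    also have "\<dots> = (\<Sum>l\<in>I. cnj (g i l * d j l))"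
      unfolding inner_on_def
    proof (intro sum.cong refl)
      fix l assume "l \<in> I"
      then have "g l i = cnj (g i l)" using herm that unfolding hermitian_on_def by blast
      then show "punctured_col g W i l * cnj (d j l) = cnj (g i l * d j l)"
        using d0[OF that(2), of l] that by (auto simp: punctured_col_def)
    qed
    also have "\<dots> = cnj (kernel_op I g (d j) i)" by (simp add: kernel_op_def)
    finally show ?thesis by simp
  qed
  have "(\<Sum>i\<in>I - W. (norm_on I (compression_pow I g W n (punctured_col g W i)))\<^sup>2)
      = (\<Sum>i\<in>I - W. \<Sum>j\<in>W. (cmod (compression_pow I g W n (punctured_col g W i) j))\<^sup>2)"
    unfolding norm_on_sq using W fin
    by (intro sum.cong refl sum.mono_neutral_right) (auto intro!: compression_pow_outside simp: punctured_col_def)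
  also have "\<dots> = (\<Sum>i\<in>I - W. \<Sum>j\<in>W. (cmod (kernel_op I g (d j) i))\<^sup>2)"
    by (intro sum.cong refl) (simp add: entry)
  also have "\<dots> = (\<Sum>j\<in>W. \<Sum>i\<in>I - W. (cmod (kernel_op I g (d j) i))\<^sup>2)" by (rule sum.swap)
  also have "\<dots> \<le> (\<Sum>j\<in>W. (norm_on I (kernel_op I g (d j)))\<^sup>2)"
    unfolding norm_on_sq using fin by (intro sum_mono sum_mono2) auto
  also have "\<dots> \<le> (\<Sum>j\<in>W. (norm_on I (d j))\<^sup>2)"
    by (intro sum_mono power_mono contr) auto
  finally show ?thesis by (simp add: d_def)
qed

text \<open>
  The right-hand side is the squared Hilbert--Schmidt norm of \<open>H\<^sup>n P\<^sub>W\<close>, which dominates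
  \<open>\<parallel>H\<^sup>n x\<parallel>\<^sup>2 / \<parallel>x\<parallel>\<^sup>2\<close> because \<open>x\<close> lives on \<open>W\<close>.
\<close>

lemma trace_power_lower_bound:
  assumes fin: "finite I" and herm: "hermitian_on I g" and W: "W \<subseteq> I"
    and x: "\<And>j. j \<notin> W \<Longrightarrow> x j = 0" and x0: "norm_on I x > 0"
    and "\<theta> > 0" and big: "norm_on I (kernel_op I (offdiag g W) x) \<ge> \<theta> * norm_on I x"
  shows "\<theta> ^ (2 * n) \<le> (\<Sum>i\<in>W. (norm_on I (compression_pow I g W n (basis_vec i)))\<^sup>2)"
proof -
  have finW: "finite W" using W fin finite_subset by blast
  have xe: "x = (\<lambda>j. \<Sum>i\<in>W. x i * basis_vec i j)"
  proof
    fix j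
    have "(\<Sum>i\<in>W. x i * basis_vec i j) = (\<Sum>i\<in>W. if i = j then x j else 0)"
      by (intro sum.cong) (auto simp: basis_vec_def)
    then show "x j = (\<Sum>i\<in>W. x i * basis_vec i j)" using x finW by simp
  qed
  let ?S = "\<Sum>i\<in>W. (norm_on I (compression_pow I g W n (basis_vec i)))\<^sup>2"
  have "\<theta> ^ n * norm_on I x \<le> norm_on I (compression_pow I g W n x)"
    using log_convex_growth[of "\<lambda>k. norm_on I (compression_pow I g W k x)" \<theta> n]
      norm_on_pow_log_convex[OF hermitian_offdiag[OF herm W]] \<open>\<theta> > 0\<close> big by (simp add: compression_pow_def)
  also have "compression_pow I g W n x = (\<lambda>j. \<Sum>i\<in>W. x i * compression_pow I g W n (basis_vec i) j)"
    unfolding compression_pow_def by (subst xe) (rule kernel_op_pow_sum)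
  also have "norm_on I \<dots> \<le> (\<Sum>i\<in>W. \<bar>cmod (x i)\<bar> * \<bar>norm_on I (compression_pow I g W n (basis_vec i))\<bar>)"
    by (rule order_trans[OF norm_on_sum[OF finW]]) (simp add: norm_on_scale)
  also have "\<dots> \<le> L2_set (\<lambda>i. cmod (x i)) W * L2_set (\<lambda>i. norm_on I (compression_pow I g W n (basis_vec i))) W"
    by (rule L2_set_mult_ineq)
  also have "L2_set (\<lambda>i. cmod (x i)) W = norm_on I x"
    unfolding norm_on_def L2_set_def using W fin x
    by (intro arg_cong[where f = sqrt] sum.mono_neutral_left) auto
  also have "L2_set (\<lambda>i. norm_on I (compression_pow I g W n (basis_vec i))) W = sqrt ?S" by (simp add: L2_set_def)
  finally have "\<theta> ^ n \<le> sqrt ?S" using x0 by (simp add: mult.commute)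
  then have "(\<theta> ^ n)\<^sup>2 \<le> (sqrt ?S)\<^sup>2" using \<open>\<theta> > 0\<close> by (intro power_mono) auto
  then show ?thesis by (simp add: power_mult[symmetric] mult.commute sum_nonneg)
qed

section \<open>Bernoulli random sets\<close>

definition bernoulli_weight :: "'a set \<Rightarrow> real \<Rightarrow> 'a set \<Rightarrow> real" where
  "bernoulli_weight I p W = p ^ card W * (1 - p) ^ card (I - W)"

lemma bernoulli_weight_nonneg: "0 \<le> p \<Longrightarrow> p \<le> 1 \<Longrightarrow> bernoulli_weight I p W \<ge> 0"
  by (simp add: bernoulli_weight_def)

lemma sum_bernoulli_weight_prod:
  assumes "finite I"
  shows "(\<Sum>W\<in>Pow I. bernoulli_weight I p W * (\<Prod>t\<in>W. f t)) = (\<Prod>t\<in>I. p * f t + (1 - p))"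
  unfolding prod_add[OF assms] by (intro sum.cong refl) (simp add: bernoulli_weight_def prod.distrib)

lemma sum_bernoulli_weight: "finite I \<Longrightarrow> (\<Sum>W\<in>Pow I. bernoulli_weight I p W) = 1"
  using sum_bernoulli_weight_prod[of I p "\<lambda>_. 1"] by simp

lemma bernoulli_weight_insert:
  assumes "finite I" "W \<subseteq> I" "i \<in> I" "i \<notin> W"
  shows "bernoulli_weight I p (insert i W) * (1 - p) = p * bernoulli_weight I p W"
proof -
  have "finite W" using assms finite_subset by blast
  have "I - W = insert i (I - insert i W)" using assms by auto
  then have "card (I - W) = Suc (card (I - insert i W))"
    using assms by (metis Diff_iff card_insert_disjoint finite_Diff insertI1)
  moreover have "card (insert i W) = Suc (card W)" using assms \<open>finite W\<close> by simp
  ultimately show ?thesis by (simp only: bernoulli_weight_def power_Suc ac_simps)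
qed

text \<open>
  Given \<open>W - {i}\<close>, the events \<open>i \<in> W\<close> and \<open>i \<notin> W\<close> have odds \<open>p : 1 - p\<close>.
\<close>

lemma sum_bernoulli_weight_remove:
  assumes I: "finite I" and i: "i \<in> I"
  shows "(\<Sum>W | W \<subseteq> I \<and> i \<in> W. bernoulli_weight I p W * f (W - {i})) * (1 - p)
    = p * (\<Sum>W | W \<subseteq> I \<and> i \<notin> W. bernoulli_weight I p W * f W)"
proof -
  have "(\<Sum>W | W \<subseteq> I \<and> i \<in> W. bernoulli_weight I p W * f (W - {i}))
      = (\<Sum>W | W \<subseteq> I \<and> i \<notin> W. bernoulli_weight I p (insert i W) * f W)"
    using i by (intro sum.reindex_bij_witness[of _ "insert i" "\<lambda>W. W - {i}"]) (auto simp: insert_absorb)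
  then have "(\<Sum>W | W \<subseteq> I \<and> i \<in> W. bernoulli_weight I p W * f (W - {i})) * (1 - p)
      = (\<Sum>W | W \<subseteq> I \<and> i \<notin> W. (bernoulli_weight I p (insert i W) * (1 - p)) * f W)"
    by (simp add: sum_distrib_left sum_distrib_right ac_simps)
  also have "\<dots> = (\<Sum>W | W \<subseteq> I \<and> i \<notin> W. (p * bernoulli_weight I p W) * f W)"
    by (intro sum.cong refl) (use bernoulli_weight_insert[OF I _ i] in auto)
  finally show ?thesis by (simp add: sum_distrib_left ac_simps)
qed

text \<open>
  For negative \<open>c\<close>, invert the quadratic Taylor lower bound for \<open>exp (- c)\<close>.
\<close>

lemma exp_le_quadratic:
  fixes c :: real
  assumes "\<bar>c\<bar> \<le> 1"
  shows "exp c \<le> 1 + c + c\<^sup>2"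
proof (cases "c \<ge> 0")
  case True then show ?thesis using assms exp_bound[of c] by simp
next
  case False
  define x where "x = - c"
  have x: "0 \<le> x" "x \<le> 1" using False assms by (auto simp: x_def)
  have "1 \<le> 1 + x\<^sup>2 / 2 + x ^ 3 / 2 + x ^ 4 / 2" using x by simp
  also have "\<dots> = (1 - x + x\<^sup>2) * (1 + x + x\<^sup>2 / 2)"
    by (simp add: field_simps power2_eq_square power3_eq_cube power4_eq_xxxx)
  also have "\<dots> \<le> (1 - x + x\<^sup>2) * exp x"
    using x by (intro mult_left_mono exp_lower_Taylor_quadratic) auto
  finally have "exp (- x) \<le> 1 - x + x\<^sup>2" by (simp add: exp_minus field_simps)
  then show ?thesis by (simp add: x_def)
qed

text \<open>
  Bernstein's bound: the exponential moment of \<open>\<Sum>t\<in>W. c t\<close> factorizes, and each factor is at most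
  \<open>exp (p (c t + (c t)\<^sup>2))\<close>. The usual free exponent is absorbed into \<open>c\<close>.
\<close>

lemma sum_bernoulli_weight_tail:
  assumes I: "finite I" and p: "0 \<le> p" "p \<le> 1" and c: "\<And>t. t \<in> I \<Longrightarrow> \<bar>c t\<bar> \<le> 1"
  shows "(\<Sum>W | W \<subseteq> I \<and> p * (\<Sum>t\<in>I. c t) + p * (\<Sum>t\<in>I. (c t)\<^sup>2) + u \<le> (\<Sum>t\<in>W. c t). bernoulli_weight I p W) \<le> exp (- u)"
proof -
  let ?m = "p * (\<Sum>t\<in>I. c t) + p * (\<Sum>t\<in>I. (c t)\<^sup>2)"
  have "(\<Sum>W | W \<subseteq> I \<and> ?m + u \<le> (\<Sum>t\<in>W. c t). bernoulli_weight I p W)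
      \<le> (\<Sum>W | W \<subseteq> I \<and> ?m + u \<le> (\<Sum>t\<in>W. c t). bernoulli_weight I p W * exp ((\<Sum>t\<in>W. c t) - (?m + u)))"
  proof (intro sum_mono)
    fix W assume "W \<in> {W. W \<subseteq> I \<and> ?m + u \<le> (\<Sum>t\<in>W. c t)}"
    then have "bernoulli_weight I p W * 1 \<le> bernoulli_weight I p W * exp ((\<Sum>t\<in>W. c t) - (?m + u))"
      using bernoulli_weight_nonneg[OF p] by (intro mult_left_mono) auto
    then show "bernoulli_weight I p W \<le> bernoulli_weight I p W * exp ((\<Sum>t\<in>W. c t) - (?m + u))" by simp
  qed
  also have "\<dots> \<le> (\<Sum>W\<in>Pow I. bernoulli_weight I p W * exp ((\<Sum>t\<in>W. c t) - (?m + u)))"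
    using I bernoulli_weight_nonneg[OF p] by (intro sum_mono2) (auto intro!: mult_nonneg_nonneg)
  also have "\<dots> = exp (- (?m + u)) * (\<Sum>W\<in>Pow I. bernoulli_weight I p W * (\<Prod>t\<in>W. exp (c t)))"
    unfolding sum_distrib_left[of "exp (- (?m + u))"]
  proof (intro sum.cong refl)
    fix W assume "W \<in> Pow I"
    then have fW: "finite W" using I finite_subset by blast
    have "exp ((\<Sum>t\<in>W. c t) - (?m + u)) = exp (- (?m + u)) * (\<Prod>t\<in>W. exp (c t))"
      unfolding exp_sum[OF fW, symmetric] exp_add[symmetric] by simp
    then show "bernoulli_weight I p W * exp ((\<Sum>t\<in>W. c t) - (?m + u)) = exp (- (?m + u)) * (bernoulli_weight I p W * (\<Prod>t\<in>W. exp (c t)))"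
      by simp
  qed
  also have "\<dots> = exp (- (?m + u)) * (\<Prod>t\<in>I. p * exp (c t) + (1 - p))" unfolding sum_bernoulli_weight_prod[OF I] ..
  also have "\<dots> \<le> exp (- (?m + u)) * (\<Prod>t\<in>I. exp (p * (c t + (c t)\<^sup>2)))"
  proof (intro mult_left_mono prod_mono conjI)
    fix t assume "t \<in> I"
    then have "p * exp (c t) \<le> p * (1 + c t + (c t)\<^sup>2)" using p c exp_le_quadratic by (intro mult_left_mono) auto
    also have "\<dots> + (1 - p) \<le> exp (p * (c t + (c t)\<^sup>2))"
      using exp_ge_add_one_self[of "p * (c t + (c t)\<^sup>2)"] by (simp add: algebra_simps)
    finally show "p * exp (c t) + (1 - p) \<le> exp (p * (c t + (c t)\<^sup>2))" by simp
  qed (use p in auto)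
  also have "\<dots> = exp (- (?m + u)) * exp ?m"
    unfolding exp_sum[OF I, symmetric] by (simp add: sum_distrib_left sum.distrib distrib_left)
  also have "\<dots> = exp (- u)" by (simp add: exp_add[symmetric])
  finally show ?thesis .
qed

text \<open>
  A predicate drawn from the product law is \<open>False\<close> outside \<open>{..<N}\<close>, so it is determined by its set of
  true indices.
\<close>

lemma pmf_bernoulli_set:
  assumes p: "0 \<le> p" "p \<le> 1" and W: "W \<subseteq> {..<N}"
  shows "pmf (bernoulli_set N p) W = bernoulli_weight {..<N} p W"
proof -
  let ?M = "Pi_pmf {..<N} False (\<lambda>_. bernoulli_pmf p)"
  have set: "set_pmf ?M \<subseteq> {I. \<forall>t. t \<notin> {..<N} \<longrightarrow> \<not> I t}"
    using set_Pi_pmf_subset[of "{..<N}" False "\<lambda>_. bernoulli_pmf p"] by auto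
  have "pmf (bernoulli_set N p) W = measure ?M ((\<lambda>I. {t \<in> {..<N}. I t}) -` {W})"
    unfolding bernoulli_set_def pmf_map ..
  also have "\<dots> = measure ?M {\<lambda>t. t \<in> W}"
  proof (rule measure_pmf.finite_measure_eq_AE)
    show "AE I in ?M. (I \<in> (\<lambda>I. {t \<in> {..<N}. I t}) -` {W}) = (I \<in> {\<lambda>t. t \<in> W})"
      using set W by (intro AE_pmfI) (auto simp: fun_eq_iff)
  qed auto
  also have "\<dots> = pmf ?M (\<lambda>t. t \<in> W)" by (simp add: measure_pmf_single)
  also have "\<dots> = (\<Prod>t<N. pmf (bernoulli_pmf p) (t \<in> W))"
    using W by (subst pmf_Pi') auto
  also have "\<dots> = (\<Prod>t\<in>W \<union> ({..<N} - W). if t \<in> W then p else 1 - p)"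
    using W p by (intro prod.cong) auto
  also have "\<dots> = bernoulli_weight {..<N} p W"
    using W finite_subset[OF W] by (subst prod.union_disjoint) (auto simp: bernoulli_weight_def)
  finally show ?thesis .
qed

lemma set_bernoulli_set: "set_pmf (bernoulli_set N p) \<subseteq> Pow {..<N}"
  by (auto simp: bernoulli_set_def)

lemma prob_bernoulli_set:
  assumes p: "0 \<le> p" "p \<le> 1"
  shows "measure (bernoulli_set N p) {W. P W} = (\<Sum>W | W \<subseteq> {..<N} \<and> P W. bernoulli_weight {..<N} p W)"
proof -
  have "measure (bernoulli_set N p) {W. P W} = measure (bernoulli_set N p) {W. W \<subseteq> {..<N} \<and> P W}"
    using set_bernoulli_set[of N p] by (intro measure_pmf.finite_measure_eq_AE AE_pmfI) auto
  also have "\<dots> = (\<Sum>W | W \<subseteq> {..<N} \<and> P W. pmf (bernoulli_set N p) W)"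
    by (rule measure_measure_pmf_finite) simp
  also have "\<dots> = (\<Sum>W | W \<subseteq> {..<N} \<and> P W. bernoulli_weight {..<N} p W)"
    by (intro sum.cong refl) (simp add: pmf_bernoulli_set[OF p])
  finally show ?thesis .
qed

lemma expected_card_eq:
  assumes p: "0 \<le> p" "p \<le> 1"
  shows "expected_card N p = p * real N"
proof -
  have marg: "(\<Sum>W | W \<subseteq> {..<N} \<and> i \<in> W. bernoulli_weight {..<N} p W) = p" if "i < N" for i
  proof -
    let ?a = "\<Sum>W | W \<subseteq> {..<N} \<and> i \<in> W. bernoulli_weight {..<N} p W"
    let ?b = "\<Sum>W | W \<subseteq> {..<N} \<and> i \<notin> W. bernoulli_weight {..<N} p W"
    have "?a + ?b = (\<Sum>W\<in>Pow {..<N}. bernoulli_weight {..<N} p W)"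
      by (subst sum.union_disjoint[symmetric]) (auto intro!: sum.cong)
    then have b: "?b = 1 - ?a" by (simp add: sum_bernoulli_weight)
    moreover have "?a * (1 - p) = p * ?b"
      using sum_bernoulli_weight_remove[of "{..<N}" i p "\<lambda>_. 1"] that by simp
    ultimately show ?thesis unfolding b by (simp add: algebra_simps)
  qed
  have "expected_card N p = (\<Sum>W\<in>Pow {..<N}. real (card W) * pmf (bernoulli_set N p) W)"
    unfolding expected_card_def
    by (rule integral_measure_pmf_real) (use set_bernoulli_set[of N p] in auto)
  also have "\<dots> = (\<Sum>W\<in>Pow {..<N}. \<Sum>i<N. if i \<in> W then bernoulli_weight {..<N} p W else 0)"
  proof (intro sum.cong refl)
    fix W assume W: "W \<in> Pow {..<N}"
    then have "{i. i < N \<and> i \<in> W} = W" by auto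
    then show "real (card W) * pmf (bernoulli_set N p) W = (\<Sum>i<N. if i \<in> W then bernoulli_weight {..<N} p W else 0)"
      using W pmf_bernoulli_set[OF p, of W N] by (simp add: sum.If_cases Int_def)
  qed
  also have "\<dots> = (\<Sum>i<N. \<Sum>W\<in>Pow {..<N}. if i \<in> W then bernoulli_weight {..<N} p W else 0)" by (rule sum.swap)
  also have "\<dots> = (\<Sum>i<N. p)"
    by (intro sum.cong refl) (simp add: sum.If_cases Int_def marg)
  finally show ?thesis by simp
qed

section \<open>Moments of random compressions\<close>

text \<open>
  This event is closed under passing to subsets of \<open>W\<close>, so it survives the removal of an index in the moment
  recursion.
\<close>

definition small_cols :: "'a set \<Rightarrow> ('a \<Rightarrow> 'a \<Rightarrow> complex) \<Rightarrow> real \<Rightarrow> 'a set \<Rightarrow> bool" where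
  "small_cols I g L W \<longleftrightarrow> (\<forall>i\<in>I. (norm_on I (punctured_col g W i))\<^sup>2 \<le> L)"

text \<open>
  This is \<open>tr H\<^sup>2\<^sup>n\<close> over the coordinates in \<open>W\<close>; for \<open>n = 0\<close> it is \<open>card W\<close>.
\<close>

definition moment :: "'a set \<Rightarrow> ('a \<Rightarrow> 'a \<Rightarrow> complex) \<Rightarrow> 'a set \<Rightarrow> nat \<Rightarrow> real" where
  "moment I g W n = (\<Sum>i\<in>W. (norm_on I (compression_pow I g W n (basis_vec i)))\<^sup>2)"

lemma small_cols_subset:
  assumes "finite I" "small_cols I g L W" "W' \<subseteq> W"
  shows "small_cols I g L W'"
proof -
  have "(norm_on I (punctured_col g W' i))\<^sup>2 \<le> (norm_on I (punctured_col g W i))\<^sup>2" for i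
    unfolding norm_on_sq using assms by (intro sum_mono) (auto simp: punctured_col_def)
  then show ?thesis using assms unfolding small_cols_def by (meson order_trans)
qed

lemma moment_nonneg: "moment I g W n \<ge> 0"
  by (simp add: moment_def sum_nonneg)

text \<open>
  Each diagonal entry at \<open>i \<in> W\<close> is bounded through \<open>W - {i}\<close> by the first-return estimate. Trading
  \<open>i \<in> W\<close> against \<open>i \<notin> W\<close> then makes \<open>W - {i}\<close> equal to \<open>W\<close>, and the sum over \<open>i \<notin> W\<close> of the
  column norms is again a moment.
\<close>

lemma expected_moment_recursion:
  fixes I :: "'a set" and g :: "'a \<Rightarrow> 'a \<Rightarrow> complex" and q L :: real
  defines "u \<equiv> \<lambda>n. \<Sum>W | W \<subseteq> I \<and> small_cols I g L W. bernoulli_weight I q W * moment I g W n"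
  assumes fin: "finite I" and herm: "hermitian_on I g" and contr: "\<And>x. norm_on I (kernel_op I g x) \<le> norm_on I x"
    and q: "0 \<le> q" "q \<le> 1" and L: "L \<ge> 0" and n: "n \<ge> 1"
  shows "(1 - q) * u n \<le> q * (\<Sum>r<n. real (2 * n choose r) * L ^ r * u (n - 1 - r))"
proof -
  \<comment> \<open>Down-closedness gives \<open>d W \<le> d (W - {i})\<close>, so the event can be attached to \<open>W - {i}\<close>.\<close>
  define d where "d W = (if small_cols I g L W then 1 else 0 :: real)" for W
  define F where "F i r W = (norm_on I (compression_pow I g W (n - 1 - r) (punctured_col g W i)))\<^sup>2" for i r W
  define f where "f i W = d W * (\<Sum>r<n. real (2 * n choose r) * L ^ r * F i r W)" for i W
  have u: "u m = (\<Sum>W\<in>Pow I. bernoulli_weight I q W * (d W * moment I g W m))" for m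
    unfolding u_def d_def using fin by (intro sum.mono_neutral_cong_left) auto
  have bw: "bernoulli_weight I q W \<ge> 0" for W by (rule bernoulli_weight_nonneg[OF q])
  have "u n \<le> (\<Sum>W\<in>Pow I. \<Sum>i | i \<in> I \<and> i \<in> W. bernoulli_weight I q W * f i (W - {i}))"
    unfolding u
  proof (intro sum_mono)
    fix W assume W: "W \<in> Pow I"
    have "d W * moment I g W n \<le> (\<Sum>i\<in>W. f i (W - {i}))"
      unfolding moment_def sum_distrib_left
    proof (intro sum_mono)
      fix i assume i: "i \<in> W"
      show "d W * (norm_on I (compression_pow I g W n (basis_vec i)))\<^sup>2 \<le> f i (W - {i})"
      proof (cases "small_cols I g L W")
        case True
        then have d: "d W = 1" "d (W - {i}) = 1"
          using small_cols_subset[OF fin True, of "W - {i}"] by (auto simp: d_def)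
        have "(norm_on I (punctured_col g W i))\<^sup>2 \<le> L" using True i W unfolding small_cols_def by auto
        moreover have "punctured_col g (W - {i}) i = punctured_col g W i" by (simp add: punctured_col_def)
        ultimately show ?thesis
          using first_return_column_bound[OF fin herm _ i _ n, of L] W by (simp add: f_def F_def d)
      next
        case False
        then show ?thesis using L by (auto simp: d_def f_def F_def intro!: sum_nonneg)
      qed
    qed
    then have "bernoulli_weight I q W * (d W * moment I g W n) \<le> bernoulli_weight I q W * (\<Sum>i\<in>W. f i (W - {i}))"
      using bw by (intro mult_left_mono)
    moreover have "{i. i \<in> I \<and> i \<in> W} = W" using W by auto
    ultimately show "bernoulli_weight I q W * (d W * moment I g W n) \<le> (\<Sum>i | i \<in> I \<and> i \<in> W. bernoulli_weight I q W * f i (W - {i}))"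
      by (simp add: sum_distrib_left)
  qed
  also have "\<dots> = (\<Sum>i\<in>I. \<Sum>W | W \<in> Pow I \<and> i \<in> W. bernoulli_weight I q W * f i (W - {i}))"
    using fin by (intro sum.swap_restrict) auto
  finally have "(1 - q) * u n \<le> (1 - q) * (\<Sum>i\<in>I. \<Sum>W | W \<in> Pow I \<and> i \<in> W. bernoulli_weight I q W * f i (W - {i}))"
    using q by (intro mult_left_mono) auto
  also have "\<dots> = (\<Sum>i\<in>I. (\<Sum>W | W \<subseteq> I \<and> i \<in> W. bernoulli_weight I q W * f i (W - {i})) * (1 - q))"
    by (simp add: sum_distrib_left mult.commute)
  also have "\<dots> = (\<Sum>i\<in>I. q * (\<Sum>W | W \<subseteq> I \<and> i \<notin> W. bernoulli_weight I q W * f i W))"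
    by (intro sum.cong refl sum_bernoulli_weight_remove[OF fin])
  also have "\<dots> = q * (\<Sum>i\<in>I. \<Sum>W | W \<in> Pow I \<and> i \<notin> W. bernoulli_weight I q W * f i W)"
    by (simp add: sum_distrib_left)
  also have "(\<Sum>i\<in>I. \<Sum>W | W \<in> Pow I \<and> i \<notin> W. bernoulli_weight I q W * f i W)
      = (\<Sum>W\<in>Pow I. \<Sum>i | i \<in> I \<and> i \<notin> W. bernoulli_weight I q W * f i W)"
    using fin by (intro sum.swap_restrict[symmetric]) auto
  also have "\<dots> \<le> (\<Sum>W\<in>Pow I. \<Sum>r<n. real (2 * n choose r) * L ^ r * (bernoulli_weight I q W * (d W * moment I g W (n - 1 - r))))"
  proof (intro sum_mono)
    fix W assume W: "W \<in> Pow I"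
    have "(\<Sum>i | i \<in> I \<and> i \<notin> W. bernoulli_weight I q W * f i W)
        = (\<Sum>i\<in>I - W. \<Sum>r<n. bernoulli_weight I q W * d W * (real (2 * n choose r) * L ^ r) * F i r W)"
      unfolding f_def set_diff_eq by (simp add: sum_distrib_left ac_simps)
    also have "\<dots> = (\<Sum>r<n. bernoulli_weight I q W * d W * (real (2 * n choose r) * L ^ r) * (\<Sum>i\<in>I - W. F i r W))"
      by (subst sum.swap) (simp add: sum_distrib_left)
    also have "\<dots> \<le> (\<Sum>r<n. bernoulli_weight I q W * d W * (real (2 * n choose r) * L ^ r) * moment I g W (n - 1 - r))"
      unfolding F_def moment_def using W L bw
      by (intro sum_mono mult_left_mono sum_columns_outside_le[OF fin herm _ contr]) (auto simp: d_def)
    finally show "(\<Sum>i | i \<in> I \<and> i \<notin> W. bernoulli_weight I q W * f i W)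
        \<le> (\<Sum>r<n. real (2 * n choose r) * L ^ r * (bernoulli_weight I q W * (d W * moment I g W (n - 1 - r))))"
      by (simp add: ac_simps)
  qed
  also have "\<dots> = (\<Sum>r<n. real (2 * n choose r) * L ^ r * u (n - 1 - r))"
    unfolding u by (subst sum.swap) (simp add: sum_distrib_left)
  finally show ?thesis using q by (simp add: mult_left_mono)
qed

text \<open>
  Inserting \<open>u m \<le> card I * K\<^sup>m\<close> into the recursion, the binomial theorem sums the right-hand side to at
  most \<open>q / (1 - q) * card I * K\<^sup>m\<^sup>-\<^sup>1 * (1 + L / K)\<^sup>2\<^sup>m\<close>.
\<close>

lemma expected_moment_le:
  fixes I :: "'a set" and g :: "'a \<Rightarrow> 'a \<Rightarrow> complex" and q L K :: real
  assumes fin: "finite I" and herm: "hermitian_on I g" and contr: "\<And>x. norm_on I (kernel_op I g x) \<le> norm_on I x"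
    and q: "0 \<le> q" "q < 1" and L: "L \<ge> 0" and K: "K > 0" and qK: "q * (1 + L / K) ^ (2 * n) \<le> K * (1 - q)"
  shows "(\<Sum>W | W \<subseteq> I \<and> small_cols I g L W. bernoulli_weight I q W * moment I g W n) \<le> real (card I) * K ^ n"
proof -
  define u where "u n = (\<Sum>W | W \<subseteq> I \<and> small_cols I g L W. bernoulli_weight I q W * moment I g W n)" for n
  have bw: "bernoulli_weight I q W \<ge> 0" for W by (rule bernoulli_weight_nonneg) (use q in auto)
  have "u m \<le> real (card I) * K ^ m" if "m \<le> n" for m
    using that
  proof (induction m rule: less_induct)
    case (less m)
    show ?case
    proof (cases "m = 0")
      case True
      have mom: "moment I g W 0 \<le> real (card I)" if W: "W \<subseteq> I" for W
      proof -
        have "(norm_on I (basis_vec i))\<^sup>2 = 1" if "i \<in> W" for i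
        proof -
          have "complex_of_real ((norm_on I (basis_vec i))\<^sup>2) = 1"
            using fin W that unfolding inner_on_self[symmetric] by (subst inner_on_basis_vec) (auto simp: basis_vec_def)
          then show ?thesis using of_real_eq_1_iff by blast
        qed
        then have "moment I g W 0 = real (card W)" by (simp add: moment_def compression_pow_def)
        then show ?thesis using card_mono[OF fin W] by simp
      qed
      have "u 0 \<le> (\<Sum>W | W \<subseteq> I \<and> small_cols I g L W. bernoulli_weight I q W * real (card I))"
        unfolding u_def by (intro sum_mono mult_left_mono mom bw) auto
      also have "\<dots> \<le> (\<Sum>W\<in>Pow I. bernoulli_weight I q W * real (card I))"
        using fin bw by (intro sum_mono2) auto
      also have "\<dots> = real (card I)" using sum_bernoulli_weight[OF fin] by (simp add: sum_distrib_right[symmetric])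
      finally show ?thesis using True by simp
    next
      case False
      have LK: "L / K \<ge> 0" using L K by simp
      have "(1 - q) * u m \<le> q * (\<Sum>r<m. real (2 * m choose r) * L ^ r * u (m - 1 - r))"
        unfolding u_def using fin herm contr q L False by (intro expected_moment_recursion) auto
      also have "\<dots> \<le> q * (\<Sum>r<m. real (2 * m choose r) * L ^ r * (real (card I) * K ^ (m - 1 - r)))"
        using q L less by (intro mult_left_mono sum_mono) auto
      also have "\<dots> = q * (\<Sum>r<m. real (card I) * K ^ (m - 1) * (real (2 * m choose r) * (L / K) ^ r))"
      proof (intro arg_cong[where f = "\<lambda>x. q * x"] sum.cong refl)
        fix r assume "r \<in> {..<m}"
        then have "K ^ (m - 1) = K ^ (m - 1 - r) * K ^ r" by (simp add: power_add[symmetric])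
        then show "real (2 * m choose r) * L ^ r * (real (card I) * K ^ (m - 1 - r))
            = real (card I) * K ^ (m - 1) * (real (2 * m choose r) * (L / K) ^ r)"
          using K by (simp add: power_divide)
      qed
      also have "\<dots> = real (card I) * K ^ (m - 1) * (q * (\<Sum>r<m. real (2 * m choose r) * (L / K) ^ r))"
        by (simp add: sum_distrib_left[symmetric])
      also have "\<dots> \<le> real (card I) * K ^ (m - 1) * (q * (\<Sum>r\<le>2 * m. real (2 * m choose r) * (L / K) ^ r))"
        using q K LK by (intro mult_left_mono sum_mono2) auto
      also have "(\<Sum>r\<le>2 * m. real (2 * m choose r) * (L / K) ^ r) = (1 + L / K) ^ (2 * m)"
        using binomial_ring[of "L / K" 1 "2 * m"] by (simp add: add.commute)
      also have "q * (1 + L / K) ^ (2 * m) \<le> q * (1 + L / K) ^ (2 * n)"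
        using q LK less.prems by (intro mult_left_mono power_increasing) auto
      also note qK
      also have "real (card I) * K ^ (m - 1) * (K * (1 - q)) = (1 - q) * (real (card I) * K ^ m)"
        using False by (cases m) (auto simp: ac_simps)
      finally show ?thesis using q K by (simp add: mult_left_mono)
    qed
  qed
  then show ?thesis unfolding u_def by simp
qed

text \<open>
  The Markov inequality for the moment of order \<open>2 n\<close>: one vector stretched by \<open>\<theta>\<close> forces it to be at
  least \<open>\<theta>\<^sup>2\<^sup>n\<close>.
\<close>

lemma random_compression_bound:
  fixes I :: "'a set" and g :: "'a \<Rightarrow> 'a \<Rightarrow> complex" and q L K \<theta> :: real
  assumes fin: "finite I" and herm: "hermitian_on I g" and contr: "\<And>x. norm_on I (kernel_op I g x) \<le> norm_on I x"
    and q: "0 \<le> q" "q < 1" and L: "L \<ge> 0" and K: "K > 0" and qK: "q * (1 + L / K) ^ (2 * n) \<le> K * (1 - q)"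
    and \<theta>: "\<theta> > 0"
  shows "(\<Sum>W | W \<subseteq> I \<and> small_cols I g L W \<and> (\<exists>x. (\<forall>j. j \<notin> W \<longrightarrow> x j = 0) \<and> norm_on I x > 0 \<and>
      norm_on I (kernel_op I (offdiag g W) x) \<ge> \<theta> * norm_on I x). bernoulli_weight I q W) \<le> real (card I) * (K / \<theta>\<^sup>2) ^ n"
    (is "(\<Sum>W | W \<subseteq> I \<and> _ W \<and> ?bad W. _) \<le> _")
proof -
  have bw: "bernoulli_weight I q W \<ge> 0" for W by (rule bernoulli_weight_nonneg) (use q in auto)
  have tp: "\<theta> ^ (2 * n) > 0" using \<theta> by simp
  have "\<theta> ^ (2 * n) * (\<Sum>W | W \<subseteq> I \<and> small_cols I g L W \<and> ?bad W. bernoulli_weight I q W)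
      \<le> (\<Sum>W | W \<subseteq> I \<and> small_cols I g L W \<and> ?bad W. bernoulli_weight I q W * moment I g W n)"
    unfolding sum_distrib_left
  proof (intro sum_mono)
    fix W assume "W \<in> {W. W \<subseteq> I \<and> small_cols I g L W \<and> ?bad W}"
    then have "\<theta> ^ (2 * n) \<le> moment I g W n"
      unfolding moment_def using trace_power_lower_bound[OF fin herm] \<theta> by blast
    then show "\<theta> ^ (2 * n) * bernoulli_weight I q W \<le> bernoulli_weight I q W * moment I g W n"
      using bw by (metis mult.commute mult_left_mono)
  qed
  also have "\<dots> \<le> (\<Sum>W | W \<subseteq> I \<and> small_cols I g L W. bernoulli_weight I q W * moment I g W n)"
    using fin bw moment_nonneg[of I g] by (intro sum_mono2) auto
  also have "\<dots> \<le> real (card I) * K ^ n" by (rule expected_moment_le) fact+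
  finally show ?thesis
    using tp by (simp add: power_divide power_mult[symmetric] pos_le_divide_eq mult.commute)
qed

section \<open>The discrete Fourier transform\<close>

lemma dft_commute: "dft N w t = dft N t w"
  by (simp add: dft_def mult.assoc mult.left_commute mult.commute)

lemma dft_eq_power:
  assumes "N > 0"
  shows "dft N w t = cnj (exp (2 * of_real pi * \<i> * (of_nat t / of_nat N))) ^ w / of_real (sqrt (real N))"
  by (simp add: dft_def exp_cnj exp_of_nat_mult[symmetric] field_simps)

text \<open>
  A geometric sum of powers of a root of unity, which is \<open>1\<close> only on the diagonal.
\<close>

lemma dft_orthonormal:
  assumes t: "t < N" and t': "t' < N"
  shows "(\<Sum>w<N. dft N w t * cnj (dft N w t')) = (if t = t' then 1 else 0)"
proof -
  define r where "r t = exp (2 * of_real pi * \<i> * (of_nat t / of_nat N))" for t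
  have N: "N > 0" using t by simp
  have cr: "cnj (r t) * r t = 1" for t
    by (simp add: r_def exp_cnj exp_add[symmetric])
  define z where "z = cnj (r t) * r t'"
  have "dft N w t * cnj (dft N w t') = z ^ w / of_nat N" for w
  proof -
    have "complex_of_real (sqrt (real N)) * complex_of_real (sqrt (real N)) = of_nat N"
      by (simp flip: of_real_mult)
    then show ?thesis unfolding dft_eq_power[OF N] r_def[symmetric] z_def by (simp add: power_mult_distrib)
  qed
  then have sum: "(\<Sum>w<N. dft N w t * cnj (dft N w t')) = (\<Sum>w<N. z ^ w) / of_nat N"
    by (simp add: sum_divide_distrib)
  show ?thesis
  proof (cases "t = t'")
    case True
    then have "z = 1" using cr[of t'] by (simp add: z_def)
    then show ?thesis using sum True N by simp
  next
    case False
    have rN: "r t ^ N = 1" for t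
    proof -
      have "r t ^ N = exp (of_nat t * (2 * of_real pi * \<i>))"
        using N by (simp add: r_def exp_of_nat_mult[symmetric] ac_simps)
      then show ?thesis by (simp add: exp_of_nat_mult)
    qed
    have "z ^ N = 1" using rN[of t] rN[of t'] by (simp add: z_def power_mult_distrib flip: complex_cnj_power)
    moreover have "z \<noteq> 1"
    proof
      assume "z = 1"
      then have "r t * z = r t" by simp
      moreover have "r t * z = (cnj (r t) * r t) * r t'" by (simp add: z_def)
      ultimately have "r t' = r t" using cr[of t] by simp
      then show False unfolding r_def
        using complex_root_unity_eq[of N t' t] N False t t' by simp
    qed
    ultimately show ?thesis using sum False by (simp add: sum_gp_strict)
  qed
qed

lemma norm_on_kernel_op_unitary:
  assumes fin: "finite I" and orth: "\<And>t t'. t \<in> I \<Longrightarrow> t' \<in> I \<Longrightarrow> (\<Sum>w\<in>I. U w t * cnj (U w t')) = (if t = t' then 1 else 0)"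
  shows "norm_on I (kernel_op I U z) = norm_on I z"
proof -
  have "inner_on I (kernel_op I U z) (kernel_op I U z) = (\<Sum>w\<in>I. \<Sum>t\<in>I. \<Sum>t'\<in>I. (U w t * z t) * cnj (U w t' * z t'))"
    unfolding inner_on_def kernel_op_def by (simp add: sum_product)
  also have "\<dots> = (\<Sum>t\<in>I. \<Sum>w\<in>I. \<Sum>t'\<in>I. (U w t * z t) * cnj (U w t' * z t'))" by (rule sum.swap)
  also have "\<dots> = (\<Sum>t\<in>I. \<Sum>t'\<in>I. \<Sum>w\<in>I. (U w t * z t) * cnj (U w t' * z t'))"
    by (rule sum.cong[OF refl], rule sum.swap)
  also have "\<dots> = (\<Sum>t\<in>I. \<Sum>t'\<in>I. z t * cnj (z t') * (\<Sum>w\<in>I. U w t * cnj (U w t')))"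
    by (simp add: sum_distrib_left ac_simps)
  also have "\<dots> = (\<Sum>t\<in>I. \<Sum>t'\<in>I. if t = t' then z t * cnj (z t') else 0)"
    by (intro sum.cong refl) (simp add: orth)
  also have "\<dots> = inner_on I z z" using fin by (simp add: inner_on_def)
  finally have "(norm_on I (kernel_op I U z))\<^sup>2 = (norm_on I z)\<^sup>2"
    unfolding inner_on_self using of_real_eq_iff by blast
  then show ?thesis by (simp add: power2_eq_iff_nonneg)
qed

abbreviation fourier :: "nat \<Rightarrow> (nat \<Rightarrow> complex) \<Rightarrow> nat \<Rightarrow> complex" where
  "fourier N \<equiv> kernel_op {..<N} (dft N)"

definition inv_fourier :: "nat \<Rightarrow> (nat \<Rightarrow> complex) \<Rightarrow> nat \<Rightarrow> complex" where
  "inv_fourier N = kernel_op {..<N} (\<lambda>s w. cnj (dft N w s))"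

lemma norm_on_fourier: "norm_on {..<N} (fourier N z) = norm_on {..<N} z"
  by (rule norm_on_kernel_op_unitary) (simp_all add: dft_orthonormal)

lemma norm_on_inv_fourier: "norm_on {..<N} (inv_fourier N z) = norm_on {..<N} z"
  unfolding inv_fourier_def
proof (rule norm_on_kernel_op_unitary)
  fix t t' assume "t \<in> {..<N}" "t' \<in> {..<N}"
  then have "(\<Sum>w<N. dft N w t' * cnj (dft N w t)) = (if t = t' then 1 else 0)"
    by (simp add: dft_orthonormal)
  then show "(\<Sum>w<N. cnj (dft N t w) * cnj (cnj (dft N t' w))) = (if t = t' then 1 else 0)"
    by (simp add: dft_commute[of N t] dft_commute[of N t'] mult.commute)
qed simp

lemma fourier_inv_fourier: "w < N \<Longrightarrow> fourier N (inv_fourier N x) w = x w"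
proof -
  assume w: "w < N"
  have "fourier N (inv_fourier N x) w = (\<Sum>s<N. \<Sum>w'<N. x w' * (dft N w s * cnj (dft N w' s)))"
    by (simp add: kernel_op_def inv_fourier_def sum_distrib_left ac_simps)
  also have "\<dots> = (\<Sum>w'<N. x w' * (\<Sum>s<N. dft N w s * cnj (dft N w' s)))"
    by (subst sum.swap) (simp add: sum_distrib_left)
  also have "\<dots> = (\<Sum>w'<N. if w' = w then x w' else 0)"
  proof (intro sum.cong refl)
    fix w' assume "w' \<in> {..<N}"
    then show "x w' * (\<Sum>s<N. dft N w s * cnj (dft N w' s)) = (if w' = w then x w' else 0)"
      using dft_orthonormal[of w N w'] w by (simp add: dft_commute[of N _ w] dft_commute[of N _ w'])
  qed
  also have "\<dots> = x w" using w by simp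
  finally show ?thesis .
qed

text \<open>
  The kernel of \<open>F P\<^sub>T F\<^sup>*\<close> on frequency space.
\<close>

definition time_gram :: "nat \<Rightarrow> nat set \<Rightarrow> nat \<Rightarrow> nat \<Rightarrow> complex" where
  "time_gram N T w w' = (\<Sum>t\<in>T. dft N w t * cnj (dft N w' t))"

lemma hermitian_time_gram: "hermitian_on I (time_gram N T)"
  unfolding hermitian_on_def time_gram_def by (simp add: mult.commute)

lemma kernel_op_time_gram:
  assumes "T \<subseteq> {..<N}"
  shows "kernel_op {..<N} (time_gram N T) x = fourier N (\<lambda>t. if t \<in> T then inv_fourier N x t else 0)"
proof
  fix w
  have "kernel_op {..<N} (time_gram N T) x w = (\<Sum>w'<N. \<Sum>t\<in>T. dft N w t * cnj (dft N w' t) * x w')"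
    by (simp add: kernel_op_def time_gram_def sum_distrib_right)
  also have "\<dots> = (\<Sum>t\<in>T. dft N w t * inv_fourier N x t)"
    by (subst sum.swap) (simp add: inv_fourier_def kernel_op_def sum_distrib_left mult.assoc)
  also have "\<dots> = fourier N (\<lambda>t. if t \<in> T then inv_fourier N x t else 0) w"
    unfolding kernel_op_def using assms by (intro sum.mono_neutral_cong_left) auto
  finally show "kernel_op {..<N} (time_gram N T) x w = fourier N (\<lambda>t. if t \<in> T then inv_fourier N x t else 0) w" .
qed

lemma norm_on_time_gram_le:
  assumes "T \<subseteq> {..<N}"
  shows "norm_on {..<N} (kernel_op {..<N} (time_gram N T) x) \<le> norm_on {..<N} x"
proof -
  have "norm_on {..<N} (\<lambda>t. if t \<in> T then inv_fourier N x t else 0) \<le> norm_on {..<N} (inv_fourier N x)"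
    unfolding norm_on_def by (intro L2_set_mono) auto
  then show ?thesis unfolding kernel_op_time_gram[OF assms] norm_on_fourier norm_on_inv_fourier .
qed

lemma cmod_dft: "(cmod (dft N w t))\<^sup>2 = 1 / real N"
proof -
  have "cmod (dft N w t) = 1 / sqrt (real N)"
    unfolding dft_def by (simp add: norm_divide)
  then show ?thesis by (simp add: power_divide)
qed

lemma time_gram_diag: "time_gram N T w w = of_real (real (card T) / real N)"
proof -
  have "time_gram N T w w = (\<Sum>t\<in>T. of_real ((cmod (dft N w t))\<^sup>2))"
    unfolding time_gram_def by (simp only: complex_norm_square)
  then show ?thesis unfolding cmod_dft by simp
qed

lemma sum_time_gram_sq:
  assumes T: "T \<subseteq> {..<N}" and i: "i < N"
  shows "(\<Sum>j<N. (cmod (time_gram N T j i))\<^sup>2) = real (card T) / real N"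
proof -
  have u: "inv_fourier N (basis_vec i) = (\<lambda>t. cnj (dft N t i))"
    using i by (simp add: inv_fourier_def kernel_op_basis_vec) (simp add: dft_commute[of N i])
  have "(\<Sum>j<N. (cmod (time_gram N T j i))\<^sup>2) = (norm_on {..<N} (kernel_op {..<N} (time_gram N T) (basis_vec i)))\<^sup>2"
    using i by (simp add: kernel_op_basis_vec norm_on_sq)
  also have "\<dots> = (\<Sum>t<N. (cmod (if t \<in> T then cnj (dft N t i) else 0))\<^sup>2)"
    unfolding kernel_op_time_gram[OF T] norm_on_fourier norm_on_sq u ..
  also have "\<dots> = (\<Sum>t\<in>T. 1 / real N)"
    using T by (intro sum.mono_neutral_cong_right) (auto simp: cmod_dft)
  finally show ?thesis by simp
qed

lemma kernel_op_offdiag_eq: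
  assumes fin: "finite I" and W: "W \<subseteq> I" and x: "\<And>j. j \<notin> W \<Longrightarrow> x j = 0" and w: "w \<in> W"
  shows "kernel_op I (offdiag g W) x w = kernel_op I g x w - g w w * x w"
proof -
  have wI: "w \<in> I" using W w by auto
  have "kernel_op I (offdiag g W) x w = (\<Sum>j\<in>I - {w}. g w j * x j)"
    unfolding kernel_op_def using fin w x W by (intro sum.mono_neutral_cong_right) (auto simp: offdiag_def)
  also have "\<dots> = kernel_op I g x w - g w w * x w"
    unfolding kernel_op_def using fin wI by (simp add: sum_diff1)
  finally show ?thesis .
qed

text \<open>
  Here \<open>f = F\<^sup>* x\<close> lives on \<open>T\<close> and one more time \<open>t'\<close>, so \<open>F P\<^sub>T F\<^sup>* x\<close> differs from \<open>x\<close> by a multiple \<open>b\<close>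
  of the sinusoid at \<open>t'\<close>. Restricted to \<open>W\<close> that sinusoid has norm \<open>sqrt (card W / N)\<close>, and the
  same number bounds \<open>b\<close> relative to \<open>\<parallel>x\<parallel>\<close>.
\<close>

lemma compression_big_time:
  assumes T: "T \<subseteq> {..<N}" and W: "W \<subseteq> {..<N}" and t': "t' < N"
    and x: "\<And>j. j \<notin> W \<Longrightarrow> x j = 0" and f: "\<And>s. s < N \<Longrightarrow> s \<notin> insert t' T \<Longrightarrow> inv_fourier N x s = 0"
    and p: "real (card T) / real N \<le> 1"
  shows "(1 - real (card T) / real N - real (card W) / real N) * norm_on {..<N} x
    \<le> norm_on {..<N} (kernel_op {..<N} (offdiag (time_gram N T) W) x)"
proof -
  define I where "I = {..<N}"
  define p' where "p' = real (card T) / real N"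
  define b where "b = (if t' \<in> T then 0 else inv_fourier N x t')"
  define d where "d w = (if w \<in> W then dft N w t' else 0)" for w
  let ?H = "kernel_op I (offdiag (time_gram N T) W) x"
  have nd2: "(norm_on I d)\<^sup>2 = real (card W) / real N"
  proof -
    have "(norm_on I d)\<^sup>2 = (\<Sum>w\<in>W. 1 / real N)"
      unfolding norm_on_sq I_def using W by (intro sum.mono_neutral_cong_right) (auto simp: d_def cmod_dft)
    then show ?thesis by simp
  qed
  have "inv_fourier N x t' = inner_on I x d"
    unfolding inv_fourier_def kernel_op_def inner_on_def I_def using x by (intro sum.cong) (auto simp: d_def)
  then have b: "cmod b \<le> norm_on I x * norm_on I d"
    using Cauchy_Schwarz_inner_on[of I x d] by (auto simp: b_def)
  have "(1 - p') * x w = ?H w + b * d w" if w: "w \<in> I" for w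
  proof (cases "w \<in> W")
    case True
    have "kernel_op I (time_gram N T) x w = fourier N (\<lambda>t. if t \<in> T then inv_fourier N x t else 0) w"
      unfolding I_def kernel_op_time_gram[OF T] ..
    also have "\<dots> = (\<Sum>t<N. dft N w t * inv_fourier N x t - (if t = t' then dft N w t' * b else 0))"
      unfolding kernel_op_def using f by (intro sum.cong) (auto simp: b_def)
    also have "\<dots> = fourier N (inv_fourier N x) w - dft N w t' * b"
      using t' by (simp add: sum_subtractf kernel_op_def)
    also have "\<dots> = x w - b * d w"
      using w True by (simp add: I_def fourier_inv_fourier d_def mult.commute)
    finally have "kernel_op I (time_gram N T) x w = x w - b * d w" .
    then have "?H w = x w - b * d w - p' * x w"
      using kernel_op_offdiag_eq[of I W x w "time_gram N T"] W x True by (simp add: I_def time_gram_diag p'_def)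
    then show ?thesis by (simp add: algebra_simps)
  next
    case False
    then show ?thesis using x by (simp add: d_def kernel_op_def offdiag_def)
  qed
  then have "norm_on I (\<lambda>w. (1 - p') * x w) = norm_on I (\<lambda>w. ?H w + b * d w)" by (intro norm_on_cong)
  also have "\<dots> \<le> norm_on I ?H + cmod b * norm_on I d" using norm_on_triangle norm_on_scale by metis
  also have "\<dots> \<le> norm_on I ?H + norm_on I x * norm_on I d * norm_on I d" using b by (intro add_left_mono mult_right_mono) auto
  also have "norm_on I x * norm_on I d * norm_on I d = real (card W) / real N * norm_on I x"
    unfolding nd2[symmetric] by (simp add: power2_eq_square)
  also have "norm_on I (\<lambda>w. (1 - p') * x w) = (1 - p') * norm_on I x"
    using p unfolding norm_on_scale norm_of_real p'_def by simp
  finally show ?thesis by (simp add: I_def p'_def algebra_simps)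
qed

text \<open>
  Here \<open>x\<close> lives on \<open>W\<close> and one more frequency \<open>w'\<close>, and \<open>F P\<^sub>T F\<^sup>* x = x\<close>. Reading this equation
  at \<open>w'\<close> bounds the coefficient \<open>x w'\<close> by \<open>sqrt L \<parallel>y\<parallel> / (1 - card T / N)\<close>; reading it on \<open>W\<close> shows
  that \<open>y\<close> is almost an eigenvector of the compression, with an error of column \<open>w'\<close> times \<open>x w'\<close>.
\<close>

lemma compression_big_frequency:
  assumes T: "T \<subseteq> {..<N}" and W: "W \<subseteq> {..<N}" and w': "w' < N" "w' \<notin> W"
    and x: "\<And>j. j \<notin> insert w' W \<Longrightarrow> x j = 0" and f: "\<And>s. s < N \<Longrightarrow> s \<notin> T \<Longrightarrow> inv_fourier N x s = 0"
    and p: "real (card T) / real N < 1" and L: "small_cols {..<N} (time_gram N T) L W"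
    and x0: "norm_on {..<N} x > 0"
  defines "y \<equiv> \<lambda>j. if j \<in> W then x j else 0"
  shows "norm_on {..<N} y > 0 \<and> (1 - real (card T) / real N - L / (1 - real (card T) / real N)) * norm_on {..<N} y
    \<le> norm_on {..<N} (kernel_op {..<N} (offdiag (time_gram N T) W) y)"
proof -
  define I where "I = {..<N}"
  define p' where "p' = real (card T) / real N"
  define c where "c = punctured_col (time_gram N T) W w'"
  let ?H = "kernel_op I (offdiag (time_gram N T) W) y"
  have finI: "finite I" and w'I: "w' \<in> I" using w' by (auto simp: I_def)
  have p1: "1 - p' > 0" using p by (simp add: p'_def)
  have y_out: "y j = 0" if "j \<notin> W" for j using that by (simp add: y_def)
  have xy: "x j = y j + (if j = w' then x w' else 0)" for j using x[of j] w' by (auto simp: y_def)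
  have c2: "(norm_on I c)\<^sup>2 \<le> L" using L w'I by (auto simp: c_def small_cols_def I_def)
  have cnj_time_gram: "cnj (time_gram N T i j) = time_gram N T j i" for i j
    by (simp add: time_gram_def mult.commute)
  have G: "x w = kernel_op I (time_gram N T) y w + x w' * time_gram N T w w'" if w: "w \<in> I" for w
  proof -
    have "x w = fourier N (inv_fourier N x) w" using w by (simp add: I_def fourier_inv_fourier)
    also have "\<dots> = fourier N (\<lambda>t. if t \<in> T then inv_fourier N x t else 0) w"
      unfolding kernel_op_def using f by (intro sum.cong) auto
    also have "\<dots> = kernel_op I (time_gram N T) x w" unfolding I_def kernel_op_time_gram[OF T] ..
    also have "\<dots> = (\<Sum>j\<in>I. time_gram N T w j * y j + (if j = w' then time_gram N T w w' * x w' else 0))"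
      unfolding kernel_op_def by (intro sum.cong refl, subst xy) (simp add: distrib_left)
    also have "\<dots> = kernel_op I (time_gram N T) y w + x w' * time_gram N T w w'"
      using finI w'I by (simp add: sum.distrib kernel_op_def mult.commute)
    finally show ?thesis .
  qed
  have "kernel_op I (time_gram N T) y w' = inner_on I y c"
    unfolding kernel_op_def inner_on_def c_def punctured_col_def using w' by (intro sum.cong refl) (auto simp: y_def cnj_time_gram)
  then have "x w' = inner_on I y c + x w' * of_real p'"
    using G[OF w'I] by (simp only: time_gram_diag p'_def)
  then have "(1 - p') * x w' = inner_on I y c" unfolding of_real_diff of_real_1 by algebra
  then have "cmod ((1 - p') * x w') \<le> norm_on I y * norm_on I c" using Cauchy_Schwarz_inner_on by metis
  then have \<xi>: "(1 - p') * cmod (x w') \<le> norm_on I y * norm_on I c"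
    using p1 by (simp only: norm_mult norm_of_real abs_of_pos)
  have y0: "norm_on I y > 0"
  proof (rule ccontr)
    assume "\<not> norm_on I y > 0"
    then have y0: "norm_on I y = 0" using norm_on_nonneg[of I y] by linarith
    then have "x w' = 0" using \<xi> p1 by (simp add: mult_le_0_iff)
    then have "x j = y j" for j unfolding y_def using x[of j] by auto
    then have "norm_on I x = norm_on I y" by (intro norm_on_cong)
    then show False using x0 y0 by (simp add: I_def)
  qed
  have "(1 - p') * y w = ?H w + x w' * c w" if w: "w \<in> I" for w
  proof (cases "w \<in> W")
    case True
    then have "y w = x w" by (simp add: y_def)
    then have "kernel_op I (time_gram N T) y w = y w - x w' * time_gram N T w w'"
      using G[OF w] by (metis add_diff_cancel_right')
    then have "?H w = y w - x w' * time_gram N T w w' - p' * y w"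
      using kernel_op_offdiag_eq[of I W y w "time_gram N T"] W y_out True finI
      by (simp add: I_def time_gram_diag p'_def)
    then show ?thesis using True w' by (auto simp: algebra_simps c_def punctured_col_def)
  next
    case False
    then show ?thesis by (simp add: y_def c_def punctured_col_def kernel_op_def offdiag_def)
  qed
  then have "norm_on I (\<lambda>w. (1 - p') * y w) = norm_on I (\<lambda>w. ?H w + x w' * c w)" by (intro norm_on_cong)
  also have "\<dots> \<le> norm_on I ?H + cmod (x w') * norm_on I c" using norm_on_triangle norm_on_scale by metis
  also have "cmod (x w') * norm_on I c \<le> (norm_on I y * norm_on I c / (1 - p')) * norm_on I c"
    using \<xi> p1 by (intro mult_right_mono) (auto simp: field_simps)
  also have "\<dots> = (norm_on I c)\<^sup>2 * (norm_on I y / (1 - p'))" by (simp add: power2_eq_square)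
  also have "\<dots> \<le> L * (norm_on I y / (1 - p'))" using c2 p1 by (intro mult_right_mono) auto
  also have "norm_on I (\<lambda>w. (1 - p') * y w) = (1 - p') * norm_on I y"
    using p1 unfolding norm_on_scale norm_of_real by simp
  finally show ?thesis using y0 by (simp add: I_def p'_def algebra_simps)
qed

section \<open>Independent columns of the time-frequency dictionary\<close>

text \<open>
  Independence of the indexed family, so that two equal columns count as dependent.
\<close>

definition indep_cols :: "nat \<Rightarrow> (nat + nat) set \<Rightarrow> bool" where
  "indep_cols N S \<longleftrightarrow> (\<forall>a. (\<forall>i. i \<notin> S \<longrightarrow> a i = 0) \<longrightarrow>
     (\<forall>s<N. (\<Sum>i\<in>idx N. Phi N s i * a i) = 0) \<longrightarrow> (\<forall>i. a i = 0))"

lemma sum_Phi: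
  assumes "s < N"
  shows "(\<Sum>i\<in>idx N. Phi N s i * a i) = a (Inl s) + inv_fourier N (\<lambda>w. a (Inr w)) s"
proof -
  have "(\<Sum>t<N. Phi N s (Inl t) * a (Inl t)) = (\<Sum>t<N. if t = s then a (Inl s) else 0)"
    by (intro sum.cong) auto
  then show ?thesis using assms
    unfolding idx_def by (subst sum.Plus) (simp_all add: inv_fourier_def kernel_op_def)
qed

text \<open>
  A dependency is a pair \<open>(- f, x)\<close> with \<open>f = F\<^sup>* x\<close>, and the extra index \<open>\<gamma>\<close> is either a time or a
  frequency. In both cases the compression would stretch a nonzero vector by at least \<open>1 / 2\<close>, since
  \<open>1 - 1 / 8 - (1 / 8) / (7 / 8) > 1 / 2\<close>.
\<close>

lemma indep_cols_insert_of_compression: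
  assumes T: "T \<subseteq> {..<N}" and W: "W \<subseteq> {..<N}" and \<gamma>: "\<gamma> \<in> idx N"
    and cT: "real (card T) / real N \<le> 1 / 8" and cW: "real (card W) / real N \<le> 1 / 8"
    and L: "small_cols {..<N} (time_gram N T) L W" "L \<le> 1 / 8"
    and small: "\<And>x. (\<And>j. j \<notin> W \<Longrightarrow> x j = 0) \<Longrightarrow> norm_on {..<N} x > 0 \<Longrightarrow>
      norm_on {..<N} (kernel_op {..<N} (offdiag (time_gram N T) W) x) < 1 / 2 * norm_on {..<N} x"
  shows "indep_cols N (insert \<gamma> (T <+> W))"
  unfolding indep_cols_def
proof (intro allI impI)
  fix a i
  assume a: "\<forall>i. i \<notin> insert \<gamma> (T <+> W) \<longrightarrow> a i = 0" and ker: "\<forall>s<N. (\<Sum>i\<in>idx N. Phi N s i * a i) = 0"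
  define x where "x w = a (Inr w)" for w
  have N: "N > 0" using \<gamma> by (auto simp: idx_def)
  have sub: "insert \<gamma> (T <+> W) \<subseteq> idx N" using T W \<gamma> by (auto simp: idx_def)
  have f: "inv_fourier N x s = - a (Inl s)" if "s < N" for s
    using ker sum_Phi[OF that, of a] that unfolding x_def by (metis add.commute add_eq_0_iff)
  have x0: "norm_on {..<N} x = 0"
  proof (rule ccontr)
    assume "norm_on {..<N} x \<noteq> 0"
    then have pos: "norm_on {..<N} x > 0" using norm_on_nonneg[of "{..<N}" x] by linarith
    show False
    proof (cases "\<exists>w'. \<gamma> = Inr w' \<and> w' \<notin> W")
      case True
      then obtain w' where w': "\<gamma> = Inr w'" "w' \<notin> W" by auto
      define y where "y = (\<lambda>j. if j \<in> W then x j else 0)"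
      have "norm_on {..<N} y > 0 \<and> (1 - real (card T) / real N - L / (1 - real (card T) / real N)) * norm_on {..<N} y
        \<le> norm_on {..<N} (kernel_op {..<N} (offdiag (time_gram N T) W) y)"
        unfolding y_def
      proof (rule compression_big_frequency[OF T W _ w'(2) _ _ _ L(1) pos])
        show "w' < N" using \<gamma> w' by (auto simp: idx_def)
        show "x j = 0" if "j \<notin> insert w' W" for j using a that w' by (auto simp: x_def)
        show "inv_fourier N x s = 0" if "s < N" "s \<notin> T" for s
          using a that w' by (subst f) auto
        show "real (card T) / real N < 1" using cT by linarith
      qed
      moreover from this have "norm_on {..<N} (kernel_op {..<N} (offdiag (time_gram N T) W) y) < 1 / 2 * norm_on {..<N} y"
        by (intro small) (auto simp: y_def)
      moreover have "L / (1 - real (card T) / real N) \<le> (1 / 8) / (7 / 8)"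
        by (rule frac_le) (use L cT in linarith)+
      then have "L / (1 - real (card T) / real N) \<le> 1 / 7" by simp
      then have "1 / 2 * norm_on {..<N} y \<le> (1 - real (card T) / real N - L / (1 - real (card T) / real N)) * norm_on {..<N} y"
        using cT by - (rule mult_right_mono, linarith, simp)
      ultimately show False by linarith
    next
      case False
      obtain t' where t': "t' < N" "\<gamma> = Inl t' \<or> \<gamma> \<in> T <+> W"
      proof (cases \<gamma>)
        case (Inl t) then show ?thesis using that \<gamma> by (auto simp: idx_def)
      next
        case (Inr w) then show ?thesis using that[of 0] False N by auto
      qed
      have xout: "x j = 0" if "j \<notin> W" for j
      proof -
        have "Inr j \<notin> insert \<gamma> (T <+> W)" using that t' by auto
        then show ?thesis using a by (simp add: x_def)
      qed
      have "(1 - real (card T) / real N - real (card W) / real N) * norm_on {..<N} x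
        \<le> norm_on {..<N} (kernel_op {..<N} (offdiag (time_gram N T) W) x)"
      proof (rule compression_big_time[OF T W t'(1) xout])
        show "inv_fourier N x s = 0" if "s < N" "s \<notin> insert t' T" for s
        proof -
          have "Inl s \<notin> insert \<gamma> (T <+> W)" using that t' by auto
          then show ?thesis using a by (simp add: f[OF that(1)])
        qed
        show "real (card T) / real N \<le> 1" using cT by linarith
      qed
      moreover have "norm_on {..<N} (kernel_op {..<N} (offdiag (time_gram N T) W) x) < 1 / 2 * norm_on {..<N} x"
        using xout pos by (intro small) auto
      moreover have "1 / 2 * norm_on {..<N} x \<le> (1 - real (card T) / real N - real (card W) / real N) * norm_on {..<N} x"
        using cT cW by (intro mult_right_mono) auto
      ultimately show False by linarith
    qed
  qed
  have xw: "x w = 0" if "w < N" for w using norm_on_eq_0[OF _ x0] that by simp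
  show "a i = 0"
  proof (cases "i \<in> idx N")
    case True
    then show ?thesis
    proof (cases i)
      case (Inl s)
      then have s: "s < N" using True by (auto simp: idx_def)
      have "inv_fourier N x s = 0" by (simp add: inv_fourier_def kernel_op_def xw)
      then show ?thesis using f[OF s] Inl by simp
    next
      case (Inr w) then show ?thesis using True xw by (auto simp: idx_def x_def)
    qed
  next
    case False then show ?thesis using a sub by blast
  qed
qed

section \<open>Spans of columns\<close>

definition in_span :: "'s set \<Rightarrow> ('i \<Rightarrow> 's \<Rightarrow> complex) \<Rightarrow> 'i set \<Rightarrow> ('s \<Rightarrow> complex) \<Rightarrow> bool" where
  "in_span I \<phi> S v \<longleftrightarrow> (\<exists>a. \<forall>s\<in>I. v s = (\<Sum>i\<in>S. a i * \<phi> i s))"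

text \<open>
  A subspace is cut out by finitely many linear equations. Adding a vector \<open>\<phi> j\<close> to the spanning set either changes
  nothing, or uses one functional that does not vanish at \<open>\<phi> j\<close> to clear the others. The equations
  serve twice: they show that representability is a measurable event, and that it is a null event.
\<close>

lemma span_eq_annihilator:
  assumes I: "finite I" and "finite S"
  shows "\<exists>\<Lambda>. finite \<Lambda> \<and> (\<forall>v. in_span I \<phi> S v \<longleftrightarrow> (\<forall>l\<in>\<Lambda>. (\<Sum>s\<in>I. l s * v s) = 0))"
  using \<open>finite S\<close>
proof (induction S rule: finite_induct)
  case empty
  have "(\<Sum>s\<in>I. basis_vec t s * v s) = v t" if "t \<in> I" for t and v :: "'a \<Rightarrow> complex"
    using I that by (simp add: basis_vec_def if_distrib[of "\<lambda>x. x * _"] cong: if_cong)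
  then have "\<forall>v. in_span I \<phi> {} v \<longleftrightarrow> (\<forall>l\<in>basis_vec ` I. (\<Sum>s\<in>I. l s * v s) = 0)"
    by (simp add: in_span_def)
  moreover have "finite (basis_vec ` I)" using I by simp
  ultimately show ?case by blast
next
  case (insert j S)
  then obtain \<Lambda> where \<Lambda>: "finite \<Lambda>" "\<And>v. in_span I \<phi> S v \<longleftrightarrow> (\<forall>l\<in>\<Lambda>. (\<Sum>s\<in>I. l s * v s) = 0)" by blast
  define ev where "ev l v = (\<Sum>s\<in>I. l s * v s)" for l v :: "'a \<Rightarrow> complex"
  have ev_diff: "ev l (\<lambda>s. v s - c * w s) = ev l v - c * ev l w" for l v w and c :: complex
    by (simp add: ev_def algebra_simps sum_subtractf sum_distrib_left)
  have ev_diff': "ev (\<lambda>s. l s - c * k s) v = ev l v - c * ev k v" for l v k and c :: complex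
    by (simp add: ev_def algebra_simps sum_subtractf sum_distrib_left)
  have split: "in_span I \<phi> (insert j S) v \<longleftrightarrow> (\<exists>c. in_span I \<phi> S (\<lambda>s. v s - c * \<phi> j s))" for v
  proof
    assume "in_span I \<phi> (insert j S) v"
    then obtain a where "\<forall>s\<in>I. v s = (\<Sum>i\<in>insert j S. a i * \<phi> i s)" unfolding in_span_def by blast
    then have "\<forall>s\<in>I. v s - a j * \<phi> j s = (\<Sum>i\<in>S. a i * \<phi> i s)" using insert.hyps by simp
    then show "\<exists>c. in_span I \<phi> S (\<lambda>s. v s - c * \<phi> j s)" unfolding in_span_def by blast
  next
    assume "\<exists>c. in_span I \<phi> S (\<lambda>s. v s - c * \<phi> j s)"
    then obtain c a where ca: "\<forall>s\<in>I. v s - c * \<phi> j s = (\<Sum>i\<in>S. a i * \<phi> i s)" unfolding in_span_def by blast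
    have "v s = (\<Sum>i\<in>insert j S. (if i = j then c else a i) * \<phi> i s)" if "s \<in> I" for s
    proof -
      have "(\<Sum>i\<in>S. (if i = j then c else a i) * \<phi> i s) = (\<Sum>i\<in>S. a i * \<phi> i s)"
        using insert.hyps by (intro sum.cong) auto
      also have "\<dots> = v s - c * \<phi> j s" using ca that by simp
      finally show ?thesis using insert.hyps by simp
    qed
    then show "in_span I \<phi> (insert j S) v"
      unfolding in_span_def by (intro exI[of _ "\<lambda>i. if i = j then c else a i"]) blast
  qed
  show ?case
  proof (cases "\<forall>l\<in>\<Lambda>. ev l (\<phi> j) = 0")
    case True
    then have "in_span I \<phi> (insert j S) v \<longleftrightarrow> (\<forall>l\<in>\<Lambda>. ev l v = 0)" for v
      unfolding split \<Lambda>(2) ev_def[symmetric] ev_diff by simp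
    then show ?thesis using \<Lambda>(1) unfolding ev_def by blast
  next
    case False
    then obtain k where k: "k \<in> \<Lambda>" "ev k (\<phi> j) \<noteq> 0" by blast
    define shift where "shift l = (\<lambda>s. l s - (ev l (\<phi> j) / ev k (\<phi> j)) * k s)" for l
    define \<Lambda>' where "\<Lambda>' = shift ` \<Lambda>"
    have ev_shift: "ev (shift l) v = ev l v - (ev l (\<phi> j) / ev k (\<phi> j)) * ev k v" for l v
      unfolding shift_def by (rule ev_diff')
    have "in_span I \<phi> (insert j S) v \<longleftrightarrow> (\<forall>l\<in>\<Lambda>'. ev l v = 0)" for v
    proof -
      have "in_span I \<phi> (insert j S) v \<longleftrightarrow> (\<exists>c. \<forall>l\<in>\<Lambda>. ev l v = c * ev l (\<phi> j))"
        unfolding split \<Lambda>(2) ev_def[symmetric] ev_diff by simp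
      also have "\<dots> \<longleftrightarrow> (\<forall>l\<in>\<Lambda>. ev l v = (ev k v / ev k (\<phi> j)) * ev l (\<phi> j))"
      proof
        assume "\<exists>c. \<forall>l\<in>\<Lambda>. ev l v = c * ev l (\<phi> j)"
        then obtain c where c: "\<forall>l\<in>\<Lambda>. ev l v = c * ev l (\<phi> j)" by blast
        then have "c = ev k v / ev k (\<phi> j)" using k by simp
        then show "\<forall>l\<in>\<Lambda>. ev l v = (ev k v / ev k (\<phi> j)) * ev l (\<phi> j)" using c by blast
      qed blast
      also have "\<dots> \<longleftrightarrow> (\<forall>l\<in>\<Lambda>'. ev l v = 0)"
        by (simp add: \<Lambda>'_def ev_shift mult.commute)
      finally show ?thesis .
    qed
    moreover have "finite \<Lambda>'" using \<Lambda>(1) by (simp add: \<Lambda>'_def)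
    ultimately show ?thesis unfolding ev_def by blast
  qed
qed

text \<open>
  Gaussian elimination of one equation and one unknown at a time.
\<close>

lemma homogeneous_system_nontrivial:
  fixes c :: "'i \<Rightarrow> 'j \<Rightarrow> complex"
  assumes "finite B" "finite A" "card B < card A"
  shows "\<exists>a. (\<exists>i\<in>A. a i \<noteq> 0) \<and> (\<forall>j\<in>B. (\<Sum>i\<in>A. a i * c i j) = 0)"
  using assms
proof (induction B arbitrary: A c rule: finite_induct)
  case empty
  then have "A \<noteq> {}" by auto
  then show ?case by (intro exI[of _ "\<lambda>_. 1"]) auto
next
  case (insert j0 B)
  show ?case
  proof (cases "\<forall>i\<in>A. c i j0 = 0")
    case True
    obtain a where "\<exists>i\<in>A. a i \<noteq> 0" "\<forall>j\<in>B. (\<Sum>i\<in>A. a i * c i j) = 0"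
      using insert.IH[of A c] insert.prems insert.hyps by auto
    then show ?thesis using True by (intro exI[of _ a]) auto
  next
    case False
    then obtain i0 where i0: "i0 \<in> A" "c i0 j0 \<noteq> 0" by blast
    define A' where "A' = A - {i0}"
    define r where "r i = c i j0 / c i0 j0" for i
    have A: "A = insert i0 A'" "i0 \<notin> A'" "finite A'" using i0 insert.prems by (auto simp: A'_def)
    have "card B < card A'" using insert.prems insert.hyps A by simp
    then obtain a where a: "\<exists>i\<in>A'. a i \<noteq> 0" "\<forall>j\<in>B. (\<Sum>i\<in>A'. a i * (c i j - r i * c i0 j)) = 0"
      using insert.IH[of A' "\<lambda>i j. c i j - r i * c i0 j"] A by auto
    \<comment> \<open>The unknown \<open>i0\<close> is determined by equation \<open>j0\<close> and eliminated from the others.\<close>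
    define b where "b i = (if i = i0 then - (\<Sum>i\<in>A'. a i * r i) else a i)" for i
    have b: "(\<Sum>i\<in>A. b i * c i j) = (\<Sum>i\<in>A'. a i * (c i j - r i * c i0 j))" for j
    proof -
      have "(\<Sum>i\<in>A'. b i * c i j) = (\<Sum>i\<in>A'. a i * c i j)"
        using A by (intro sum.cong) (auto simp: b_def)
      then have "(\<Sum>i\<in>A. b i * c i j) = - (\<Sum>i\<in>A'. a i * r i) * c i0 j + (\<Sum>i\<in>A'. a i * c i j)"
        using A by (simp add: b_def)
      then show ?thesis by (simp add: algebra_simps sum_subtractf sum_distrib_left)
    qed
    have "(\<Sum>i\<in>A. b i * c i j0) = 0" unfolding b r_def using i0 by simp
    moreover have "\<exists>i\<in>A. b i \<noteq> 0" using a(1) A by (auto simp: b_def)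
    ultimately show ?thesis using a(2) b by (intro exI[of _ b]) auto
  qed
qed

abbreviation Phi_span :: "nat \<Rightarrow> (nat + nat) set \<Rightarrow> (nat \<Rightarrow> complex) \<Rightarrow> bool" where
  "Phi_span N S v \<equiv> in_span {..<N} (\<lambda>i s. Phi N s i) S v"

section \<open>Unique sparsest solutions\<close>

definition supp :: "nat \<Rightarrow> (nat + nat \<Rightarrow> complex) \<Rightarrow> (nat + nat) set" where
  "supp N a = {i \<in> idx N. a i \<noteq> 0}"

lemma finite_idx [simp]: "finite (idx N)"
  by (simp add: idx_def)

lemma sum_idx_restrict:
  assumes "S \<subseteq> idx N" "\<And>i. i \<in> idx N \<Longrightarrow> i \<notin> S \<Longrightarrow> a i = 0"
  shows "(\<Sum>i\<in>idx N. Phi N s i * a i) = (\<Sum>i\<in>S. a i * Phi N s i)"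
  using assms by (intro sum.mono_neutral_cong_right) auto

text \<open>
  If all columns of \<open>S\<close> were in the span of \<open>S'\<close>, so would be those of \<open>S\<close> and one index of \<open>S' - S\<close>. These
  are more than \<open>card S'\<close> vectors in a space spanned by \<open>card S'\<close> vectors, hence dependent. If \<open>S'\<close> is a
  proper subset of \<open>S\<close>, the columns of \<open>S\<close> are already too many.
\<close>

lemma exists_column_outside_span:
  assumes S: "S \<subseteq> idx N" and S': "S' \<subseteq> idx N" "S' \<noteq> S" "card S' \<le> card S"
    and indep: "\<And>\<gamma>. \<gamma> \<in> idx N \<Longrightarrow> indep_cols N (insert \<gamma> S)"
  shows "\<exists>\<gamma>\<in>S. \<not> Phi_span N S' (\<lambda>s. Phi N s \<gamma>)"
proof (rule ccontr)
  assume "\<not> ?thesis"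
  then have all: "\<And>\<gamma>. \<gamma> \<in> S \<Longrightarrow> Phi_span N S' (\<lambda>s. Phi N s \<gamma>)" by blast
  have fin: "finite S" "finite S'" using finite_subset[OF S finite_idx] finite_subset[OF S'(1) finite_idx] by auto
  have dependent: False
    if A: "A \<subseteq> insert \<gamma> S" "\<gamma> \<in> idx N" "card S' < card A" and sp: "\<And>i. i \<in> A \<Longrightarrow> Phi_span N S' (\<lambda>s. Phi N s i)" for A \<gamma>
  proof -
    have finA: "finite A" using A fin finite_subset by auto
    have AI: "A \<subseteq> idx N" using A S by auto
    have "\<forall>i\<in>A. \<exists>c. \<forall>s\<in>{..<N}. Phi N s i = (\<Sum>j\<in>S'. c j * Phi N s j)"
      using sp unfolding in_span_def by blast
    then obtain c where c: "\<And>i s. i \<in> A \<Longrightarrow> s < N \<Longrightarrow> Phi N s i = (\<Sum>j\<in>S'. c i j * Phi N s j)"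
      by (metis lessThan_iff)
    obtain a where a: "\<exists>i\<in>A. a i \<noteq> 0" "\<And>j. j \<in> S' \<Longrightarrow> (\<Sum>i\<in>A. a i * c i j) = 0"
      using homogeneous_system_nontrivial[OF fin(2) finA A(3), of c] by blast
    define b where "b i = (if i \<in> A then a i else 0)" for i
    have "(\<Sum>i\<in>idx N. Phi N s i * b i) = 0" if s: "s < N" for s
    proof -
      have "(\<Sum>i\<in>idx N. Phi N s i * b i) = (\<Sum>i\<in>A. b i * Phi N s i)"
        by (rule sum_idx_restrict[OF AI]) (simp add: b_def)
      also have "\<dots> = (\<Sum>i\<in>A. a i * (\<Sum>j\<in>S'. c i j * Phi N s j))"
        by (intro sum.cong refl) (simp add: b_def c[OF _ s, symmetric])
      also have "\<dots> = (\<Sum>i\<in>A. \<Sum>j\<in>S'. a i * c i j * Phi N s j)" by (simp add: sum_distrib_left mult.assoc)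
      also have "\<dots> = (\<Sum>j\<in>S'. (\<Sum>i\<in>A. a i * c i j) * Phi N s j)"
        by (subst sum.swap) (simp add: sum_distrib_right)
      also have "\<dots> = 0" using a(2) by simp
      finally show ?thesis .
    qed
    moreover have "\<forall>i. i \<notin> insert \<gamma> S \<longrightarrow> b i = 0" using A(1) by (auto simp: b_def)
    ultimately have "\<forall>i. b i = 0" using indep[OF A(2)] unfolding indep_cols_def by blast
    then show False using a(1) by (metis b_def)
  qed
  show False
  proof (cases "S' \<subseteq> S")
    case True
    then have lt: "card S' < card S" using S' fin psubset_card_mono by blast
    then obtain \<gamma> where "\<gamma> \<in> S" by (metis card.empty equals0I not_less_zero)
    then show False using dependent[of S \<gamma>] lt all S by auto
  next
    case False
    then obtain \<gamma> where \<gamma>: "\<gamma> \<in> S'" "\<gamma> \<notin> S" by blast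
    have "Phi_span N S' (\<lambda>s. Phi N s \<gamma>)"
      unfolding in_span_def using \<gamma> fin
      by (intro exI[of _ "\<lambda>i. if i = \<gamma> then 1 else 0"]) (simp add: if_distrib[of "\<lambda>x. x * _"] cong: if_cong)
    then show False using dependent[of "insert \<gamma> S" \<gamma>] \<gamma> S' all fin by auto
  qed
qed

lemma P0_unique_iff:
  assumes "\<alpha> \<in> coeff_vecs N"
  shows "P0_solutions N (synth N \<alpha>) = {\<alpha>} \<longleftrightarrow>
    (\<forall>\<alpha>'\<in>coeff_vecs N. synth N \<alpha>' = synth N \<alpha> \<longrightarrow> \<alpha>' \<noteq> \<alpha> \<longrightarrow> l0 N \<alpha> < l0 N \<alpha>')" (is "_ = ?R")
proof
  assume sol: "P0_solutions N (synth N \<alpha>) = {\<alpha>}"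
  show ?R
  proof (intro ballI impI, rule ccontr)
    fix \<alpha>' assume \<alpha>': "\<alpha>' \<in> coeff_vecs N" "synth N \<alpha>' = synth N \<alpha>" "\<alpha>' \<noteq> \<alpha>" "\<not> l0 N \<alpha> < l0 N \<alpha>'"
    have "\<alpha> \<in> P0_solutions N (synth N \<alpha>)" using sol by simp
    then have "\<And>b. b \<in> coeff_vecs N \<Longrightarrow> synth N b = synth N \<alpha> \<Longrightarrow> \<not> l0 N b < l0 N \<alpha>"
      unfolding P0_solutions_def is_arg_min_def by blast
    then have "\<alpha>' \<in> P0_solutions N (synth N \<alpha>)"
      using \<alpha>' unfolding P0_solutions_def is_arg_min_def by (auto simp: not_less) (meson leD le_trans not_le)
    then show False using sol \<alpha>' by simp
  qed
next
  assume ?R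
  then show "P0_solutions N (synth N \<alpha>) = {\<alpha>}"
    using assms unfolding P0_solutions_def is_arg_min_def by (auto dest: less_asym)
qed

lemma synth_eq_iff: "synth N a = synth N b \<longleftrightarrow> (\<forall>s<N. (\<Sum>i\<in>idx N. Phi N s i * a i) = (\<Sum>i\<in>idx N. Phi N s i * b i))"
  unfolding synth_def by (auto simp: restrict_def fun_eq_iff)

text \<open>
  A competitor with a different support puts the signal into the span of at most as many columns; a
  competitor with the same support is a dependency in that support. This form exhibits the event as a
  finite Boolean combination of linear conditions.
\<close>

lemma P0_unique_iff_spans:
  assumes \<alpha>: "\<alpha> \<in> coeff_vecs N"
  shows "P0_solutions N (synth N \<alpha>) = {\<alpha>} \<longleftrightarrow> indep_cols N (supp N \<alpha>) \<and>
    (\<forall>S'. S' \<subseteq> idx N \<and> S' \<noteq> supp N \<alpha> \<and> card S' \<le> card (supp N \<alpha>) \<longrightarrow> \<not> Phi_span N S' (synth N \<alpha>))"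
    (is "_ \<longleftrightarrow> ?A \<and> ?B")
proof -
  have fs: "finite (supp N a)" for a by (simp add: supp_def)
  have l0: "l0 N a = card (supp N a)" for a by (simp add: l0_def supp_def)
  have syn: "synth N a s = (\<Sum>i\<in>idx N. Phi N s i * a i)" if "s < N" for a s using that by (simp add: synth_def)
  have ext: "a = b" if "a \<in> coeff_vecs N" "b \<in> coeff_vecs N" "\<And>i. i \<in> idx N \<Longrightarrow> a i = b i" for a b
    using that unfolding coeff_vecs_def by (intro PiE_ext) auto
  show ?thesis
    unfolding P0_unique_iff[OF \<alpha>]
  proof (intro iffI conjI)
    assume uniq: "\<forall>\<alpha>'\<in>coeff_vecs N. synth N \<alpha>' = synth N \<alpha> \<longrightarrow> \<alpha>' \<noteq> \<alpha> \<longrightarrow> l0 N \<alpha> < l0 N \<alpha>'"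
    show ?A
      unfolding indep_cols_def
    proof (intro allI impI)
      fix a i
      assume a: "\<forall>i. i \<notin> supp N \<alpha> \<longrightarrow> a i = 0" "\<forall>s<N. (\<Sum>i\<in>idx N. Phi N s i * a i) = 0"
      define \<alpha>' where "\<alpha>' = (\<lambda>i\<in>idx N. \<alpha> i + a i)"
      have c: "\<alpha>' \<in> coeff_vecs N" by (simp add: \<alpha>'_def coeff_vecs_def)
      have "synth N \<alpha>' = synth N \<alpha>"
        unfolding synth_eq_iff \<alpha>'_def using a(2) by (simp add: distrib_left sum.distrib)
      moreover have "l0 N \<alpha>' \<le> l0 N \<alpha>"
        unfolding l0 using a(1) by (intro card_mono fs) (auto simp: supp_def \<alpha>'_def)
      ultimately have "\<alpha>' = \<alpha>" using uniq c by (meson not_less)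
      then have "\<alpha> i + a i = \<alpha> i" if "i \<in> idx N" using that by (metis \<alpha>'_def restrict_apply')
      then show "a i = 0" using a(1) by (cases "i \<in> idx N") (auto simp: supp_def)
    qed
    show ?B
    proof (intro allI impI notI)
      fix S' assume S': "S' \<subseteq> idx N \<and> S' \<noteq> supp N \<alpha> \<and> card S' \<le> card (supp N \<alpha>)" and "Phi_span N S' (synth N \<alpha>)"
      then obtain a where a: "\<And>s. s < N \<Longrightarrow> synth N \<alpha> s = (\<Sum>i\<in>S'. a i * Phi N s i)"
        unfolding in_span_def by auto
      define \<alpha>' where "\<alpha>' = (\<lambda>i\<in>idx N. if i \<in> S' then a i else 0)"
      have fS': "finite S'" using S' finite_subset[OF _ finite_idx] by blast
      have c: "\<alpha>' \<in> coeff_vecs N" by (simp add: \<alpha>'_def coeff_vecs_def)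
      have "synth N \<alpha>' s = synth N \<alpha> s" if s: "s < N" for s
      proof -
        have "synth N \<alpha>' s = (\<Sum>i\<in>S'. \<alpha>' i * Phi N s i)"
          unfolding syn[OF s] using S' by (intro sum_idx_restrict) (auto simp: \<alpha>'_def)
        also have "\<dots> = (\<Sum>i\<in>S'. a i * Phi N s i)"
          using S' by (intro sum.cong refl) (auto simp: \<alpha>'_def)
        finally show ?thesis using a[OF s] by simp
      qed
      then have "synth N \<alpha>' = synth N \<alpha>" unfolding synth_eq_iff by (simp add: syn)
      moreover have sub: "supp N \<alpha>' \<subseteq> S'" by (auto simp: supp_def \<alpha>'_def)
      then have "l0 N \<alpha>' \<le> l0 N \<alpha>" unfolding l0 using S' card_mono[OF fS' sub] by linarith
      ultimately have "\<alpha>' = \<alpha>" using uniq c by (meson not_less)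
      then have "supp N \<alpha> \<subseteq> S'" using sub by simp
      then show False using S' fS' by (metis card_seteq)
    qed
  next
    assume AB: "?A \<and> ?B"
    show "\<forall>\<alpha>'\<in>coeff_vecs N. synth N \<alpha>' = synth N \<alpha> \<longrightarrow> \<alpha>' \<noteq> \<alpha> \<longrightarrow> l0 N \<alpha> < l0 N \<alpha>'"
    proof (intro ballI impI, rule ccontr)
      fix \<alpha>' assume \<alpha>': "\<alpha>' \<in> coeff_vecs N" "synth N \<alpha>' = synth N \<alpha>" "\<alpha>' \<noteq> \<alpha>" "\<not> l0 N \<alpha> < l0 N \<alpha>'"
      show False
      proof (cases "supp N \<alpha>' = supp N \<alpha>")
        case False
        have "Phi_span N (supp N \<alpha>') (synth N \<alpha>)"
          unfolding in_span_def
        proof (intro exI[of _ \<alpha>'] ballI)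
          fix s assume "s \<in> {..<N}"
          then have "synth N \<alpha> s = (\<Sum>i\<in>idx N. Phi N s i * \<alpha>' i)" using \<alpha>'(2) syn by (metis lessThan_iff)
          also have "\<dots> = (\<Sum>i\<in>supp N \<alpha>'. \<alpha>' i * Phi N s i)"
            by (rule sum_idx_restrict) (auto simp: supp_def)
          finally show "synth N \<alpha> s = (\<Sum>i\<in>supp N \<alpha>'. \<alpha>' i * Phi N s i)" .
        qed
        moreover have "supp N \<alpha>' \<subseteq> idx N" by (auto simp: supp_def)
        ultimately show False using AB False \<alpha>'(4) unfolding l0 by (auto simp: not_less)
      next
        case True
        define a where "a i = (if i \<in> idx N then \<alpha>' i - \<alpha> i else 0)" for i
        have "\<forall>i. i \<notin> supp N \<alpha> \<longrightarrow> a i = 0" using True by (auto simp: a_def supp_def)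
        moreover have "\<forall>s<N. (\<Sum>i\<in>idx N. Phi N s i * a i) = 0"
          using \<alpha>'(2) unfolding synth_eq_iff by (simp add: a_def right_diff_distrib sum_subtractf)
        ultimately have "\<forall>i. a i = 0" using AB unfolding indep_cols_def by blast
        then have "\<alpha>' i = \<alpha> i" if "i \<in> idx N" for i using that by (metis a_def right_minus_eq)
        then show False using ext \<alpha>' \<alpha> by blast
      qed
    qed
  qed
qed

lemma functional_synth:
  "(\<Sum>s<N. l s * synth N \<alpha> s) = (\<Sum>i\<in>idx N. (\<Sum>s<N. l s * Phi N s i) * \<alpha> i)"
proof -
  have "(\<Sum>s<N. l s * synth N \<alpha> s) = (\<Sum>s<N. \<Sum>i\<in>idx N. l s * Phi N s i * \<alpha> i)"
    by (simp add: synth_def sum_distrib_left mult.assoc)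
  then show ?thesis by (subst (asm) sum.swap) (simp add: sum_distrib_right)
qed

section \<open>Almost sure uniqueness on a given support\<close>

abbreviation coeff_space :: "nat \<Rightarrow> (nat + nat \<Rightarrow> complex) measure" where
  "coeff_space N \<equiv> \<Pi>\<^sub>M i\<in>idx N. borel"

lemma space_coeff_space: "space (coeff_space N) = coeff_vecs N"
  by (simp add: space_PiM coeff_vecs_def)

lemma sets_linear_zero:
  "{\<alpha> \<in> space (coeff_space N). (\<Sum>i\<in>idx N. m i * \<alpha> i) = 0} \<in> sets (coeff_space N)"
  by measurable

lemma sets_Phi_span:
  assumes "S' \<subseteq> idx N"
  shows "{\<alpha> \<in> space (coeff_space N). Phi_span N S' (synth N \<alpha>)} \<in> sets (coeff_space N)"
proof -
  obtain \<Lambda> where \<Lambda>: "finite \<Lambda>" "\<And>v. Phi_span N S' v \<longleftrightarrow> (\<forall>l\<in>\<Lambda>. (\<Sum>s<N. l s * v s) = 0)"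
    using span_eq_annihilator[of "{..<N}" S' "\<lambda>i s. Phi N s i"] assms finite_subset[OF assms] by auto
  show ?thesis
    unfolding \<Lambda>(2) functional_synth
    by (rule sets.sets_Collect_finite_All[OF sets_linear_zero \<Lambda>(1)])
qed

text \<open>
  The support takes finitely many values, and on each of them uniqueness is a finite conjunction of
  linear conditions. Measurability is essential because a non-measurable event would have measure \<open>0\<close>.
\<close>

lemma sets_unique_event:
  "{\<alpha> \<in> space (coeff_space N). P0_solutions N (synth N \<alpha>) = {\<alpha>}} \<in> sets (coeff_space N)"
proof -
  let ?M = "coeff_space N"
  have supp: "{\<alpha> \<in> space ?M. supp N \<alpha> = S} \<in> sets ?M" if "S \<subseteq> idx N" for S
  proof -
    have "{\<alpha> \<in> space ?M. supp N \<alpha> = S} = {\<alpha> \<in> space ?M. \<forall>i\<in>idx N. (\<alpha> i = 0) = (i \<notin> S)}"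
      using that by (auto simp: supp_def)
    also have "\<dots> \<in> sets ?M" by measurable
    finally show ?thesis .
  qed
  have "{\<alpha> \<in> space ?M. P0_solutions N (synth N \<alpha>) = {\<alpha>}} =
    {\<alpha> \<in> space ?M. \<exists>S\<in>Pow (idx N). supp N \<alpha> = S \<and> (indep_cols N S \<and>
       (\<forall>S'\<in>{S'. S' \<subseteq> idx N \<and> S' \<noteq> S \<and> card S' \<le> card S}. \<not> Phi_span N S' (synth N \<alpha>)))}"
    unfolding space_coeff_space using P0_unique_iff_spans[of _ N] by (auto simp: supp_def)
  also have "\<dots> \<in> sets ?M"
  proof (intro sets.sets_Collect_finite_Ex sets.sets_Collect_conj sets.sets_Collect_const
      sets.sets_Collect_finite_All sets.sets_Collect_neg)
    show "finite (Pow (idx N))" by simp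
  qed (auto intro: supp sets_Phi_span)
  finally show ?thesis .
qed

text \<open>
  With the other coordinates fixed, only one value of the coordinate \<open>i0\<close> solves the equation.
\<close>

lemma AE_linear_form_nonzero:
  fixes \<mu> :: "complex measure"
  assumes \<mu>: "prob_space \<mu>" and sets: "sets \<mu> = sets borel" and atom: "\<And>z. emeasure \<mu> {z} = 0"
    and J: "finite J" "i0 \<in> J" and m: "m i0 \<noteq> (0 :: complex)"
  shows "AE x in (\<Pi>\<^sub>M i\<in>J. \<mu>). (\<Sum>i\<in>J. m i * x i) \<noteq> 0"
proof -
  interpret \<mu>: prob_space \<mu> by (rule \<mu>)
  interpret P: product_sigma_finite "\<lambda>_. \<mu>" by standard
  define J' where "J' = J - {i0}"
  have J': "J = insert i0 J'" "i0 \<notin> J'" "finite J'" using J by (auto simp: J'_def)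
  let ?P = "\<Pi>\<^sub>M i\<in>J. \<mu>"
  have [measurable_cong]: "sets \<mu> = sets borel" by (rule sets)
  define A where "A = {x \<in> space ?P. (\<Sum>i\<in>J. m i * x i) = 0}"
  have A: "A \<in> sets ?P" unfolding A_def by measurable
  have "emeasure ?P A = (\<integral>\<^sup>+x. indicator A x \<partial>?P)" using A by simp
  also have "\<dots> = (\<integral>\<^sup>+x. (\<integral>\<^sup>+y. indicator A (x(i0 := y)) \<partial>\<mu>) \<partial>(\<Pi>\<^sub>M i\<in>J'. \<mu>))"
    unfolding J'(1) using A J' by (intro P.product_nn_integral_insert) (auto simp: J'(1))
  also have "\<dots> = (\<integral>\<^sup>+x. 0 \<partial>(\<Pi>\<^sub>M i\<in>J'. \<mu>))"
  proof (intro nn_integral_cong)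
    fix x :: "'a \<Rightarrow> complex"
    define z where "z = - (\<Sum>i\<in>J'. m i * x i) / m i0"
    have "x(i0 := y) \<in> A \<Longrightarrow> y = z" for y
    proof -
      assume "x(i0 := y) \<in> A"
      moreover have "(\<Sum>i\<in>J. m i * (x(i0 := y)) i) = m i0 * y + (\<Sum>i\<in>J'. m i * x i)"
        using J' by (simp, intro sum.cong) auto
      ultimately have "m i0 * y + (\<Sum>i\<in>J'. m i * x i) = 0" by (simp add: A_def)
      then show "y = z" using m by (simp add: z_def field_simps eq_neg_iff_add_eq_0)
    qed
    then have "(\<integral>\<^sup>+y. indicator A (x(i0 := y)) \<partial>\<mu>) \<le> (\<integral>\<^sup>+y. indicator {z} y \<partial>\<mu>)"
      by (intro nn_integral_mono) (auto simp: indicator_def)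
    also have "\<dots> = 0" using atom sets by (subst nn_integral_indicator) auto
    finally show "(\<integral>\<^sup>+y. indicator A (x(i0 := y)) \<partial>\<mu>) = 0" by simp
  qed
  finally have "A \<in> null_sets ?P" using A by auto
  then show ?thesis by (intro AE_I'[of A]) (auto simp: A_def)
qed

lemma circular_continuousD:
  assumes "circular_continuous \<mu>"
  shows "prob_space \<mu>" "sets \<mu> = sets borel" "emeasure \<mu> {z} = 0"
proof -
  obtain g where g: "g \<in> borel_measurable lborel" "\<mu> = density lborel g"
    using assms unfolding circular_continuous_def by blast
  show "prob_space \<mu>" using assms unfolding circular_continuous_def by blast
  show "sets \<mu> = sets borel" using g by simp
  have "emeasure \<mu> {z} = (\<integral>\<^sup>+x. g x * indicator {z} x \<partial>lborel)"
    using g by (simp add: emeasure_density)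
  also have "\<dots> = 0" by (rule nn_integral_null_set) (simp add: null_sets_def)
  finally show "emeasure \<mu> {z} = 0" .
qed

lemma coeff_map_measurable:
  fixes \<mu> :: "complex measure"
  assumes "sets \<mu> = sets borel"
  shows "(\<lambda>x. \<lambda>i\<in>idx N. if i \<in> S then x i else 0) \<in> (\<Pi>\<^sub>M i\<in>S. \<mu>) \<rightarrow>\<^sub>M coeff_space N"
proof (rule measurable_restrict)
  fix i
  have [measurable_cong]: "sets \<mu> = sets borel" by (rule assms)
  show "(\<lambda>x. if i \<in> S then x i else 0) \<in> (\<Pi>\<^sub>M i\<in>S. \<mu>) \<rightarrow>\<^sub>M borel"
  proof (cases "i \<in> S")
    case True
    then have "(\<lambda>x. x i) \<in> (\<Pi>\<^sub>M i\<in>S. \<mu>) \<rightarrow>\<^sub>M \<mu>" by (rule measurable_component_singleton)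
    then show ?thesis using True assms by (simp cong: measurable_cong_sets)
  qed simp
qed

text \<open>
  For each competing support some equation of its span does not vanish on a column of \<open>S\<close>; it is then
  a nonzero linear form in the coefficients, which is almost surely nonzero.
\<close>

lemma AE_unique_solution:
  assumes \<mu>: "circular_continuous \<mu>" and T: "T \<subseteq> {..<N}" and W: "W \<subseteq> {..<N}" and N: "N > 0"
    and indep: "\<And>\<gamma>. \<gamma> \<in> idx N \<Longrightarrow> indep_cols N (insert \<gamma> (T <+> W))"
  shows "AE \<alpha> in coeff_law N \<mu> T W. P0_solutions N (synth N \<alpha>) = {\<alpha>}"
proof -
  define S where "S = T <+> W"
  define P where "P = (\<Pi>\<^sub>M i\<in>S. \<mu>)"
  define \<phi> :: "(nat + nat \<Rightarrow> complex) \<Rightarrow> nat + nat \<Rightarrow> complex"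
    where "\<phi> x = (\<lambda>i\<in>idx N. if i \<in> S then x i else 0)" for x
  note \<mu>D = circular_continuousD[OF \<mu>]
  have SI: "S \<subseteq> idx N" using T W by (auto simp: S_def idx_def)
  have finS: "finite S" by (rule finite_subset[OF SI finite_idx])
  have meas: "\<phi> \<in> P \<rightarrow>\<^sub>M coeff_space N"
    unfolding \<phi>_def P_def by (rule coeff_map_measurable[OF \<mu>D(2)])
  have nz: "AE x in P. (\<Sum>i\<in>S. m i * x i) \<noteq> 0" if "i0 \<in> S" "m i0 \<noteq> 0" for m i0
    unfolding P_def using \<mu>D finS that by (intro AE_linear_form_nonzero)
  have "AE x in P. \<forall>i\<in>S. x i \<noteq> 0"
  proof (rule AE_finite_allI[OF finS])
    fix i assume i: "i \<in> S"
    have "(\<Sum>j\<in>S. basis_vec i j * x j) = x i" for x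
      using i finS by (simp add: basis_vec_def if_distrib[of "\<lambda>c. c * _"] cong: if_cong)
    then show "AE x in P. x i \<noteq> 0" using nz[OF i, of "basis_vec i"] by (simp add: basis_vec_def)
  qed
  moreover have "AE x in P. \<forall>S'\<in>{S'. S' \<subseteq> idx N \<and> S' \<noteq> S \<and> card S' \<le> card S}. \<not> Phi_span N S' (synth N (\<phi> x))"
  proof (rule AE_finite_allI)
    fix S' assume S': "S' \<in> {S'. S' \<subseteq> idx N \<and> S' \<noteq> S \<and> card S' \<le> card S}"
    obtain \<gamma> where \<gamma>: "\<gamma> \<in> S" "\<not> Phi_span N S' (\<lambda>s. Phi N s \<gamma>)"
      using exists_column_outside_span[OF SI, of S'] S' indep unfolding S_def by blast
    have "finite S'" using S' by (auto intro: finite_subset)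
    then obtain \<Lambda> where \<Lambda>: "\<And>v. Phi_span N S' v \<longleftrightarrow> (\<forall>l\<in>\<Lambda>. (\<Sum>s<N. l s * v s) = 0)"
      using span_eq_annihilator[of "{..<N}" S' "\<lambda>i s. Phi N s i"] by auto
    obtain l where l: "l \<in> \<Lambda>" "(\<Sum>s<N. l s * Phi N s \<gamma>) \<noteq> 0" using \<gamma>(2) unfolding \<Lambda> by blast
    have eq: "(\<Sum>s<N. l s * synth N (\<phi> x) s) = (\<Sum>i\<in>S. (\<Sum>s<N. l s * Phi N s i) * x i)" for x
      unfolding functional_synth using SI by (intro sum.mono_neutral_cong_right) (auto simp: \<phi>_def)
    have "AE x in P. (\<Sum>i\<in>S. (\<Sum>s<N. l s * Phi N s i) * x i) \<noteq> 0"
      by (rule nz[OF \<gamma>(1)]) (rule l(2))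
    then show "AE x in P. \<not> Phi_span N S' (synth N (\<phi> x))"
      unfolding \<Lambda> by eventually_elim (use eq l(1) in metis)
  qed (rule finite_subset[of _ "Pow (idx N)"], auto)
  ultimately have "AE x in P. P0_solutions N (synth N (\<phi> x)) = {\<phi> x}"
  proof eventually_elim
    case (elim x)
    have c: "\<phi> x \<in> coeff_vecs N" by (simp add: \<phi>_def coeff_vecs_def)
    have supp: "supp N (\<phi> x) = S" using elim(1) SI by (auto simp: supp_def \<phi>_def)
    have "0 < N" by (rule N)
    then have "Inl 0 \<in> idx N" by (auto simp: idx_def)
    then have "indep_cols N (insert (Inl 0) S)" unfolding S_def by (rule indep)
    then have "indep_cols N S" unfolding indep_cols_def by blast
    then show ?case unfolding P0_unique_iff_spans[OF c] supp using elim(2) by blast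
  qed
  then show ?thesis
    unfolding coeff_law_def S_def[symmetric] P_def[symmetric] \<phi>_def[symmetric]
    using meas by (subst AE_distr_iff) (auto intro: sets_unique_event)
qed

section \<open>Probability of an exceptional support\<close>

lemma bernoulli_set_tail:
  assumes p: "0 \<le> p" "p \<le> 1" and c: "\<And>t. t < N \<Longrightarrow> \<bar>c t\<bar> \<le> 1"
  shows "measure (bernoulli_set N p) {W. p * (\<Sum>t<N. c t) + p * (\<Sum>t<N. (c t)\<^sup>2) + u \<le> (\<Sum>t\<in>W. c t)} \<le> exp (- u)"
  unfolding prob_bernoulli_set[OF p] using c by (intro sum_bernoulli_weight_tail p) auto

lemma prob_mono_bernoulli_set:
  assumes "\<And>W. W \<subseteq> {..<N} \<Longrightarrow> P W \<Longrightarrow> Q W"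
  shows "measure (bernoulli_set N p) {W. P W} \<le> measure (bernoulli_set N p) {W. Q W}"
  using set_bernoulli_set[of N p] assms
  by (intro measure_pmf.finite_measure_mono_AE AE_pmfI) auto

lemma prob_disj_le:
  "measure (measure_pmf M) {x. P x \<or> Q x} \<le> measure (measure_pmf M) {x. P x} + measure (measure_pmf M) {x. Q x}"
proof -
  have "{x. P x \<or> Q x} = {x. P x} \<union> {x. Q x}" by auto
  then show ?thesis by (simp add: measure_Un_le)
qed

lemma prob_Bex_le:
  assumes "finite K" "\<And>k. k \<in> K \<Longrightarrow> measure (measure_pmf M) {x. P k x} \<le> e"
  shows "measure (measure_pmf M) {x. \<exists>k\<in>K. P k x} \<le> real (card K) * e"
proof -
  have "{x. \<exists>k\<in>K. P k x} = (\<Union>k\<in>K. {x. P k x})" by auto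
  then have "measure (measure_pmf M) {x. \<exists>k\<in>K. P k x} \<le> (\<Sum>k\<in>K. measure (measure_pmf M) {x. P k x})"
    using assms by (simp add: measure_pmf.finite_measure_subadditive_finite)
  also have "\<dots> \<le> real (card K) * e" using assms(2) by (rule sum_bounded_above)
  finally show ?thesis .
qed

text \<open>
  Properties of a typical \<open>T\<close>. The parameter \<open>\<nu>\<close> stands for \<open>N\<^sup>1\<^sup>/\<^sup>4\<close>: entries of that inverse size are
  likely enough to follow from Bernstein's bound with exponentially small error in \<open>\<nu>\<^sup>2\<close>, and small
  enough to be negligible against powers of \<open>ln N\<close>.
\<close>

definition balanced :: "nat \<Rightarrow> real \<Rightarrow> real \<Rightarrow> nat set \<Rightarrow> bool" where
  "balanced N p \<nu> T \<longleftrightarrow> T \<subseteq> {..<N} \<and> real (card T) / real N \<le> p + 2 / \<nu> \<and>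
     (\<forall>w<N. \<forall>w'<N. w \<noteq> w' \<longrightarrow> cmod (time_gram N T w w') \<le> 4 / \<nu>)"

lemma prob_card_large:
  assumes p: "0 \<le> p" "p \<le> 1" and \<nu>: "\<nu> \<ge> 1" "real N = \<nu> ^ 4"
  shows "measure (bernoulli_set N p) {T. real (card T) / real N > p + 2 / \<nu>} \<le> exp (- (\<nu>\<^sup>2))"
proof -
  have "measure (bernoulli_set N p) {T. real (card T) / real N > p + 2 / \<nu>}
    \<le> measure (bernoulli_set N p) {T. p * (\<Sum>t<N. 1 / \<nu>) + p * (\<Sum>t<N. (1 / \<nu>)\<^sup>2) + \<nu>\<^sup>2 \<le> (\<Sum>t\<in>T. 1 / \<nu>)}"
  proof (rule prob_mono_bernoulli_set)
    fix T :: "nat set" assume "real (card T) / real N > p + 2 / \<nu>"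
    then have "real (card T) > (p + 2 / \<nu>) * \<nu> ^ 4"
      using \<nu> by (simp add: pos_less_divide_eq)
    also have "(p + 2 / \<nu>) * \<nu> ^ 4 = p * \<nu> ^ 4 + 2 * \<nu> ^ 3"
      using \<nu> by (simp add: field_simps power4_eq_xxxx power3_eq_cube)
    finally have "real (card T) / \<nu> \<ge> (p * \<nu> ^ 4 + 2 * \<nu> ^ 3) / \<nu>"
      using \<nu> by (intro divide_right_mono) auto
    also have "(p * \<nu> ^ 4 + 2 * \<nu> ^ 3) / \<nu> = p * \<nu> ^ 3 + 2 * \<nu>\<^sup>2"
      using \<nu> by (simp add: field_simps power4_eq_xxxx power3_eq_cube power2_eq_square)
    finally have "p * \<nu> ^ 3 + 2 * \<nu>\<^sup>2 \<le> real (card T) / \<nu>" .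
    moreover have "p * \<nu>\<^sup>2 \<le> \<nu>\<^sup>2" using p by (simp add: mult_left_le_one_le)
    moreover have "(\<Sum>t\<in>T. 1 / \<nu>) = real (card T) / \<nu>" by simp
    moreover have "p * (\<Sum>t<N. 1 / \<nu>) = p * \<nu> ^ 3" "p * (\<Sum>t<N. (1 / \<nu>)\<^sup>2) = p * \<nu>\<^sup>2"
      using \<nu> by (simp_all add: field_simps power4_eq_xxxx power3_eq_cube power2_eq_square)
    ultimately show "p * (\<Sum>t<N. 1 / \<nu>) + p * (\<Sum>t<N. (1 / \<nu>)\<^sup>2) + \<nu>\<^sup>2 \<le> (\<Sum>t\<in>T. 1 / \<nu>)"
      by linarith
  qed
  also have "\<dots> \<le> exp (- (\<nu>\<^sup>2))" using \<nu> by (intro bernoulli_set_tail p) auto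
  finally show ?thesis .
qed

text \<open>
  The entry is a sum over \<open>T\<close> of numbers that sum to \<open>0\<close> over all times, by orthogonality. Bernstein's
  bound is applied to these numbers scaled to size \<open>1 / \<nu>\<close>.
\<close>

lemma prob_time_gram_large_direction:
  assumes p: "0 \<le> p" "p \<le> 1" and \<nu>: "\<nu> \<ge> 1" "real N = \<nu> ^ 4"
    and w: "w < N" "w' < N" "w \<noteq> w'" and \<sigma>: "cmod \<sigma> = 1"
  shows "measure (bernoulli_set N p) {T. Re (\<sigma> * time_gram N T w w') > 2 / \<nu>} \<le> exp (- (\<nu>\<^sup>2))"
proof -
  \<comment> \<open>The summands of the entry have modulus \<open>1 / \<nu>\<^sup>4\<close>; the factor \<open>\<nu>\<^sup>3\<close> makes the variance term \<open>\<nu>\<^sup>2\<close>.\<close>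
  define c where "c t = \<nu> ^ 3 * Re (\<sigma> * (dft N w t * cnj (dft N w' t)))" for t
  have cd: "cmod (dft N w t) = 1 / \<nu>\<^sup>2" for w t
  proof -
    have "(cmod (dft N w t))\<^sup>2 = (1 / \<nu>\<^sup>2)\<^sup>2" using \<nu> by (simp add: cmod_dft power_divide)
    then show ?thesis using \<nu> by (subst (asm) power2_eq_iff_nonneg) auto
  qed
  have c1: "\<bar>c t\<bar> \<le> 1 / \<nu>" for t
  proof -
    have "\<bar>Re (\<sigma> * (dft N w t * cnj (dft N w' t)))\<bar> \<le> 1 / \<nu> ^ 4"
      using abs_Re_le_cmod[of "\<sigma> * (dft N w t * cnj (dft N w' t))"] \<sigma>
      by (simp add: norm_mult cd power4_eq_xxxx power2_eq_square)
    then have "\<nu> ^ 3 * \<bar>Re (\<sigma> * (dft N w t * cnj (dft N w' t)))\<bar> \<le> \<nu> ^ 3 * (1 / \<nu> ^ 4)"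
      using \<nu> by (intro mult_left_mono) auto
    also have "\<dots> = 1 / \<nu>" using \<nu> by (simp add: field_simps power4_eq_xxxx power3_eq_cube)
    finally show ?thesis using \<nu> by (simp add: c_def abs_mult)
  qed
  have csum: "(\<Sum>t\<in>T. c t) = \<nu> ^ 3 * Re (\<sigma> * time_gram N T w w')" for T
    by (simp add: c_def time_gram_def sum_distrib_left Re_sum)
  have "time_gram N {..<N} w w' = (\<Sum>t<N. dft N t w * cnj (dft N t w'))"
    unfolding time_gram_def by (simp add: dft_commute[of N w] dft_commute[of N w'])
  then have c0: "(\<Sum>t<N. c t) = 0" unfolding csum using dft_orthonormal[OF w(1,2)] w(3) by simp
  have "(\<Sum>t<N. (c t)\<^sup>2) \<le> (\<Sum>t<N. (1 / \<nu>)\<^sup>2)"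
    by (intro sum_mono) (metis c1 abs_ge_zero power2_abs power_mono)
  also have "\<dots> = \<nu>\<^sup>2" using \<nu> by (simp add: field_simps power4_eq_xxxx power2_eq_square)
  finally have c2: "(\<Sum>t<N. (c t)\<^sup>2) \<le> \<nu>\<^sup>2" .
  have "measure (bernoulli_set N p) {T. Re (\<sigma> * time_gram N T w w') > 2 / \<nu>}
    \<le> measure (bernoulli_set N p) {T. p * (\<Sum>t<N. c t) + p * (\<Sum>t<N. (c t)\<^sup>2) + \<nu>\<^sup>2 \<le> (\<Sum>t\<in>T. c t)}"
  proof (rule prob_mono_bernoulli_set)
    fix T :: "nat set" assume "Re (\<sigma> * time_gram N T w w') > 2 / \<nu>"
    then have "\<nu> ^ 3 * (2 / \<nu>) \<le> (\<Sum>t\<in>T. c t)"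
      unfolding csum using \<nu> by (intro mult_left_mono) auto
    moreover have "\<nu> ^ 3 * (2 / \<nu>) = 2 * \<nu>\<^sup>2" using \<nu> by (simp add: power3_eq_cube power2_eq_square)
    moreover have "p * (\<Sum>t<N. (c t)\<^sup>2) \<le> 1 * \<nu>\<^sup>2" using p c2 by (intro mult_mono) (auto simp: sum_nonneg)
    ultimately show "p * (\<Sum>t<N. c t) + p * (\<Sum>t<N. (c t)\<^sup>2) + \<nu>\<^sup>2 \<le> (\<Sum>t\<in>T. c t)"
      unfolding c0 by simp
  qed
  also have "\<dots> \<le> exp (- (\<nu>\<^sup>2))"
    using c1 \<nu> by (intro bernoulli_set_tail p) (meson divide_le_eq_1 order_trans zero_less_one less_le_trans)
  finally show ?thesis .
qed

text \<open>
  The four directions \<open>1, -1, \<i>, -\<i>\<close> control real and imaginary part from both sides.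
\<close>

lemma prob_unbalanced:
  assumes p: "0 \<le> p" "p \<le> 1" and \<nu>: "\<nu> \<ge> 1" "real N = \<nu> ^ 4"
  shows "measure (bernoulli_set N p) {T. \<not> balanced N p \<nu> T} \<le> (1 + 4 * (real N)\<^sup>2) * exp (- (\<nu>\<^sup>2))"
proof -
  define K where "K = {(w, w', \<sigma>). w < N \<and> w' < N \<and> w \<noteq> w' \<and> \<sigma> \<in> {1, -1, \<i>, -\<i>}}"
  let ?bad = "\<lambda>(w, w', \<sigma>) T. Re (\<sigma> * time_gram N T w w') > 2 / \<nu>"
  have sub: "K \<subseteq> {..<N} \<times> {..<N} \<times> {1, -1, \<i>, -\<i>}" by (auto simp: K_def)
  have finK: "finite K" by (rule finite_subset[OF sub]) auto
  have "card K \<le> card ({..<N} \<times> {..<N} \<times> {1, -1, \<i>, -\<i> :: complex})"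
    by (rule card_mono[OF _ sub]) auto
  also have "\<dots> \<le> N * (N * 4)"
    unfolding card_cartesian_product card_lessThan by (intro mult_left_mono order.trans[OF card_insert_le_m1]) (auto simp: card_insert_if)
  finally have "real (card K) \<le> real (N * (N * 4))" by (rule of_nat_mono)
  then have cK: "real (card K) \<le> 4 * (real N)\<^sup>2" by (simp add: power2_eq_square)
  have "measure (bernoulli_set N p) {T. \<not> balanced N p \<nu> T}
    \<le> measure (bernoulli_set N p) {T. real (card T) / real N > p + 2 / \<nu> \<or> (\<exists>k\<in>K. ?bad k T)}"
  proof (rule prob_mono_bernoulli_set, rule ccontr)
    fix T assume T: "T \<subseteq> {..<N}" "\<not> balanced N p \<nu> T"
      and nb: "\<not> (real (card T) / real N > p + 2 / \<nu> \<or> (\<exists>k\<in>K. ?bad k T))"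
    have "cmod (time_gram N T w w') \<le> 4 / \<nu>" if w: "w < N" "w' < N" "w \<noteq> w'" for w w'
    proof -
      have k: "Re (\<sigma> * time_gram N T w w') \<le> 2 / \<nu>" if "\<sigma> \<in> {1, -1, \<i>, -\<i>}" for \<sigma>
      proof -
        have "(w, w', \<sigma>) \<in> K" using w that by (simp add: K_def)
        then show ?thesis using nb by fastforce
      qed
      have "\<bar>Re (time_gram N T w w')\<bar> \<le> 2 / \<nu>" "\<bar>Im (time_gram N T w w')\<bar> \<le> 2 / \<nu>"
        using k[of 1] k[of "-1"] k[of \<i>] k[of "-\<i>"] by auto
      then show ?thesis using cmod_le[of "time_gram N T w w'"] by simp
    qed
    then show False using T nb by (auto simp: balanced_def not_less)
  qed
  also have "\<dots> \<le> exp (- (\<nu>\<^sup>2)) + real (card K) * exp (- (\<nu>\<^sup>2))"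
  proof (rule order_trans[OF prob_disj_le], intro add_mono prob_Bex_le finK)
    show "measure (bernoulli_set N p) {T. real (card T) / real N > p + 2 / \<nu>} \<le> exp (- (\<nu>\<^sup>2))"
      by (rule prob_card_large) fact+
    fix k assume "k \<in> K"
    then obtain w w' \<sigma> where k: "k = (w, w', \<sigma>)" "w < N" "w' < N" "w \<noteq> w'" "\<sigma> \<in> {1, -1, \<i>, -\<i>}"
      by (auto simp: K_def)
    have "cmod \<sigma> = 1" using k(5) by auto
    then show "measure (bernoulli_set N p) {T. ?bad k T} \<le> exp (- (\<nu>\<^sup>2))"
      unfolding k(1) case_prod_conv using k by (intro prob_time_gram_large_direction p \<nu>)
  qed
  also have "\<dots> \<le> (1 + 4 * (real N)\<^sup>2) * exp (- (\<nu>\<^sup>2))"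
    using cK by (simp add: distrib_right)
  finally show ?thesis .
qed

text \<open>
  The squared entries of a column of \<open>F P\<^sub>T F\<^sup>*\<close> sum to \<open>card T / N\<close>, and those off the diagonal are
  individually at most \<open>16 / \<nu>\<^sup>2\<close>. Scaled to at most \<open>1\<close>, their sum over \<open>W\<close> exceeds twice its mean by
  \<open>\<nu>\<close> only with probability \<open>exp (- \<nu>)\<close>.
\<close>

lemma prob_not_small_cols:
  assumes q: "0 \<le> q" "q \<le> 1" and \<nu>: "\<nu> \<ge> 1" and T: "balanced N p \<nu> T" and N: "N > 0"
  shows "measure (bernoulli_set N q) {W. \<not> small_cols {..<N} (time_gram N T) (2 * q * (p + 2 / \<nu>) + 16 / \<nu>) W}
    \<le> real N * exp (- \<nu>)"
proof -
  define c where "c i j = (if j = i then 0 else (cmod (time_gram N T j i))\<^sup>2 * \<nu>\<^sup>2 / 16)" for i j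
  have TI: "T \<subseteq> {..<N}" using T by (simp add: balanced_def)
  have c01: "0 \<le> c i j \<and> c i j \<le> 1" if "i < N" "j < N" for i j
  proof (cases "i = j")
    case False
    then have "(cmod (time_gram N T j i))\<^sup>2 \<le> (4 / \<nu>)\<^sup>2" using T that by (intro power_mono) (auto simp: balanced_def)
    then have "(cmod (time_gram N T j i))\<^sup>2 * \<nu>\<^sup>2 \<le> (4 / \<nu>)\<^sup>2 * \<nu>\<^sup>2" by (intro mult_right_mono) auto
    also have "\<dots> = 16" using \<nu> by (simp add: power_divide)
    finally show ?thesis by (auto simp: c_def)
  qed (simp add: c_def)
  let ?L = "2 * q * (p + 2 / \<nu>) + 16 / \<nu>"
  have "measure (bernoulli_set N q) {W. \<not> small_cols {..<N} (time_gram N T) ?L W}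
    \<le> measure (bernoulli_set N q) {W. \<exists>i\<in>{..<N}. q * (\<Sum>j<N. c i j) + q * (\<Sum>j<N. (c i j)\<^sup>2) + \<nu> \<le> (\<Sum>j\<in>W. c i j)}"
  proof (rule prob_mono_bernoulli_set)
    fix W assume W: "W \<subseteq> {..<N}" and "\<not> small_cols {..<N} (time_gram N T) ?L W"
    then obtain i where i: "i < N" "(norm_on {..<N} (punctured_col (time_gram N T) W i))\<^sup>2 > ?L"
      by (auto simp: small_cols_def not_le)
    have "(norm_on {..<N} (punctured_col (time_gram N T) W i))\<^sup>2 = (\<Sum>j\<in>W. if j = i then 0 else (cmod (time_gram N T j i))\<^sup>2)"
      unfolding norm_on_sq using W by (intro sum.mono_neutral_cong_right) (auto simp: punctured_col_def)
    moreover have "(\<Sum>j\<in>W. c i j) = (\<Sum>j\<in>W. (if j = i then 0 else (cmod (time_gram N T j i))\<^sup>2) * (\<nu>\<^sup>2 / 16))"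
      by (intro sum.cong) (auto simp: c_def)
    ultimately have Wc: "(\<Sum>j\<in>W. c i j) = (norm_on {..<N} (punctured_col (time_gram N T) W i))\<^sup>2 * (\<nu>\<^sup>2 / 16)"
      by (simp only: sum_distrib_right)
    have "(\<Sum>j<N. c i j) \<le> (\<Sum>j<N. (cmod (time_gram N T j i))\<^sup>2 * (\<nu>\<^sup>2 / 16))"
      by (intro sum_mono) (simp add: c_def)
    also have "\<dots> = real (card T) / real N * (\<nu>\<^sup>2 / 16)"
      using sum_time_gram_sq[OF TI i(1)] by (simp only: sum_distrib_right[symmetric])
    also have "\<dots> \<le> (p + 2 / \<nu>) * (\<nu>\<^sup>2 / 16)" using T by (intro mult_right_mono) (auto simp: balanced_def)
    finally have s: "(\<Sum>j<N. c i j) \<le> (p + 2 / \<nu>) * (\<nu>\<^sup>2 / 16)" .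
    have "(\<Sum>j<N. (c i j)\<^sup>2) \<le> (\<Sum>j<N. c i j)"
      using c01[OF i(1)] by (intro sum_mono) (simp add: power2_eq_square mult_left_le)
    then have "q * (\<Sum>j<N. c i j) + q * (\<Sum>j<N. (c i j)\<^sup>2) \<le> q * ((p + 2 / \<nu>) * (\<nu>\<^sup>2 / 16)) + q * ((p + 2 / \<nu>) * (\<nu>\<^sup>2 / 16))"
      using s q by (intro add_mono mult_left_mono) auto
    also have "\<dots> + \<nu> = ?L * (\<nu>\<^sup>2 / 16)" using \<nu> by (simp add: field_simps power2_eq_square)
    also have "\<dots> \<le> (\<Sum>j\<in>W. c i j)" unfolding Wc using i(2) by (intro mult_right_mono) auto
    finally show "\<exists>i\<in>{..<N}. q * (\<Sum>j<N. c i j) + q * (\<Sum>j<N. (c i j)\<^sup>2) + \<nu> \<le> (\<Sum>j\<in>W. c i j)"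
      using i(1) by auto
  qed
  also have "\<dots> \<le> real (card {..<N}) * exp (- \<nu>)"
    using c01 by (intro prob_Bex_le bernoulli_set_tail q) auto
  finally show ?thesis by simp
qed

definition good_pair :: "nat \<Rightarrow> nat set \<Rightarrow> nat set \<Rightarrow> bool" where
  "good_pair N T W \<longleftrightarrow> T \<subseteq> {..<N} \<and> W \<subseteq> {..<N} \<and> (\<forall>\<gamma>\<in>idx N. indep_cols N (insert \<gamma> (T <+> W)))"

lemma prob_dependent_given_balanced:
  assumes q: "0 \<le> q" "q < 1" and \<nu>: "\<nu> \<ge> 1" "real N = \<nu> ^ 4" and T: "balanced N p \<nu> T"
    and p: "0 \<le> p" "p + 2 / \<nu> \<le> 1 / 8" "q + 2 / \<nu> \<le> 1 / 8"
  defines "L \<equiv> 2 * q * (p + 2 / \<nu>) + 16 / \<nu>"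
  assumes L: "L \<le> 1 / 8" and n: "q * (1 + 16 * L) ^ (2 * n) \<le> (1 - q) / 16"
  shows "measure (bernoulli_set N q) {W. \<not> good_pair N T W}
    \<le> exp (- (\<nu>\<^sup>2)) + real N * exp (- \<nu>) + real N * (1 / 4) ^ n"
proof -
  let ?I = "{..<N}" and ?g = "time_gram N T"
  let ?big = "\<lambda>W. \<exists>x. (\<forall>j. j \<notin> W \<longrightarrow> x j = 0) \<and> norm_on ?I x > 0 \<and> norm_on ?I (kernel_op ?I (offdiag ?g W) x) \<ge> 1 / 2 * norm_on ?I x"
  have TI: "T \<subseteq> ?I" and cT: "real (card T) / real N \<le> p + 2 / \<nu>" using T by (auto simp: balanced_def)
  have "real N > 0" using \<nu> by simp
  then have N: "N > 0" by simp
  have L0: "L \<ge> 0" unfolding L_def using q p \<nu> by simp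
  have "measure (bernoulli_set N q) {W. \<not> good_pair N T W} \<le> measure (bernoulli_set N q)
    {W. (real (card W) / real N > q + 2 / \<nu> \<or> \<not> small_cols ?I ?g L W) \<or> (small_cols ?I ?g L W \<and> ?big W)}"
  proof (rule prob_mono_bernoulli_set, rule ccontr)
    fix W assume W: "W \<subseteq> ?I" and ng: "\<not> good_pair N T W"
      and nb: "\<not> ((real (card W) / real N > q + 2 / \<nu> \<or> \<not> small_cols ?I ?g L W) \<or> (small_cols ?I ?g L W \<and> ?big W))"
    have "indep_cols N (insert \<gamma> (T <+> W))" if "\<gamma> \<in> idx N" for \<gamma>
    proof (rule indep_cols_insert_of_compression[OF TI W that _ _ _ L])
      show "real (card T) / real N \<le> 1 / 8" using cT p by linarith
      show "real (card W) / real N \<le> 1 / 8" using nb p by linarith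
      show "small_cols ?I ?g L W" using nb by blast
      fix x assume "\<And>j. j \<notin> W \<Longrightarrow> x j = 0" "norm_on ?I x > 0"
      then show "norm_on ?I (kernel_op ?I (offdiag ?g W) x) < 1 / 2 * norm_on ?I x" using nb by (meson not_le)
    qed
    then show False using ng TI W by (simp add: good_pair_def)
  qed
  also have "\<dots> \<le> (exp (- (\<nu>\<^sup>2)) + real N * exp (- \<nu>)) + real N * (1 / 4) ^ n"
  proof (rule order_trans[OF prob_disj_le], rule add_mono)
    show "measure (bernoulli_set N q) {W. real (card W) / real N > q + 2 / \<nu> \<or> \<not> small_cols ?I ?g L W}
      \<le> exp (- (\<nu>\<^sup>2)) + real N * exp (- \<nu>)"
      unfolding L_def using q \<nu> T N
      by (intro order_trans[OF prob_disj_le] add_mono prob_card_large prob_not_small_cols) auto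
    have "measure (bernoulli_set N q) {W. small_cols ?I ?g L W \<and> ?big W}
      = (\<Sum>W | W \<subseteq> ?I \<and> small_cols ?I ?g L W \<and> ?big W. bernoulli_weight ?I q W)"
      using q by (intro prob_bernoulli_set) auto
    also have "\<dots> \<le> real (card ?I) * ((1 / 16) / (1 / 2)\<^sup>2) ^ n"
      using norm_on_time_gram_le[OF TI] q L0 n
      by (intro random_compression_bound) (auto simp: hermitian_time_gram mult.commute)
    finally show "measure (bernoulli_set N q) {W. small_cols ?I ?g L W \<and> ?big W} \<le> real N * (1 / 4) ^ n"
      by (simp add: power2_eq_square)
  qed
  finally show ?thesis .
qed

section \<open>From supports to signals\<close>

text \<open>
  Condition on the first component.
\<close>

lemma prob_pair_le:
  assumes A: "measure (measure_pmf A) {x. \<not> G x} \<le> a" and B: "\<And>x. G x \<Longrightarrow> measure (measure_pmf B) {y. \<not> H x y} \<le> b" and "0 \<le> b"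
  shows "measure (measure_pmf (pair_pmf A B)) {z. \<not> H (fst z) (snd z)} \<le> a + b"
proof -
  have a0: "0 \<le> a" using A measure_nonneg order_trans by blast
  have "emeasure (pair_pmf A B) {z. \<not> H (fst z) (snd z)}
      = (\<integral>\<^sup>+x. \<integral>\<^sup>+y. indicator {z. \<not> H (fst z) (snd z)} (x, y) \<partial>B \<partial>A)"
    by (subst nn_integral_pair_pmf'[symmetric]) simp
  also have "\<dots> = (\<integral>\<^sup>+x. emeasure B {y. \<not> H x y} \<partial>A)"
  proof (intro nn_integral_cong)
    fix x
    have "(\<integral>\<^sup>+y. indicator {z. \<not> H (fst z) (snd z)} (x, y) \<partial>B) = (\<integral>\<^sup>+y. indicator {y. \<not> H x y} y \<partial>B)"
      by (intro nn_integral_cong) (simp add: indicator_def)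
    then show "(\<integral>\<^sup>+y. indicator {z. \<not> H (fst z) (snd z)} (x, y) \<partial>B) = emeasure B {y. \<not> H x y}" by simp
  qed
  also have "\<dots> \<le> (\<integral>\<^sup>+x. indicator {x. \<not> G x} x + ennreal b \<partial>A)"
  proof (intro nn_integral_mono)
    fix x
    show "emeasure B {y. \<not> H x y} \<le> indicator {x. \<not> G x} x + ennreal b"
    proof (cases "G x")
      case True
      then show ?thesis using B[OF True] by (simp add: measure_pmf.emeasure_eq_measure ennreal_leI)
    next
      case False
      then show ?thesis using measure_pmf.emeasure_le_1[of B "{y. \<not> H x y}"]
        by (simp add: add_increasing2)
    qed
  qed
  also have "\<dots> = emeasure A {x. \<not> G x} + ennreal b"
    by (subst nn_integral_add) simp_all
  also have "\<dots> \<le> ennreal (a + b)"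
    using A a0 \<open>0 \<le> b\<close> by (simp add: measure_pmf.emeasure_eq_measure ennreal_plus[symmetric] ennreal_leI del: ennreal_plus)
  finally show ?thesis using a0 \<open>0 \<le> b\<close> by (simp add: measure_pmf.emeasure_eq_measure del: ennreal_plus)
qed

lemma coeff_law_props:
  assumes "circular_continuous \<mu>"
  shows "prob_space (coeff_law N \<mu> T W)" "sets (coeff_law N \<mu> T W) = sets (coeff_space N)"
proof -
  note \<mu>D = circular_continuousD[OF assms]
  show "prob_space (coeff_law N \<mu> T W)"
    unfolding coeff_law_def
    by (intro prob_space.prob_space_distr prob_space_PiM \<mu>D(1) coeff_map_measurable \<mu>D(2))
  show "sets (coeff_law N \<mu> T W) = sets (coeff_space N)" by (simp add: coeff_law_def)
qed

lemma prob_unique_ge: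
  assumes \<mu>: "circular_continuous \<mu>" and N: "N > 0"
    and \<delta>: "measure (pair_pmf (bernoulli_set N pT) (bernoulli_set N pW)) {z. \<not> good_pair N (fst z) (snd z)} \<le> \<delta>"
  shows "measure (signal_law N pT pW \<mu>)
    {\<alpha> \<in> space (signal_law N pT pW \<mu>). P0_solutions N (synth N \<alpha>) = {\<alpha>}} \<ge> 1 - \<delta>"
proof -
  let ?M = "pair_pmf (bernoulli_set N pT) (bernoulli_set N pW)"
  let ?f = "\<lambda>(T, W). coeff_law N \<mu> T W"
  let ?E = "{\<alpha> \<in> space (coeff_space N). P0_solutions N (synth N \<alpha>) = {\<alpha>}}"
  let ?G = "{z. good_pair N (fst z) (snd z)}"
  note props = coeff_law_props[OF \<mu>]
  have sets: "sets (signal_law N pT pW \<mu>) = sets (coeff_space N)"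
    unfolding signal_law_def by (rule sets_bind) (auto simp: props)
  have space: "space (signal_law N pT pW \<mu>) = space (coeff_space N)"
    by (rule sets_eq_imp_space_eq[OF sets])
  have f: "?f \<in> measure_pmf ?M \<rightarrow>\<^sub>M subprob_algebra (coeff_space N)"
    by (auto simp: space_subprob_algebra props intro!: prob_space_imp_subprob_space)
  have E: "?E \<in> sets (coeff_space N)" by (rule sets_unique_event)
  have em: "emeasure (signal_law N pT pW \<mu>) X = (\<integral>\<^sup>+z. emeasure (?f z) X \<partial>?M)" if "X \<in> sets (coeff_space N)" for X
    unfolding signal_law_def using that f by (intro emeasure_bind) auto
  have "emeasure ?M ?G = (\<integral>\<^sup>+z. indicator ?G z \<partial>?M)" by simp
  also have "\<dots> \<le> (\<integral>\<^sup>+z. emeasure (?f z) ?E \<partial>?M)"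
  proof (intro nn_integral_mono)
    fix z :: "nat set \<times> nat set"
    obtain T W where z: "z = (T, W)" by (cases z)
    show "indicator ?G z \<le> emeasure (?f z) ?E"
    proof (cases "good_pair N T W")
      case True
      interpret prob_space "coeff_law N \<mu> T W" by (rule props)
      have "AE \<alpha> in coeff_law N \<mu> T W. P0_solutions N (synth N \<alpha>) = {\<alpha>}"
        using True unfolding good_pair_def by (intro AE_unique_solution[OF \<mu> _ _ N]) auto
      then have "AE \<alpha> in coeff_law N \<mu> T W. \<alpha> \<in> ?E"
        using AE_space[of "coeff_law N \<mu> T W"]
        by eventually_elim (auto simp: sets_eq_imp_space_eq[OF props(2)])
      then have "emeasure (coeff_law N \<mu> T W) ?E = 1"
        using E props(2) by (intro emeasure_eq_1_AE) auto
      then show ?thesis by (simp add: z indicator_def)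
    qed (simp add: z)
  qed
  also have "\<dots> = emeasure (signal_law N pT pW \<mu>) ?E" using E by (rule em[symmetric])
  finally have le: "emeasure ?M ?G \<le> emeasure (signal_law N pT pW \<mu>) ?E" .
  have "emeasure (signal_law N pT pW \<mu>) ?E \<le> (\<integral>\<^sup>+z. 1 \<partial>?M)"
    unfolding em[OF E]
  proof (intro nn_integral_mono)
    fix z :: "nat set \<times> nat set"
    obtain T W where z: "z = (T, W)" by (cases z)
    interpret prob_space "coeff_law N \<mu> T W" by (rule props)
    show "emeasure (?f z) ?E \<le> 1" using emeasure_le_1 by (simp add: z)
  qed
  then have fin: "emeasure (signal_law N pT pW \<mu>) ?E < \<top>" by (simp add: le_less_trans)
  have "1 - \<delta> \<le> measure ?M ?G"
  proof -
    have "{z. \<not> good_pair N (fst z) (snd z)} = UNIV - ?G" by auto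
    then have "measure ?M {z. \<not> good_pair N (fst z) (snd z)} = 1 - measure ?M ?G"
      using measure_pmf.prob_compl[of ?G ?M] by simp
    then show ?thesis using \<delta> by simp
  qed
  also have "\<dots> \<le> measure (signal_law N pT pW \<mu>) ?E"
    unfolding measure_def using le fin by (rule enn2real_mono)
  finally show ?thesis unfolding space .
qed

section \<open>Choice of parameters\<close>

text \<open>
  Since \<open>2 p q \<le> (p + q)\<^sup>2 / 2 \<le> 1 / (2 b l)\<close>, the product \<open>L * n\<close> is at most \<open>11 / 10\<close> for
  \<open>n \<le> b * l + 1\<close>, where \<open>b * l\<close> stands for \<open>(\<beta> + 1) ln N\<close>. So \<open>(1 + 16 L)\<^sup>2\<^sup>n \<le> exp (32 n L)\<close> stays
  below \<open>exp 36\<close>, while \<open>q\<close> is at most \<open>1 / sqrt (b l)\<close> and compensates for it.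
\<close>

lemma compression_parameters:
  fixes b l p q \<nu> :: real
  assumes p: "0 \<le> p" and q: "0 \<le> q" and \<nu>1: "\<nu> \<ge> 1" and bl: "b * l \<ge> 1"
    and pq: "p + q \<le> 1 / sqrt (b * l)" and \<nu>: "200 * (b * l + 1) \<le> \<nu>" and big: "32 * exp 36 \<le> sqrt (b * l)"
    and n: "real n \<le> b * l + 1"
  defines "L \<equiv> 2 * q * (p + 2 / \<nu>) + 16 / \<nu>"
  shows "q < 1" "p + 2 / \<nu> \<le> 1 / 8" "q + 2 / \<nu> \<le> 1 / 8" "L \<le> 1 / 8"
    "q * (1 + 16 * L) ^ (2 * n) \<le> (1 - q) / 16"
proof -
  have s: "sqrt (b * l) > 0" using bl by simp
  have "1 / sqrt (b * l) \<le> 1 / (32 * exp 36)" using big by (intro frac_le) auto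
  then have x: "p + q \<le> 1 / (32 * exp 36)" using pq by linarith
  have "(1 :: real) / (32 * exp 36) \<le> 1 / (32 * 1)" by (intro divide_left_mono mult_left_mono) auto
  then have x': "p + q \<le> 1 / 32" using x by linarith
  have \<nu>i: "1 / \<nu> \<le> 1 / (200 * (b * l + 1))" using \<nu> bl \<nu>1 by (intro divide_left_mono) auto
  also have "\<dots> \<le> 1 / (200 * 2)" using bl by (intro divide_left_mono mult_left_mono) auto
  finally have \<nu>2: "1 / \<nu> \<le> 1 / 400" by simp
  have \<nu>0: "0 \<le> 1 / \<nu>" using \<nu>1 by simp
  show q1: "q < 1" using x' p by linarith
  show "p + 2 / \<nu> \<le> 1 / 8" "q + 2 / \<nu> \<le> 1 / 8" using x' \<nu>2 p q by auto
  have pq4: "2 * (q * p) \<le> (1 / 2) * (p + q)\<^sup>2"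
    using sum_squares_bound[of p q] by (simp add: power2_sum)
  have Lle: "L \<le> (1 / 2) * (p + q)\<^sup>2 + 20 * (1 / \<nu>)"
  proof -
    have "q * (1 / \<nu>) \<le> 1 * (1 / \<nu>)" using q1 \<nu>0 by (intro mult_right_mono) auto
    moreover have "L = 2 * (q * p) + 4 * (q * (1 / \<nu>)) + 16 * (1 / \<nu>)" by (simp add: L_def algebra_simps)
    ultimately show ?thesis using pq4 by linarith
  qed
  have L0: "L \<ge> 0" unfolding L_def using p q \<nu>1 by simp
  have "(p + q)\<^sup>2 \<le> (1 / 32)\<^sup>2" using x' p q by (intro power_mono) auto
  then have "(p + q)\<^sup>2 \<le> 1 / 1024" by (simp add: power2_eq_square)
  then show "L \<le> 1 / 8" using Lle \<nu>2 by linarith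
  have "(p + q)\<^sup>2 \<le> (1 / sqrt (b * l))\<^sup>2" using pq p q by (intro power_mono) auto
  also have "\<dots> = 1 / (b * l)" using bl by (simp add: power_divide)
  finally have sq: "(p + q)\<^sup>2 \<le> 1 / (b * l)" .
  have "real n * L \<le> (b * l + 1) * ((1 / 2) * (1 / (b * l)) + 20 * (1 / (200 * (b * l + 1))))"
    using n Lle sq \<nu>i L0 bl by (intro mult_mono) auto
  also have "\<dots> = 1 / 2 + 1 / 2 * (1 / (b * l)) + 1 / 10"
  proof -
    have "(x + 1) * ((1 / 2) * (1 / x) + 20 * (1 / (200 * (x + 1)))) = 1 / 2 + 1 / 2 * (1 / x) + 1 / 10"
      if "x \<ge> 1" for x :: real
    proof -
      have "(x + 1) * (20 * (1 / (200 * (x + 1)))) = 1 / 10" "(x + 1) * ((1 / 2) * (1 / x)) = 1 / 2 + 1 / 2 * (1 / x)"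
        using that by (simp_all add: field_simps)
      then show ?thesis by (simp only: distrib_left)
    qed
    then show ?thesis using bl .
  qed
  also have "1 / (b * l) \<le> 1" using bl by simp
  finally have nL: "real n * L \<le> 11 / 10" by simp
  have "(1 + 16 * L) ^ (2 * n) \<le> exp (16 * L) ^ (2 * n)"
    using L0 by (intro power_mono) (auto simp: exp_ge_add_one_self)
  also have "\<dots> = exp (32 * (real n * L))" by (simp add: exp_of_nat_mult[symmetric])
  also have "32 * (real n * L) \<le> 36" using nL by linarith
  finally have "q * (1 + 16 * L) ^ (2 * n) \<le> q * exp 36" using q by (intro mult_left_mono) auto
  also have "\<dots> \<le> 1 / (32 * exp 36) * exp 36" using x p by (intro mult_right_mono) auto
  also have "\<dots> = 1 / 32" by simp
  also have "\<dots> \<le> (1 - q) / 16" using x' p by simp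
  finally show "q * (1 + 16 * L) ^ (2 * n) \<le> (1 - q) / 16" .
qed

lemma failure_terms_eventually_small:
  fixes \<beta> :: real
  assumes "\<beta> \<ge> 1"
  shows "\<exists>N0. \<forall>N\<ge>N0. 200 * ((\<beta> + 1) * ln (real N) + 1) \<le> real N powr (1 / 4) \<and>
    32 * exp 36 \<le> sqrt ((\<beta> + 1) * ln (real N)) \<and>
    (2 + 4 * (real N)\<^sup>2) * exp (- ((real N powr (1 / 4))\<^sup>2)) + real N * exp (- (real N powr (1 / 4))) \<le> real N powr (- \<beta>)"
proof -
  have "\<beta> + 1 > 0" using assms by simp
  then have "\<forall>\<^sub>F N :: nat in at_top. 200 * ((\<beta> + 1) * ln (real N) + 1) \<le> real N powr (1 / 4)"
    by real_asymp
  moreover have "\<forall>\<^sub>F N :: nat in at_top. 32 * exp 36 \<le> sqrt ((\<beta> + 1) * ln (real N))"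
    using \<open>\<beta> + 1 > 0\<close> by real_asymp
  moreover have "\<forall>\<^sub>F N :: nat in at_top. (2 + 4 * (real N)\<^sup>2) * exp (- ((real N powr (1 / 4))\<^sup>2))
      + real N * exp (- (real N powr (1 / 4))) \<le> real N powr (- \<beta>)"
    using assms by real_asymp
  ultimately have "\<forall>\<^sub>F N :: nat in at_top. 200 * ((\<beta> + 1) * ln (real N) + 1) \<le> real N powr (1 / 4) \<and>
    32 * exp 36 \<le> sqrt ((\<beta> + 1) * ln (real N)) \<and>
    (2 + 4 * (real N)\<^sup>2) * exp (- ((real N powr (1 / 4))\<^sup>2)) + real N * exp (- (real N powr (1 / 4))) \<le> real N powr (- \<beta>)"
    by eventually_elim auto
  then show ?thesis unfolding eventually_sequentially .
qed

text \<open>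
  With \<open>n\<close> the least integer not below \<open>(\<beta> + 1) ln N\<close>, the main term \<open>N * 4\<^sup>-\<^sup>n\<close> is at most \<open>N\<^sup>-\<^sup>\<beta>\<close>,
  because \<open>4 \<ge> exp 1\<close>; the concentration errors are exponentially small in a power of \<open>N\<close>.
\<close>

lemma prob_not_good_pair:
  fixes \<beta> :: real
  assumes \<beta>: "\<beta> \<ge> 1" and N: "N \<ge> 3" and p: "p \<in> {0..1}" and q: "q \<in> {0..1}"
    and pq: "p + q \<le> 1 / sqrt ((\<beta> + 1) * ln (real N))"
    and N1: "200 * ((\<beta> + 1) * ln (real N) + 1) \<le> real N powr (1 / 4)"
    and N2: "32 * exp 36 \<le> sqrt ((\<beta> + 1) * ln (real N))"
    and N3: "(2 + 4 * (real N)\<^sup>2) * exp (- ((real N powr (1 / 4))\<^sup>2)) + real N * exp (- (real N powr (1 / 4)))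
      \<le> real N powr (- \<beta>)"
  shows "measure (pair_pmf (bernoulli_set N p) (bernoulli_set N q)) {z. \<not> good_pair N (fst z) (snd z)}
    \<le> 2 * real N powr (- \<beta>)"
proof -
  define b where "b = \<beta> + 1"
  define l where "l = ln (real N)"
  define \<nu> where "\<nu> = real N powr (1 / 4)"
  define n where "n = nat \<lceil>b * l\<rceil>"
  have "exp 1 \<le> real N" using exp_le N by (metis numeral_le_real_of_nat_iff order_trans)
  then have l1: "l \<ge> 1" using N by (simp add: l_def ln_ge_iff)
  have bl: "b * l \<ge> 1" using mult_mono[of 1 b 1 l] \<beta> l1 by (simp add: b_def)
  have n1: "b * l \<le> real n" "real n \<le> b * l + 1" using bl unfolding n_def by linarith+
  have "1 \<le> 200 * (b * l + 1)" using bl by simp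
  then have \<nu>1: "\<nu> \<ge> 1" using N1 unfolding \<nu>_def b_def l_def by (rule order_trans)
  have \<nu>4: "real N = \<nu> ^ 4" using N by (simp add: \<nu>_def powr_realpow[symmetric] powr_powr)
  have pr: "0 \<le> p" "p \<le> 1" "0 \<le> q" "q \<le> 1" using p q by auto
  note par = compression_parameters[OF pr(1,3) \<nu>1 bl pq[folded b_def l_def]
      N1[folded b_def l_def \<nu>_def] N2[folded b_def l_def] n1(2)]
  have "real N * (1 / 4) ^ n \<le> real N * real N powr (- b)"
  proof (intro mult_left_mono)
    have "exp (1 :: real) \<le> 4" using exp_le by simp
    then have "(1 / 4) ^ n \<le> (exp (- 1 :: real)) ^ n"
      by (intro power_mono) (auto simp: exp_minus field_simps)
    also have "\<dots> = exp (- real n)" by (simp add: exp_of_nat_mult[symmetric])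
    also have "\<dots> \<le> exp (- (b * l))" using n1 by simp
    also have "\<dots> = real N powr (- b)" using N by (simp add: powr_def l_def)
    finally show "(1 / 4) ^ n \<le> real N powr (- b)" .
  qed simp
  also have "\<dots> = real N powr (- \<beta>)"
    using N powr_add[of "real N" 1 "- b"] by (simp add: b_def)
  finally have main: "real N * (1 / 4) ^ n \<le> real N powr (- \<beta>)" .
  have "measure (pair_pmf (bernoulli_set N p) (bernoulli_set N q)) {z. \<not> good_pair N (fst z) (snd z)}
    \<le> (1 + 4 * (real N)\<^sup>2) * exp (- (\<nu>\<^sup>2)) + (exp (- (\<nu>\<^sup>2)) + real N * exp (- \<nu>) + real N * (1 / 4) ^ n)"
  proof (rule prob_pair_le[where G = "balanced N p \<nu>"])
    show "measure (bernoulli_set N p) {T. \<not> balanced N p \<nu> T} \<le> (1 + 4 * (real N)\<^sup>2) * exp (- (\<nu>\<^sup>2))"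
      by (rule prob_unbalanced) fact+
    fix T assume "balanced N p \<nu> T"
    then show "measure (bernoulli_set N q) {W. \<not> good_pair N T W}
      \<le> exp (- (\<nu>\<^sup>2)) + real N * exp (- \<nu>) + real N * (1 / 4) ^ n"
      using par pr \<nu>1 \<nu>4 by (intro prob_dependent_given_balanced) auto
  qed simp
  also have "\<dots> = ((2 + 4 * (real N)\<^sup>2) * exp (- (\<nu>\<^sup>2)) + real N * exp (- \<nu>)) + real N * (1 / 4) ^ n"
    by (simp add: algebra_simps)
  also have "\<dots> \<le> real N powr (- \<beta>) + real N powr (- \<beta>)"
    using main N3 unfolding \<nu>_def by (rule add_mono[rotated])
  finally show ?thesis by simp
qed

theorem theorem4p1:
  fixes \<beta> :: real
  assumes "\<beta> \<ge> 1"
  shows "\<exists>(\<epsilon> :: nat \<Rightarrow> real) (C :: real).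
    \<epsilon> \<longlonglongrightarrow> 0 \<and> C > 0 \<and>
    (\<forall>(N :: nat) (pT :: real) (pW :: real) (\<mu> :: complex measure).
       N \<ge> 512 \<longrightarrow> pT \<in> {0..1} \<longrightarrow> pW \<in> {0..1} \<longrightarrow> circular_continuous \<mu> \<longrightarrow>
       min (expected_card N pT) (expected_card N pW) \<ge> 4 * (\<beta> + 1) * ln (real N) \<longrightarrow>
       2 * sqrt (expected_card N pT * expected_card N pW)
         \<le> expected_card N pT + expected_card N pW \<longrightarrow>
       expected_card N pT + expected_card N pW
         \<le> real N / sqrt ((\<beta> + 1) * ln (real N)) * (rho0 / 2 + \<epsilon> N) \<longrightarrow>
       measure (signal_law N pT pW \<mu>)
           {\<alpha> \<in> space (signal_law N pT pW \<mu>). P0_solutions N (synth N \<alpha>) = {\<alpha>}}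
         \<ge> 1 - C * ln (real N) * real N powr (- \<beta>))"
proof -
  obtain N0 where N0: "\<And>N. N \<ge> N0 \<Longrightarrow> 200 * ((\<beta> + 1) * ln (real N) + 1) \<le> real N powr (1 / 4) \<and>
    32 * exp 36 \<le> sqrt ((\<beta> + 1) * ln (real N)) \<and>
    (2 + 4 * (real N)\<^sup>2) * exp (- ((real N powr (1 / 4))\<^sup>2)) + real N * exp (- (real N powr (1 / 4))) \<le> real N powr (- \<beta>)"
    using failure_terms_eventually_small[OF assms] by blast
  \<comment> \<open>Since \<open>rho0 / 2 < 1\<close>, the value \<open>-1\<close> makes the hypothesis contradictory below \<open>N0\<close>.\<close>
  define \<epsilon> :: "nat \<Rightarrow> real" where "\<epsilon> N = (if N < N0 then -1 else 0)" for N
  have "\<forall>\<^sub>F N in sequentially. \<epsilon> N = 0"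
    unfolding eventually_sequentially by (rule exI[of _ N0]) (simp add: \<epsilon>_def)
  then have \<epsilon>: "\<epsilon> \<longlonglongrightarrow> 0" by (rule tendsto_eventually)
  show ?thesis
  proof (intro exI[of _ \<epsilon>] exI[of _ 2] conjI allI impI \<epsilon>)
    fix N :: nat and pT pW :: real and \<mu> :: "complex measure"
    assume N: "N \<ge> 512" and pT: "pT \<in> {0..1}" and pW: "pW \<in> {0..1}" and \<mu>: "circular_continuous \<mu>"
      and lower: "min (expected_card N pT) (expected_card N pW) \<ge> 4 * (\<beta> + 1) * ln (real N)"
      and upper: "expected_card N pT + expected_card N pW
         \<le> real N / sqrt ((\<beta> + 1) * ln (real N)) * (rho0 / 2 + \<epsilon> N)"
    have "real N \<ge> 512" using N by simp
    then have "exp 1 \<le> real N" using exp_le by linarith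
    then have l1: "ln (real N) \<ge> 1" using N by (simp add: ln_ge_iff)
    define s where "s = sqrt ((\<beta> + 1) * ln (real N))"
    have s: "s > 0" unfolding s_def using l1 assms by simp
    have card: "expected_card N pT = pT * real N" "expected_card N pW = pW * real N"
      using pT pW by (auto intro: expected_card_eq)
    have pos: "4 * (\<beta> + 1) * ln (real N) > 0" using l1 assms by simp
    have "N \<ge> N0"
    proof (rule ccontr)
      assume "\<not> N \<ge> N0"
      then have "rho0 / 2 + \<epsilon> N < 0" by (simp add: \<epsilon>_def rho0_def)
      then have "real N / s * (rho0 / 2 + \<epsilon> N) \<le> 0" using s by (intro mult_nonneg_nonpos) auto
      then show False using lower upper pos unfolding s_def[symmetric] by (simp add: min_def split: if_splits)
    qed
    then have "\<epsilon> N = 0" by (simp add: \<epsilon>_def)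
    then have "(pT + pW) * real N \<le> (1 / s * (rho0 / 2)) * real N"
      using upper unfolding card s_def[symmetric] by (simp add: algebra_simps)
    then have "pT + pW \<le> 1 / s * (rho0 / 2)" using N by (subst (asm) mult_le_cancel_right) auto
    also have "\<dots> \<le> 1 / s * 1" using s by (intro mult_left_mono) (auto simp: rho0_def)
    finally have "pT + pW \<le> 1 / sqrt ((\<beta> + 1) * ln (real N))" by (simp add: s_def)
    then have "measure (signal_law N pT pW \<mu>)
        {\<alpha> \<in> space (signal_law N pT pW \<mu>). P0_solutions N (synth N \<alpha>) = {\<alpha>}} \<ge> 1 - 2 * real N powr (- \<beta>)"
      using N0[OF \<open>N \<ge> N0\<close>] N assms pT pW by (intro prob_unique_ge[OF \<mu>] prob_not_good_pair) auto
    moreover have "2 * 1 * real N powr (- \<beta>) \<le> 2 * ln (real N) * real N powr (- \<beta>)"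
      using l1 by (intro mult_right_mono mult_left_mono) auto
    ultimately show "measure (signal_law N pT pW \<mu>)
        {\<alpha> \<in> space (signal_law N pT pW \<mu>). P0_solutions N (synth N \<alpha>) = {\<alpha>}} \<ge> 1 - 2 * ln (real N) * real N powr (- \<beta>)"
      by linarith
  qed simp
qed

end
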